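(* There exist non-abelian torsion CCR locally compact contraction groups; that is, there exists a contraction group $(N,\alpha)$ such that $N$ is a non-abelian, torsion, locally compact group which is CCR.
   Context: A locally compact contraction group is a pair $(N,\alpha)$ with $N$ a locally compact group and $\alpha$ a bicontinuous automorphism of $N$ such that $\alpha^n(g)\to\mathrm{id}_N$ as $n\to\infty$ for all $g\in N$. It is torsion if every element of $N$ has finite order. A locally compact group is CCR if its group C$^*$-algebra is CCR, i.e. all irreducible $*$-representations have image in the compact operators. *)

theory Defs
  imports "HOL-Analysis.Analysis" "HOL-Algebra.Coset" "HOL-Algebra.Module"
begin

section \<open>Locally compact contraction groups\<close>

definition topological_group :: "('a, 'm) monoid_scheme \<Rightarrow> 'a topology \<Rightarrow> bool" where
  "topological_group G X \<longleftrightarrow>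
     group G \<and> topspace X = carrier G \<and>
     continuous_map (prod_topology X X) X (\<lambda>(x, y). x \<otimes>\<^bsub>G\<^esub> y) \<and>
     continuous_map X X (\<lambda>x. inv\<^bsub>G\<^esub> x)"

definition locally_compact_group :: "('a, 'm) monoid_scheme \<Rightarrow> 'a topology \<Rightarrow> bool" where
  "locally_compact_group G X \<longleftrightarrow>
     topological_group G X \<and> locally_compact_space X \<and> Hausdorff_space X"

definition lc_contraction_group ::
    "('a, 'm) monoid_scheme \<Rightarrow> 'a topology \<Rightarrow> ('a \<Rightarrow> 'a) \<Rightarrow> bool" where
  "lc_contraction_group G X \<alpha> \<longleftrightarrow>
     locally_compact_group G X \<and> \<alpha> \<in> iso G G \<and> homeomorphic_map X X \<alpha> \<and>
     (\<forall>g\<in>carrier G. limitin X (\<lambda>n. (\<alpha> ^^ n) g) \<one>\<^bsub>G\<^esub> sequentially)"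

definition torsion_group :: "('a, 'm) monoid_scheme \<Rightarrow> bool" where
  "torsion_group G \<longleftrightarrow> (\<forall>g\<in>carrier G. \<exists>n::nat. n > 0 \<and> g [^]\<^bsub>G\<^esub> n = \<one>\<^bsub>G\<^esub>)"


section \<open>Hilbert spaces and operators\<close>

definition complex_ring :: "complex ring" where
  "complex_ring = \<lparr>carrier = UNIV, mult = (*), one = 1, zero = 0, add = (+)\<rparr>"

text \<open>As usual for the record of modules, the fields for the product and the unit are meaningless
  for a vector space and nothing below refers to them.\<close>

record 'h inner_space = "(complex, 'h) module" +
  inner_prod :: "'h \<Rightarrow> 'h \<Rightarrow> complex"

definition hnorm :: "'h inner_space \<Rightarrow> 'h \<Rightarrow> real" where
  "hnorm H v = sqrt (Re (inner_prod H v v))"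

text \<open>The locale of metric spaces wants a function that is nonnegative and symmetric on the whole
  type, hence the value outside the carrier.\<close>

definition hdist :: "'h inner_space \<Rightarrow> 'h \<Rightarrow> 'h \<Rightarrow> real" where
  "hdist H v w =
     (if v \<in> carrier H \<and> w \<in> carrier H then hnorm H (v \<ominus>\<^bsub>H\<^esub> w) else 0)"

definition htopology :: "'h inner_space \<Rightarrow> 'h topology" where
  "htopology H = Metric_space.mtopology (carrier H) (hdist H)"

definition hilbert_space :: "'h inner_space \<Rightarrow> bool" where
  "hilbert_space H \<longleftrightarrow>
     Module.module complex_ring H \<and>
     (\<forall>u\<in>carrier H. \<forall>v\<in>carrier H. \<forall>w\<in>carrier H.
        inner_prod H (u \<oplus>\<^bsub>H\<^esub> v) w = inner_prod H u w + inner_prod H v w) \<and>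
     (\<forall>c. \<forall>v\<in>carrier H. \<forall>w\<in>carrier H.
        inner_prod H (c \<odot>\<^bsub>H\<^esub> v) w = c * inner_prod H v w) \<and>
     (\<forall>v\<in>carrier H. \<forall>w\<in>carrier H. inner_prod H w v = cnj (inner_prod H v w)) \<and>
     (\<forall>v\<in>carrier H. v \<noteq> \<zero>\<^bsub>H\<^esub> \<longrightarrow> Re (inner_prod H v v) > 0) \<and>
     Metric_space.mcomplete (carrier H) (hdist H)"

definition bounded_operator :: "'h inner_space \<Rightarrow> ('h \<Rightarrow> 'h) \<Rightarrow> bool" where
  "bounded_operator H T \<longleftrightarrow>
     T \<in> carrier H \<rightarrow> carrier H \<and>
     (\<forall>v\<in>carrier H. \<forall>w\<in>carrier H. T (v \<oplus>\<^bsub>H\<^esub> w) = T v \<oplus>\<^bsub>H\<^esub> T w) \<and>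
     (\<forall>c. \<forall>v\<in>carrier H. T (c \<odot>\<^bsub>H\<^esub> v) = c \<odot>\<^bsub>H\<^esub> T v) \<and>
     (\<exists>C. \<forall>v\<in>carrier H. hnorm H (T v) \<le> C * hnorm H v)"

definition operator_norm :: "'h inner_space \<Rightarrow> ('h \<Rightarrow> 'h) \<Rightarrow> real" where
  "operator_norm H T = (SUP v\<in>{v \<in> carrier H. hnorm H v \<le> 1}. hnorm H (T v))"

definition compact_operator :: "'h inner_space \<Rightarrow> ('h \<Rightarrow> 'h) \<Rightarrow> bool" where
  "compact_operator H T \<longleftrightarrow>
     bounded_operator H T \<and>
     compactin (htopology H) (htopology H closure_of (T ` {v \<in> carrier H. hnorm H v \<le> 1}))"


section \<open>Representations of *-algebras and the CCR property\<close>

text \<open>The algebras below have no unit in general; the field for the unit is not used.\<close>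

record 'x star_algebra = "(complex, 'x) module" +
  star :: "'x \<Rightarrow> 'x"

definition star_representation ::
    "'x star_algebra \<Rightarrow> 'h inner_space \<Rightarrow> ('x \<Rightarrow> 'h \<Rightarrow> 'h) \<Rightarrow> bool" where
  "star_representation A H \<pi> \<longleftrightarrow>
     hilbert_space H \<and>
     (\<forall>a\<in>carrier A. bounded_operator H (\<pi> a)) \<and>
     (\<forall>a\<in>carrier A. \<forall>b\<in>carrier A. \<forall>v\<in>carrier H. \<pi> (a \<oplus>\<^bsub>A\<^esub> b) v = \<pi> a v \<oplus>\<^bsub>H\<^esub> \<pi> b v) \<and>
     (\<forall>c. \<forall>a\<in>carrier A. \<forall>v\<in>carrier H. \<pi> (c \<odot>\<^bsub>A\<^esub> a) v = c \<odot>\<^bsub>H\<^esub> \<pi> a v) \<and>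
     (\<forall>a\<in>carrier A. \<forall>b\<in>carrier A. \<forall>v\<in>carrier H. \<pi> (a \<otimes>\<^bsub>A\<^esub> b) v = \<pi> a (\<pi> b v)) \<and>
     (\<forall>a\<in>carrier A. \<forall>v\<in>carrier H. \<forall>w\<in>carrier H.
        inner_prod H (\<pi> (star A a) v) w = inner_prod H v (\<pi> a w))"

definition irreducible_representation ::
    "'x star_algebra \<Rightarrow> 'h inner_space \<Rightarrow> ('x \<Rightarrow> 'h \<Rightarrow> 'h) \<Rightarrow> bool" where
  "irreducible_representation A H \<pi> \<longleftrightarrow>
     star_representation A H \<pi> \<and> carrier H \<noteq> {\<zero>\<^bsub>H\<^esub>} \<and>
     (\<forall>W. submodule W complex_ring H \<and> closedin (htopology H) W \<and>
          (\<forall>a\<in>carrier A. \<pi> a ` W \<subseteq> W) \<longrightarrow> W = {\<zero>\<^bsub>H\<^esub>} \<or> W = carrier H)"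

text \<open>HOL cannot quantify over all Hilbert spaces, so representations of an algebra with elements
  in the type \<open>'x\<close> are taken on Hilbert spaces whose carrier is an arbitrary set in the type
  \<open>'x \<Rightarrow> complex\<close>. Up to unitary equivalence no irreducible (or cyclic) representation is lost:
  if \<open>v\<close> is a cyclic vector, the vectors \<open>\<pi> a v\<close> are dense, so an orthonormal basis of the
  representation space injects into \<open>'x\<close>, and the space is isomorphic to a space of
  square-summable functions on a subset of \<open>'x\<close>.\<close>

definition CCR_algebra :: "'x star_algebra \<Rightarrow> bool" where
  "CCR_algebra A \<longleftrightarrow>
     (\<forall>(H :: ('x \<Rightarrow> complex) inner_space) \<pi>.
        irreducible_representation A H \<pi> \<longrightarrow> (\<forall>a\<in>carrier A. compact_operator H (\<pi> a)))"


section \<open>Completion of a *-algebra with respect to a seminorm\<close>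

definition Cauchy_sequences :: "'x star_algebra \<Rightarrow> ('x \<Rightarrow> real) \<Rightarrow> (nat \<Rightarrow> 'x) set" where
  "Cauchy_sequences A p =
     {s. range s \<subseteq> carrier A \<and>
         (\<forall>e>0. \<exists>N. \<forall>m\<ge>N. \<forall>n\<ge>N. p (s m \<ominus>\<^bsub>A\<^esub> s n) < e)}"

definition null_relation ::
    "'x star_algebra \<Rightarrow> ('x \<Rightarrow> real) \<Rightarrow> ((nat \<Rightarrow> 'x) \<times> (nat \<Rightarrow> 'x)) set" where
  "null_relation A p =
     {(s, t). s \<in> Cauchy_sequences A p \<and> t \<in> Cauchy_sequences A p \<and>
        (\<lambda>n. p (s n \<ominus>\<^bsub>A\<^esub> t n)) \<longlonglongrightarrow> 0}"

text \<open>Each union below is over equivalent sequences, hence a single equivalence class, because the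
  operations of the algebra respect the relation when \<open>p\<close> is a submultiplicative seminorm that is
  invariant under the involution.\<close>

definition completion :: "'x star_algebra \<Rightarrow> ('x \<Rightarrow> real) \<Rightarrow> (nat \<Rightarrow> 'x) set star_algebra" where
  "completion A p =
     \<lparr>carrier = Cauchy_sequences A p // null_relation A p,
      mult = (\<lambda>S T. \<Union>s\<in>S. \<Union>t\<in>T. null_relation A p `` {\<lambda>n. s n \<otimes>\<^bsub>A\<^esub> t n}),
      one = undefined,
      zero = null_relation A p `` {\<lambda>n. \<zero>\<^bsub>A\<^esub>},
      add = (\<lambda>S T. \<Union>s\<in>S. \<Union>t\<in>T. null_relation A p `` {\<lambda>n. s n \<oplus>\<^bsub>A\<^esub> t n}),
      smult = (\<lambda>c S. \<Union>s\<in>S. null_relation A p `` {\<lambda>n. c \<odot>\<^bsub>A\<^esub> s n}),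
      star = (\<lambda>S. \<Union>s\<in>S. null_relation A p `` {\<lambda>n. star A (s n)})\<rparr>"


section \<open>Haar measure and the group C*-algebra\<close>

text \<open>A left Haar measure: a nonzero left-invariant Radon measure on the Borel sets.\<close>

definition haar_measure :: "('a, 'm) monoid_scheme \<Rightarrow> 'a topology \<Rightarrow> 'a measure \<Rightarrow> bool" where
  "haar_measure G X M \<longleftrightarrow>
     space M = carrier G \<and> sets M = sigma_sets (carrier G) {U. openin X U} \<and>
     emeasure M (carrier G) \<noteq> 0 \<and>
     (\<forall>g\<in>carrier G. \<forall>E\<in>sets M. emeasure M (g <#\<^bsub>G\<^esub> E) = emeasure M E) \<and>
     (\<forall>K. compactin X K \<longrightarrow> emeasure M K < \<infinity>) \<and>
     (\<forall>E\<in>sets M. emeasure M E = (INF U\<in>{U. openin X U \<and> E \<subseteq> U}. emeasure M U)) \<and>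
     (\<forall>U. openin X U \<longrightarrow>
        emeasure M U = (SUP K\<in>{K. compactin X K \<and> K \<subseteq> U}. emeasure M K))"

definition modular_function :: "('a, 'm) monoid_scheme \<Rightarrow> 'a measure \<Rightarrow> 'a \<Rightarrow> real" where
  "modular_function G M g =
     (THE c. c > 0 \<and> (\<forall>E\<in>sets M. emeasure M (E #>\<^bsub>G\<^esub> g) = ennreal c * emeasure M E))"

definition compactly_supported ::
    "('a, 'm) monoid_scheme \<Rightarrow> 'a topology \<Rightarrow> ('a \<Rightarrow> complex) set" where
  "compactly_supported G X =
     {f. continuous_map X euclidean f \<and>
         compactin X (X closure_of {x \<in> carrier G. f x \<noteq> 0}) \<and>
         (\<forall>x. x \<notin> carrier G \<longrightarrow> f x = 0)}"

text \<open>The convolution algebra of continuous functions with compact support, with the involution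
  \<open>f\<^sup>*(x) = \<Delta>(x\<^sup>-\<^sup>1) cnj (f(x\<^sup>-\<^sup>1))\<close>.\<close>

definition convolution_algebra ::
    "('a, 'm) monoid_scheme \<Rightarrow> 'a topology \<Rightarrow> 'a measure \<Rightarrow> ('a \<Rightarrow> complex) star_algebra" where
  "convolution_algebra G X M =
     \<lparr>carrier = compactly_supported G X,
      mult = (\<lambda>f h x. if x \<in> carrier G
                      then LINT y|M. f y * h (inv\<^bsub>G\<^esub> y \<otimes>\<^bsub>G\<^esub> x) else 0),
      one = undefined,
      zero = (\<lambda>x. 0),
      add = (\<lambda>f h x. f x + h x),
      smult = (\<lambda>c f x. c * f x),
      star = (\<lambda>f x. if x \<in> carrier G
                    then of_real (modular_function G M (inv\<^bsub>G\<^esub> x)) * cnj (f (inv\<^bsub>G\<^esub> x)) else 0)\<rparr>"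

text \<open>The universal C*-norm is the supremum of the operator norms over the *-representations that
  are contractive for the L1-norm. These are the restrictions of the *-representations of the
  Banach *-algebra of integrable functions, all of which are contractive and in which the continuous
  functions with compact support are dense; so the completion below is the enveloping C*-algebra of
  that Banach *-algebra. Since cyclic representations suffice for the supremum, the type of the
  Hilbert spaces is again no restriction.\<close>

definition universal_norm ::
    "('a, 'm) monoid_scheme \<Rightarrow> 'a topology \<Rightarrow> 'a measure \<Rightarrow> ('a \<Rightarrow> complex) \<Rightarrow> real" where
  "universal_norm G X M f =
     Sup {operator_norm H (\<pi> f) | (H :: (('a \<Rightarrow> complex) \<Rightarrow> complex) inner_space) \<pi>.
            star_representation (convolution_algebra G X M) H \<pi> \<and>
            (\<forall>h\<in>compactly_supported G X. operator_norm H (\<pi> h) \<le> (LINT x|M. cmod (h x)))}"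

definition group_Cstar_algebra ::
    "('a, 'm) monoid_scheme \<Rightarrow> 'a topology \<Rightarrow> 'a measure \<Rightarrow> (nat \<Rightarrow> 'a \<Rightarrow> complex) set star_algebra" where
  "group_Cstar_algebra G X M = completion (convolution_algebra G X M) (universal_norm G X M)"

text \<open>A Haar measure exists and is unique up to a positive factor, and rescaling it does not change
  the group C*-algebra up to isomorphism.\<close>

definition CCR_group :: "('a, 'm) monoid_scheme \<Rightarrow> 'a topology \<Rightarrow> bool" where
  "CCR_group G X \<longleftrightarrow> (\<exists>M. haar_measure G X M \<and> CCR_algebra (group_Cstar_algebra G X M))"

end

theory Submission
  imports Defs "HOL-Library.Function_Algebras" "HOL-Library.Z2"
    "HOL-Computational_Algebra.Formal_Laurent_Series"
begin

text \<open>The group is the Heisenberg group over the field of Laurent series in \<open>t\<close> with coefficients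
  in the field with two elements; the contraction is \<open>(a, b, c) \<mapsto> (t a, t b, t\<^sup>2 c)\<close>.

  For the CCR property, let \<open>K\<close> run through a base of compact open subgroups at the identity and let
  \<open>P\<close> be the image of the normalised indicator function of \<open>K\<close> in an irreducible representation.
  Convolution with these functions approximates the identity, so it suffices that each \<open>P\<close> has
  finite-dimensional range, and this range is spanned by the vectors \<open>P g v\<close> for any fixed nonzero
  \<open>v\<close> in it. Central elements are involutions and act by signs. If \<open>g k = k g z\<close> with \<open>k\<close> in \<open>K\<close> and
  \<open>z\<close> central acting as \<open>-1\<close>, then \<open>P g v = P g k v = - P k g v = - P g v\<close> vanishes; hence only finitely
  many \<open>g\<close> matter up to sign. If the whole centre acts trivially, every \<open>g\<close> acts as a central
  involution, again by a sign.\<close>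

section \<open>Hilbert spaces\<close>

text \<open>Two obstacles shape the proof. Each operator of a star representation of the completion
  is bounded, but no bound by the norm of the completion is assumed. It has to be derived, from
  square roots 1 - sqrt(1 - a) built by iteration inside the completion. Only then are all operators
  norm limits of those coming from functions, so that irreducibility passes down to the functions
  and compactness passes up from them. Secondly, the group itself is never made to act on the
  Hilbert space: identities between group elements are read off from convolutions of normalised
  indicator functions of cosets g K.

  Characteristic 2 keeps spectral theory out, since Schur's lemma is only needed for involutions and
  their eigenvalues 1 and -1. The Laurent series matter in two more places. Multiplication by a
  series with a pole of high order expands a small ball until it contains any given element, which
  is why most g have the required commutator. And binary digits carry Lebesgue measure to Haar
  measure, where the volume of a box is independent of its centre.\<close>

lemma complex_ring_simps [simp]:
  "carrier complex_ring = UNIV" "mult complex_ring = (*)" "one complex_ring = 1"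
  "zero complex_ring = 0" "add complex_ring = (+)"
  by (simp_all add: complex_ring_def)

lemma cring_complex_ring: "cring complex_ring"
proof (rule cringI)
  have "\<exists>y. y + x = 0" for x :: complex
    by (rule exI[of _ "- x"]) simp
  then show "abelian_group complex_ring"
    by (intro abelian_groupI) (auto simp: algebra_simps)
  show "comm_monoid complex_ring"
    by (intro comm_monoidI) (auto simp: algebra_simps)
qed (auto simp: algebra_simps)

locale hilbert =
  fixes H :: "'h inner_space"
  assumes hilbert_space: "hilbert_space H"
begin

sublocale module complex_ring H
  using hilbert_space unfolding hilbert_space_def by blast

lemma smult_closed' [simp, intro]: "v \<in> carrier H \<Longrightarrow> c \<odot>\<^bsub>H\<^esub> v \<in> carrier H"
  by (rule smult_closed) auto

abbreviation ip :: "'h \<Rightarrow> 'h \<Rightarrow> complex" where "ip \<equiv> inner_prod H"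

lemma ip_add_left:
  "u \<in> carrier H \<Longrightarrow> v \<in> carrier H \<Longrightarrow> w \<in> carrier H \<Longrightarrow> ip (u \<oplus>\<^bsub>H\<^esub> v) w = ip u w + ip v w"
  using hilbert_space unfolding hilbert_space_def by blast

lemma ip_smult_left:
  "v \<in> carrier H \<Longrightarrow> w \<in> carrier H \<Longrightarrow> ip (c \<odot>\<^bsub>H\<^esub> v) w = c * ip v w"
  using hilbert_space unfolding hilbert_space_def by blast

lemma ip_cnj: "v \<in> carrier H \<Longrightarrow> w \<in> carrier H \<Longrightarrow> ip w v = cnj (ip v w)"
  using hilbert_space unfolding hilbert_space_def by blast

lemma ip_add_right:
  assumes "u \<in> carrier H" "v \<in> carrier H" "w \<in> carrier H"
  shows "ip w (u \<oplus>\<^bsub>H\<^esub> v) = ip w u + ip w v"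
  using assms ip_cnj[of "u \<oplus>\<^bsub>H\<^esub> v" w] ip_cnj[of u w] ip_cnj[of v w] by (simp add: ip_add_left)

lemma ip_smult_right:
  assumes "v \<in> carrier H" "w \<in> carrier H"
  shows "ip w (c \<odot>\<^bsub>H\<^esub> v) = cnj c * ip w v"
  using assms ip_cnj[of "c \<odot>\<^bsub>H\<^esub> v" w] ip_cnj[of v w] by (simp add: ip_smult_left)

lemma ip_zero_left [simp]: "w \<in> carrier H \<Longrightarrow> ip \<zero>\<^bsub>H\<^esub> w = 0"
  using ip_add_left[of "\<zero>\<^bsub>H\<^esub>" "\<zero>\<^bsub>H\<^esub>" w] by simp

lemma ip_zero_right [simp]: "w \<in> carrier H \<Longrightarrow> ip w \<zero>\<^bsub>H\<^esub> = 0"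
  using ip_cnj[of "\<zero>\<^bsub>H\<^esub>" w] by simp

lemma ip_minus_left:
  assumes "v \<in> carrier H" "w \<in> carrier H"
  shows "ip (\<ominus>\<^bsub>H\<^esub> v) w = - ip v w"
  using ip_add_left[of "\<ominus>\<^bsub>H\<^esub> v" v w] assms M.l_neg[of v] by (simp add: eq_neg_iff_add_eq_0)

lemma ip_minus_right:
  assumes "v \<in> carrier H" "w \<in> carrier H"
  shows "ip w (\<ominus>\<^bsub>H\<^esub> v) = - ip w v"
  using ip_add_right[of "\<ominus>\<^bsub>H\<^esub> v" v w] assms M.l_neg[of v] by (simp add: eq_neg_iff_add_eq_0)

lemma ip_diff_left:
  "u \<in> carrier H \<Longrightarrow> v \<in> carrier H \<Longrightarrow> w \<in> carrier H \<Longrightarrow> ip (u \<ominus>\<^bsub>H\<^esub> v) w = ip u w - ip v w"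
  by (simp add: a_minus_def ip_add_left ip_minus_left)

lemma ip_diff_right:
  "u \<in> carrier H \<Longrightarrow> v \<in> carrier H \<Longrightarrow> w \<in> carrier H \<Longrightarrow> ip w (u \<ominus>\<^bsub>H\<^esub> v) = ip w u - ip w v"
  by (simp add: a_minus_def ip_add_right ip_minus_right)

lemmas ip_simps = ip_add_left ip_add_right ip_smult_left ip_smult_right ip_minus_left
  ip_minus_right ip_diff_left ip_diff_right

lemma ip_Re_pos: "v \<in> carrier H \<Longrightarrow> v \<noteq> \<zero>\<^bsub>H\<^esub> \<Longrightarrow> 0 < Re (ip v v)"
  using hilbert_space unfolding hilbert_space_def by blast

lemma ip_Re_nonneg: "v \<in> carrier H \<Longrightarrow> 0 \<le> Re (ip v v)"
  by (cases "v = \<zero>\<^bsub>H\<^esub>") (use ip_Re_pos[of v] in auto)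

lemma hnorm_nonneg [simp]: "v \<in> carrier H \<Longrightarrow> 0 \<le> hnorm H v"
  by (simp add: hnorm_def ip_Re_nonneg)

lemma hnorm_power2: "v \<in> carrier H \<Longrightarrow> (hnorm H v)\<^sup>2 = Re (ip v v)"
  by (simp add: hnorm_def ip_Re_nonneg)

lemma ip_self:
  assumes "v \<in> carrier H"
  shows "ip v v = of_real ((hnorm H v)\<^sup>2)"
  using assms ip_cnj[of v v] by (simp add: hnorm_power2 complex_eq_iff)

lemma hnorm_eq_0: "v \<in> carrier H \<Longrightarrow> hnorm H v = 0 \<longleftrightarrow> v = \<zero>\<^bsub>H\<^esub>"
  using ip_Re_pos[of v] by (cases "v = \<zero>\<^bsub>H\<^esub>") (auto simp: hnorm_def)

lemma hnorm_zero [simp]: "hnorm H \<zero>\<^bsub>H\<^esub> = 0"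
  by (simp add: hnorm_def)

lemma diff_eq_zero_iff:
  assumes "v \<in> carrier H" "w \<in> carrier H"
  shows "v \<ominus>\<^bsub>H\<^esub> w = \<zero>\<^bsub>H\<^esub> \<longleftrightarrow> v = w"
proof
  assume "v \<ominus>\<^bsub>H\<^esub> w = \<zero>\<^bsub>H\<^esub>"
  then show "v = w"
    using M.minus_equality[of v "\<ominus>\<^bsub>H\<^esub> w"] assms by (simp add: a_minus_def)
qed (use assms in \<open>simp add: a_minus_def M.r_neg\<close>)

lemma diff_self [simp]: "v \<in> carrier H \<Longrightarrow> v \<ominus>\<^bsub>H\<^esub> v = \<zero>\<^bsub>H\<^esub>"
  by (simp add: diff_eq_zero_iff)

text \<open>Definiteness of the form: test against \<open>v \<ominus> w\<close>. Throughout, this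
  reduces vector identities to scalar identities that \<open>ip_simps\<close> settles.\<close>

lemma ip_eqI:
  assumes "v \<in> carrier H" "w \<in> carrier H" "\<And>u. u \<in> carrier H \<Longrightarrow> ip v u = ip w u"
  shows "v = w"
proof -
  have "ip (v \<ominus>\<^bsub>H\<^esub> w) (v \<ominus>\<^bsub>H\<^esub> w) = 0"
    using assms by (simp add: ip_diff_left)
  then have "hnorm H (v \<ominus>\<^bsub>H\<^esub> w) = 0"
    by (simp add: hnorm_def)
  then show ?thesis
    using assms by (simp add: hnorm_eq_0 diff_eq_zero_iff)
qed

lemma minus_zero_right [simp]: "v \<in> carrier H \<Longrightarrow> v \<ominus>\<^bsub>H\<^esub> \<zero>\<^bsub>H\<^esub> = v"
  by (rule ip_eqI) (simp_all add: ip_simps)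

lemma hnorm_smult: "v \<in> carrier H \<Longrightarrow> hnorm H (c \<odot>\<^bsub>H\<^esub> v) = cmod c * hnorm H v"
proof -
  assume v: "v \<in> carrier H"
  have "ip (c \<odot>\<^bsub>H\<^esub> v) (c \<odot>\<^bsub>H\<^esub> v) = (c * cnj c) * ip v v"
    using v by (simp add: ip_simps)
  also have "\<dots> = of_real ((cmod c * hnorm H v)\<^sup>2)"
    using v by (simp add: ip_self power_mult_distrib flip: complex_norm_square)
  finally have "ip (c \<odot>\<^bsub>H\<^esub> v) (c \<odot>\<^bsub>H\<^esub> v) = of_real ((cmod c * hnorm H v)\<^sup>2)" .
  then show ?thesis
    using v unfolding hnorm_def[of H "c \<odot>\<^bsub>H\<^esub> v"] by (simp add: real_sqrt_mult)
qed

lemma Cauchy_Schwarz: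
  assumes v: "v \<in> carrier H" and w: "w \<in> carrier H"
  shows "cmod (ip v w) \<le> hnorm H v * hnorm H w"
proof (cases "w = \<zero>\<^bsub>H\<^esub>")
  case False
  define W where "W = (hnorm H w)\<^sup>2"
  have W: "W > 0"
    using False w hnorm_eq_0[of w] by (simp add: W_def)
  \<comment> \<open>The coefficient of the orthogonal projection of \<open>v\<close> onto
    \<open>w\<close>; the remainder has nonnegative squared norm, which is the inequality.\<close>
  define c where "c = ip v w / of_real W"
  have ww: "ip w w = of_real W"
    using w by (simp add: W_def ip_self)
  have vw: "ip w v = cnj (ip v w)"
    using v w by (rule ip_cnj)
  have "ip (v \<ominus>\<^bsub>H\<^esub> c \<odot>\<^bsub>H\<^esub> w) (v \<ominus>\<^bsub>H\<^esub> c \<odot>\<^bsub>H\<^esub> w)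
      = ip v v - cnj c * ip v w - c * cnj (ip v w) + c * cnj c * of_real W"
    using v w by (simp add: ip_simps ww vw algebra_simps)
  also have "\<dots> = ip v v - ip v w * cnj (ip v w) / of_real W"
    using W by (simp add: c_def field_simps)
  also have "\<dots> = of_real ((hnorm H v)\<^sup>2 - (cmod (ip v w))\<^sup>2 / W)"
    using v by (simp add: ip_self flip: complex_norm_square)
  finally have "0 \<le> (hnorm H v)\<^sup>2 - (cmod (ip v w))\<^sup>2 / W"
    using ip_Re_nonneg[of "v \<ominus>\<^bsub>H\<^esub> c \<odot>\<^bsub>H\<^esub> w"] v w by simp
  then have "(cmod (ip v w))\<^sup>2 \<le> (hnorm H v * hnorm H w)\<^sup>2"
    using W by (simp add: field_simps W_def power_mult_distrib)
  then show ?thesis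
    by (rule power2_le_imp_le) (use v w in simp)
qed (use v in simp)

lemma hnorm_triangle:
  assumes v: "v \<in> carrier H" and w: "w \<in> carrier H"
  shows "hnorm H (v \<oplus>\<^bsub>H\<^esub> w) \<le> hnorm H v + hnorm H w"
proof -
  have "(hnorm H (v \<oplus>\<^bsub>H\<^esub> w))\<^sup>2 = (hnorm H v)\<^sup>2 + (hnorm H w)\<^sup>2 + 2 * Re (ip v w)"
    using v w ip_cnj[OF v w] by (simp add: hnorm_power2 ip_simps)
  also have "\<dots> \<le> (hnorm H v)\<^sup>2 + (hnorm H w)\<^sup>2 + 2 * (hnorm H v * hnorm H w)"
    using Cauchy_Schwarz[OF v w] complex_Re_le_cmod[of "ip v w"] by linarith
  also have "\<dots> = (hnorm H v + hnorm H w)\<^sup>2"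
    by (simp add: power2_sum)
  finally show ?thesis
    by (rule power2_le_imp_le) (use v w in simp)
qed

lemma hnorm_minus: "v \<in> carrier H \<Longrightarrow> hnorm H (\<ominus>\<^bsub>H\<^esub> v) = hnorm H v"
  by (simp add: hnorm_def ip_simps)

lemma hnorm_diff_commute:
  assumes "v \<in> carrier H" "w \<in> carrier H"
  shows "hnorm H (v \<ominus>\<^bsub>H\<^esub> w) = hnorm H (w \<ominus>\<^bsub>H\<^esub> v)"
  using assms by (simp add: hnorm_def ip_simps algebra_simps)

lemma hnorm_diff_triangle:
  assumes "u \<in> carrier H" "v \<in> carrier H" "w \<in> carrier H"
  shows "hnorm H (u \<ominus>\<^bsub>H\<^esub> w) \<le> hnorm H (u \<ominus>\<^bsub>H\<^esub> v) + hnorm H (v \<ominus>\<^bsub>H\<^esub> w)"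
proof -
  have "u \<ominus>\<^bsub>H\<^esub> w = (u \<ominus>\<^bsub>H\<^esub> v) \<oplus>\<^bsub>H\<^esub> (v \<ominus>\<^bsub>H\<^esub> w)"
    by (rule ip_eqI) (use assms in \<open>simp_all add: ip_simps\<close>)
  then show ?thesis
    using hnorm_triangle assms by simp
qed

lemma hnorm_le_diff:
  assumes "u \<in> carrier H" "v \<in> carrier H"
  shows "hnorm H u \<le> hnorm H (u \<ominus>\<^bsub>H\<^esub> v) + hnorm H v"
  using hnorm_diff_triangle[of u v "\<zero>\<^bsub>H\<^esub>"] assms by simp

sublocale metric: Metric_space "carrier H" "hdist H"
proof
  fix x y z
  show "0 \<le> hdist H x y"
    by (simp add: hdist_def)
  show "hdist H x y = hdist H y x"
    using hnorm_diff_commute[of x y] by (simp add: hdist_def)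
  assume "x \<in> carrier H" "y \<in> carrier H"
  then show "hdist H x y = 0 \<longleftrightarrow> x = y"
    by (simp add: hdist_def hnorm_eq_0 diff_eq_zero_iff)
  assume "z \<in> carrier H"
  then show "hdist H x z \<le> hdist H x y + hdist H y z"
    using \<open>x \<in> carrier H\<close> \<open>y \<in> carrier H\<close> hnorm_diff_triangle[of x y z] by (simp add: hdist_def)
qed

lemma mcomplete: "metric.mcomplete"
  using hilbert_space unfolding hilbert_space_def by blast

section \<open>Norm closures and closed subspaces\<close>

definition hclosure :: "'h set \<Rightarrow> 'h set" where
  "hclosure S = {v \<in> carrier H. \<forall>e>0. \<exists>s\<in>S. hnorm H (v \<ominus>\<^bsub>H\<^esub> s) < e}"

lemma closedin_iff:
  "closedin (htopology H) S \<longleftrightarrow> S \<subseteq> carrier H \<and> hclosure S \<subseteq> S"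
proof -
  have *: "disjnt S (metric.mball x r) \<longleftrightarrow> (\<forall>s\<in>S. \<not> hnorm H (x \<ominus>\<^bsub>H\<^esub> s) < r)"
    if "S \<subseteq> carrier H" "x \<in> carrier H" for x r
    using that by (auto simp: disjnt_iff metric.in_mball hdist_def)
  show ?thesis
    unfolding htopology_def metric.closedin_metric hclosure_def by (auto simp: *) (metis *)+
qed

lemma subset_hclosure: "S \<subseteq> carrier H \<Longrightarrow> S \<subseteq> hclosure S"
  unfolding hclosure_def
proof safe
  fix v e assume "S \<subseteq> carrier H" "v \<in> S" "e > (0::real)"
  then show "\<exists>s\<in>S. hnorm H (v \<ominus>\<^bsub>H\<^esub> s) < e" by (intro bexI[of _ v]) auto
qed auto

lemma hclosure_carrier: "hclosure S \<subseteq> carrier H"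
  by (auto simp: hclosure_def)

lemma hclosure_mono: "S \<subseteq> T \<Longrightarrow> hclosure S \<subseteq> hclosure T"
  unfolding hclosure_def by blast

lemma hclosure_idem:
  assumes "S \<subseteq> carrier H"
  shows "hclosure (hclosure S) \<subseteq> hclosure S"
proof
  fix v assume v: "v \<in> hclosure (hclosure S)"
  show "v \<in> hclosure S"
    unfolding hclosure_def
  proof (intro CollectI conjI allI impI)
    show vH: "v \<in> carrier H" using v by (simp add: hclosure_def)
    fix e :: real assume "e > 0"
    then have "e/2 > 0" by simp
    then obtain u where u: "u \<in> hclosure S" "hnorm H (v \<ominus>\<^bsub>H\<^esub> u) < e/2"
      using v unfolding hclosure_def[of "hclosure S"] by blast
    with \<open>e/2 > 0\<close> obtain s where s: "s \<in> S" "hnorm H (u \<ominus>\<^bsub>H\<^esub> s) < e/2"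
      unfolding hclosure_def by blast
    have "hnorm H (v \<ominus>\<^bsub>H\<^esub> s) < e"
      using hnorm_diff_triangle[of v u s] u s vH assms hclosure_carrier[of S] by (auto simp: subset_eq)
    then show "\<exists>s\<in>S. hnorm H (v \<ominus>\<^bsub>H\<^esub> s) < e"
      using s by auto
  qed
qed

lemma submoduleI':
  assumes V: "V \<subseteq> carrier H" "\<zero>\<^bsub>H\<^esub> \<in> V" "\<And>a b. a \<in> V \<Longrightarrow> b \<in> V \<Longrightarrow> a \<oplus>\<^bsub>H\<^esub> b \<in> V"
    "\<And>c a. a \<in> V \<Longrightarrow> c \<odot>\<^bsub>H\<^esub> a \<in> V"
  shows "submodule V complex_ring H"
proof (rule submoduleI)
  fix a assume a: "a \<in> V"
  have "\<ominus>\<^bsub>H\<^esub> a = (-1) \<odot>\<^bsub>H\<^esub> a"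
    by (rule ip_eqI) (use a V(1) in \<open>auto simp: ip_simps\<close>)
  then show "\<ominus>\<^bsub>H\<^esub> a \<in> V"
    using V(4) a by simp
qed (use V in auto)

lemma submodule_hclosure:
  assumes V: "submodule V complex_ring H"
  shows "submodule (hclosure V) complex_ring H"
proof (rule submoduleI')
  note VE = submoduleE[OF V]
  show "\<zero>\<^bsub>H\<^esub> \<in> hclosure V"
    using VE(1) subgroup.one_closed[OF submodule.axioms(1)[OF V]] subset_hclosure[of V] by auto
  show "hclosure V \<subseteq> carrier H" by (rule hclosure_carrier)
  show "a \<oplus>\<^bsub>H\<^esub> b \<in> hclosure V" if ab: "a \<in> hclosure V" "b \<in> hclosure V" for a b
    unfolding hclosure_def
  proof (intro CollectI conjI allI impI)
    have abH: "a \<in> carrier H" "b \<in> carrier H" using ab by (auto simp: hclosure_def)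
    then show "a \<oplus>\<^bsub>H\<^esub> b \<in> carrier H" by simp
    fix e :: real assume "e > 0"
    then have "e/2 > 0" by simp
    then obtain u v where uv: "u \<in> V" "v \<in> V"
      "hnorm H (a \<ominus>\<^bsub>H\<^esub> u) < e/2" "hnorm H (b \<ominus>\<^bsub>H\<^esub> v) < e/2"
      using ab unfolding hclosure_def by blast
    then have uvH: "u \<in> carrier H" "v \<in> carrier H" using VE(1) by auto
    have "(a \<oplus>\<^bsub>H\<^esub> b) \<ominus>\<^bsub>H\<^esub> (u \<oplus>\<^bsub>H\<^esub> v) = (a \<ominus>\<^bsub>H\<^esub> u) \<oplus>\<^bsub>H\<^esub> (b \<ominus>\<^bsub>H\<^esub> v)"
      by (rule ip_eqI) (use abH uvH in \<open>simp_all add: ip_simps\<close>)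
    then have "hnorm H ((a \<oplus>\<^bsub>H\<^esub> b) \<ominus>\<^bsub>H\<^esub> (u \<oplus>\<^bsub>H\<^esub> v)) < e"
      using hnorm_triangle[of "a \<ominus>\<^bsub>H\<^esub> u" "b \<ominus>\<^bsub>H\<^esub> v"] uv(3,4) abH uvH by simp
    then show "\<exists>s\<in>V. hnorm H ((a \<oplus>\<^bsub>H\<^esub> b) \<ominus>\<^bsub>H\<^esub> s) < e"
      using VE(5) uv by auto
  qed
  show "c \<odot>\<^bsub>H\<^esub> a \<in> hclosure V" if a: "a \<in> hclosure V" for c a
    unfolding hclosure_def
  proof (intro CollectI conjI allI impI)
    have aH: "a \<in> carrier H" using a by (auto simp: hclosure_def)
    then show "c \<odot>\<^bsub>H\<^esub> a \<in> carrier H" by simp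
    fix e :: real assume "e > 0"
    \<comment> \<open>Adding 1 keeps the denominator positive when \<open>c\<close> is 0; the same
      device recurs below with norms that may vanish.\<close>
    then have "e / (cmod c + 1) > 0" by (simp add: add_nonneg_pos)
    then obtain u where u: "u \<in> V" "hnorm H (a \<ominus>\<^bsub>H\<^esub> u) < e / (cmod c + 1)"
      using a unfolding hclosure_def by blast
    then have uH: "u \<in> carrier H" using VE(1) by auto
    have "c \<odot>\<^bsub>H\<^esub> a \<ominus>\<^bsub>H\<^esub> c \<odot>\<^bsub>H\<^esub> u = c \<odot>\<^bsub>H\<^esub> (a \<ominus>\<^bsub>H\<^esub> u)"
      by (rule ip_eqI) (use aH uH in \<open>simp_all add: ip_simps algebra_simps\<close>)
    then have "hnorm H (c \<odot>\<^bsub>H\<^esub> a \<ominus>\<^bsub>H\<^esub> c \<odot>\<^bsub>H\<^esub> u) = cmod c * hnorm H (a \<ominus>\<^bsub>H\<^esub> u)"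
      using aH uH by (simp add: hnorm_smult)
    also have "\<dots> \<le> (cmod c + 1) * hnorm H (a \<ominus>\<^bsub>H\<^esub> u)"
      using aH uH by (intro mult_right_mono) auto
    also have "\<dots> < e"
      using u(2) by (simp add: pos_less_divide_eq add_nonneg_pos mult.commute)
    finally show "\<exists>s\<in>V. hnorm H (c \<odot>\<^bsub>H\<^esub> a \<ominus>\<^bsub>H\<^esub> s) < e"
      using VE(4) u by auto
  qed
qed

subsection \<open>Totally bounded sets\<close>

text \<open>The centres may lie outside \<open>S\<close>, unlike in \<open>mtotally_bounded\<close>.
  This makes passing to subsets, sums and approximations immediate; \<open>compact_operatorI\<close>
  moves the centres back.\<close>

definition totally_bounded :: "'h set \<Rightarrow> bool" where
  "totally_bounded S \<longleftrightarrow> S \<subseteq> carrier H \<and>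
     (\<forall>e>0. \<exists>F. finite F \<and> F \<subseteq> carrier H \<and> (\<forall>x\<in>S. \<exists>u\<in>F. hnorm H (x \<ominus>\<^bsub>H\<^esub> u) < e))"

lemma totally_bounded_subset: "totally_bounded S \<Longrightarrow> T \<subseteq> S \<Longrightarrow> totally_bounded T"
  unfolding totally_bounded_def by (meson subset_iff)

text \<open>An e/2-net of the approximating set is an e-net of \<open>T\<close>. This is why norm
  limits of compact operators are compact.\<close>

lemma totally_bounded_approx:
  assumes "T \<subseteq> carrier H"
    and "\<And>e. e > 0 \<Longrightarrow> \<exists>S. totally_bounded S \<and> (\<forall>x\<in>T. \<exists>y\<in>S. hnorm H (x \<ominus>\<^bsub>H\<^esub> y) < e)"
  shows "totally_bounded T"
  unfolding totally_bounded_def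
proof (intro conjI allI impI assms(1))
  fix e :: real assume "e > 0"
  then have e2: "e/2 > 0" by simp
  obtain S where S: "totally_bounded S" "\<And>x. x \<in> T \<Longrightarrow> \<exists>y\<in>S. hnorm H (x \<ominus>\<^bsub>H\<^esub> y) < e/2"
    using assms(2)[OF e2] by blast
  then obtain F where F: "finite F" "F \<subseteq> carrier H"
    "\<And>x. x \<in> S \<Longrightarrow> \<exists>u\<in>F. hnorm H (x \<ominus>\<^bsub>H\<^esub> u) < e/2"
    using e2 unfolding totally_bounded_def by meson
  have "\<exists>u\<in>F. hnorm H (x \<ominus>\<^bsub>H\<^esub> u) < e" if x: "x \<in> T" for x
  proof -
    obtain y where y: "y \<in> S" "hnorm H (x \<ominus>\<^bsub>H\<^esub> y) < e/2" using S(2)[OF x] by blast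
    obtain u where u: "u \<in> F" "hnorm H (y \<ominus>\<^bsub>H\<^esub> u) < e/2" using F(3)[OF y(1)] by blast
    have "hnorm H (x \<ominus>\<^bsub>H\<^esub> u) < e"
      using hnorm_diff_triangle[of x y u] x y u assms(1) S(1) F(2)
      by (auto simp: totally_bounded_def subset_eq)
    then show ?thesis using u by blast
  qed
  then show "\<exists>F. finite F \<and> F \<subseteq> carrier H \<and> (\<forall>x\<in>T. \<exists>u\<in>F. hnorm H (x \<ominus>\<^bsub>H\<^esub> u) < e)"
    using F by blast
qed

lemma totally_bounded_sum:
  assumes S: "totally_bounded S" and T: "totally_bounded T"
  shows "totally_bounded {s \<oplus>\<^bsub>H\<^esub> t | s t. s \<in> S \<and> t \<in> T}"
  unfolding totally_bounded_def
proof (intro conjI allI impI)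
  have ST: "S \<subseteq> carrier H" "T \<subseteq> carrier H"
    using S T by (auto simp: totally_bounded_def)
  then show "{s \<oplus>\<^bsub>H\<^esub> t | s t. s \<in> S \<and> t \<in> T} \<subseteq> carrier H" by auto
  fix e :: real assume "e > 0"
  then have e2: "e/2 > 0" by simp
  obtain F where F: "finite F" "F \<subseteq> carrier H" "\<And>x. x \<in> S \<Longrightarrow> \<exists>u\<in>F. hnorm H (x \<ominus>\<^bsub>H\<^esub> u) < e/2"
    using S e2 unfolding totally_bounded_def by meson
  obtain G where G: "finite G" "G \<subseteq> carrier H" "\<And>x. x \<in> T \<Longrightarrow> \<exists>u\<in>G. hnorm H (x \<ominus>\<^bsub>H\<^esub> u) < e/2"
    using T e2 unfolding totally_bounded_def by meson
  have "\<exists>u\<in>(\<lambda>(a, b). a \<oplus>\<^bsub>H\<^esub> b) ` (F \<times> G). hnorm H ((s \<oplus>\<^bsub>H\<^esub> t) \<ominus>\<^bsub>H\<^esub> u) < e"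
    if st: "s \<in> S" "t \<in> T" for s t
  proof -
    obtain a b where ab: "a \<in> F" "b \<in> G" "hnorm H (s \<ominus>\<^bsub>H\<^esub> a) < e/2" "hnorm H (t \<ominus>\<^bsub>H\<^esub> b) < e/2"
      using F(3) G(3) st by meson
    have car: "s \<in> carrier H" "t \<in> carrier H" "a \<in> carrier H" "b \<in> carrier H"
      using st ab ST F(2) G(2) by auto
    have "(s \<oplus>\<^bsub>H\<^esub> t) \<ominus>\<^bsub>H\<^esub> (a \<oplus>\<^bsub>H\<^esub> b) = (s \<ominus>\<^bsub>H\<^esub> a) \<oplus>\<^bsub>H\<^esub> (t \<ominus>\<^bsub>H\<^esub> b)"
      by (rule ip_eqI) (use car in \<open>simp_all add: ip_simps\<close>)
    then have "hnorm H ((s \<oplus>\<^bsub>H\<^esub> t) \<ominus>\<^bsub>H\<^esub> (a \<oplus>\<^bsub>H\<^esub> b)) < e"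
      using hnorm_triangle[of "s \<ominus>\<^bsub>H\<^esub> a" "t \<ominus>\<^bsub>H\<^esub> b"] ab(3,4) car by simp
    then show ?thesis
      using ab(1,2) by (force intro!: bexI[of _ "a \<oplus>\<^bsub>H\<^esub> b"])
  qed
  moreover have "(\<lambda>(a, b). a \<oplus>\<^bsub>H\<^esub> b) ` (F \<times> G) \<subseteq> carrier H"
    using F(2) G(2) by auto
  ultimately show "\<exists>F. finite F \<and> F \<subseteq> carrier H \<and>
      (\<forall>x\<in>{s \<oplus>\<^bsub>H\<^esub> t | s t. s \<in> S \<and> t \<in> T}. \<exists>u\<in>F. hnorm H (x \<ominus>\<^bsub>H\<^esub> u) < e)"
    using F(1) G(1)
    by (intro exI[of _ "(\<lambda>(a, b). a \<oplus>\<^bsub>H\<^esub> b) ` (F \<times> G)"]) auto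
qed

text \<open>A disc of scalars is compact, and scaling a fixed vector is Lipschitz in the
  scalar.\<close>

lemma totally_bounded_scalars:
  assumes u: "u \<in> carrier H"
  shows "totally_bounded {c \<odot>\<^bsub>H\<^esub> u | c. cmod c \<le> C}"
  unfolding totally_bounded_def
proof (intro conjI allI impI)
  show "{c \<odot>\<^bsub>H\<^esub> u | c. cmod c \<le> C} \<subseteq> carrier H" using u by auto
  fix e :: real assume e: "e > 0"
  define d where "d = e / (hnorm H u + 1)"
  have d: "d > 0" using e u by (simp add: d_def add_nonneg_pos)
  have "\<exists>k. finite k \<and> cball (0::complex) C \<subseteq> (\<Union>x\<in>k. ball x d)"
    using compact_cball[of "0::complex" C] d unfolding compact_eq_totally_bounded by simp
  then obtain k where k: "finite k" "cball (0::complex) C \<subseteq> (\<Union>x\<in>k. ball x d)" by blast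
  have "\<exists>v\<in>(\<lambda>c. c \<odot>\<^bsub>H\<^esub> u) ` k. hnorm H (c \<odot>\<^bsub>H\<^esub> u \<ominus>\<^bsub>H\<^esub> v) < e" if c: "cmod c \<le> C" for c
  proof -
    obtain b where b: "b \<in> k" "dist b c < d" using c k(2) by (force simp: subset_eq)
    have "c \<odot>\<^bsub>H\<^esub> u \<ominus>\<^bsub>H\<^esub> b \<odot>\<^bsub>H\<^esub> u = (c - b) \<odot>\<^bsub>H\<^esub> u"
      by (rule ip_eqI) (use u in \<open>simp_all add: ip_simps algebra_simps\<close>)
    then have "hnorm H (c \<odot>\<^bsub>H\<^esub> u \<ominus>\<^bsub>H\<^esub> b \<odot>\<^bsub>H\<^esub> u) = dist b c * hnorm H u"
      using u by (simp add: hnorm_smult dist_norm norm_minus_commute)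
    also have "\<dots> \<le> dist b c * (hnorm H u + 1)" by (simp add: mult_left_mono)
    also have "\<dots> < d * (hnorm H u + 1)"
      using b u by (intro mult_strict_right_mono) (simp_all add: add_nonneg_pos)
    also have "\<dots> = e"
      using hnorm_nonneg[OF u] by (simp add: d_def add_nonneg_eq_0_iff)
    finally show ?thesis using b(1) by blast
  qed
  then show "\<exists>F. finite F \<and> F \<subseteq> carrier H \<and>
      (\<forall>x\<in>{c \<odot>\<^bsub>H\<^esub> u | c. cmod c \<le> C}. \<exists>u\<in>F. hnorm H (x \<ominus>\<^bsub>H\<^esub> u) < e)"
    using k(1) u by (intro exI[of _ "(\<lambda>c. c \<odot>\<^bsub>H\<^esub> u) ` k"]) auto
qed

text \<open>By Riesz's theorem these are exactly the finite-dimensional subspaces. The compactness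
  property takes the place of dimension, so that no bases or coordinates enter.\<close>

definition boundedly_compact :: "'h set \<Rightarrow> bool" where
  "boundedly_compact V \<longleftrightarrow> submodule V complex_ring H \<and>
     (\<forall>C. totally_bounded {v \<in> V. hnorm H v \<le> C})"

text \<open>A vector of norm at most C in the closure lies within e of a vector of \<open>V\<close>
  of norm at most C + e, so the bounded parts of \<open>V\<close> serve as approximating
  sets.\<close>

lemma boundedly_compact_hclosure:
  assumes V: "boundedly_compact V"
  shows "boundedly_compact (hclosure V)"
  unfolding boundedly_compact_def
proof (intro conjI allI)
  have sub: "submodule V complex_ring H" using V by (simp add: boundedly_compact_def)
  show "submodule (hclosure V) complex_ring H"
    using sub by (rule submodule_hclosure)
  fix C :: real
  show "totally_bounded {v \<in> hclosure V. hnorm H v \<le> C}"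
  proof (rule totally_bounded_approx)
    show "{v \<in> hclosure V. hnorm H v \<le> C} \<subseteq> carrier H"
      using hclosure_carrier by blast
    fix e :: real assume e: "e > 0"
    have "\<exists>y\<in>{v \<in> V. hnorm H v \<le> C + e}. hnorm H (x \<ominus>\<^bsub>H\<^esub> y) < e"
      if x: "x \<in> hclosure V" "hnorm H x \<le> C" for x
    proof -
      obtain y where y: "y \<in> V" "hnorm H (x \<ominus>\<^bsub>H\<^esub> y) < e"
        using x(1) e unfolding hclosure_def by blast
      have car: "x \<in> carrier H" "y \<in> carrier H"
        using x(1) y(1) hclosure_carrier submoduleE(1)[OF sub] by auto
      have "hnorm H y \<le> C + e"
        using hnorm_le_diff[of y x] hnorm_diff_commute[of x y] car y(2) x(2) by simp
      then show ?thesis using y by blast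
    qed
    moreover have "totally_bounded {v \<in> V. hnorm H v \<le> C + e}"
      using V by (simp add: boundedly_compact_def)
    ultimately show "\<exists>S. totally_bounded S \<and>
        (\<forall>x\<in>{v \<in> hclosure V. hnorm H v \<le> C}. \<exists>y\<in>S. hnorm H (x \<ominus>\<^bsub>H\<^esub> y) < e)"
      by blast
  qed
qed

text \<open>If \<open>u\<close> is not in the closure of \<open>V\<close>, it has positive distance \<open>d\<close> from \<open>V\<close>, and then
  \<open>\<bar>c\<bar> d \<le> \<parallel>v + c u\<parallel>\<close> bounds the coefficient \<open>c\<close>.\<close>

lemma boundedly_compact_insert:
  assumes V: "boundedly_compact V" and u: "u \<in> carrier H"
  shows "\<exists>W. boundedly_compact W \<and> insert u V \<subseteq> W"
proof (cases "u \<in> hclosure V")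
  case True
  then show ?thesis
    using boundedly_compact_hclosure[OF V] subset_hclosure[of V] V submoduleE(1)[of V]
    by (auto simp: boundedly_compact_def)
next
  case False
  have sub: "submodule V complex_ring H" using V by (simp add: boundedly_compact_def)
  note VE = submoduleE[OF sub]
  have V0: "\<zero>\<^bsub>H\<^esub> \<in> V" using subgroup.one_closed[OF submodule.axioms(1)[OF sub]] by simp
  obtain d where d: "d > 0" "\<And>v. v \<in> V \<Longrightarrow> d \<le> hnorm H (u \<ominus>\<^bsub>H\<^esub> v)"
    using False u unfolding hclosure_def by force
  define W where "W = {v \<oplus>\<^bsub>H\<^esub> c \<odot>\<^bsub>H\<^esub> u | v c. v \<in> V}"
  have WI: "v \<oplus>\<^bsub>H\<^esub> c \<odot>\<^bsub>H\<^esub> u \<in> W" if "v \<in> V" for v c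
    using that by (auto simp: W_def)
  have V_car: "v \<in> carrier H" if "v \<in> V" for v using that VE(1) by auto
  have subW: "submodule W complex_ring H"
  proof (rule submoduleI')
    show "W \<subseteq> carrier H" using VE(1) u by (auto simp: W_def)
    show "\<zero>\<^bsub>H\<^esub> \<in> W" using WI[OF V0, of 0] u smult_l_null[of u] by simp
    show "a \<oplus>\<^bsub>H\<^esub> b \<in> W" if ab: "a \<in> W" "b \<in> W" for a b
    proof -
      obtain v c v' c' where *: "a = v \<oplus>\<^bsub>H\<^esub> c \<odot>\<^bsub>H\<^esub> u" "b = v' \<oplus>\<^bsub>H\<^esub> c' \<odot>\<^bsub>H\<^esub> u" "v \<in> V" "v' \<in> V"
        using ab by (auto simp: W_def)
      have "a \<oplus>\<^bsub>H\<^esub> b = (v \<oplus>\<^bsub>H\<^esub> v') \<oplus>\<^bsub>H\<^esub> (c + c') \<odot>\<^bsub>H\<^esub> u"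
        by (rule ip_eqI) (use * u V_car in \<open>simp_all add: ip_simps algebra_simps\<close>)
      then show ?thesis using WI VE(5) * by simp
    qed
    show "c \<odot>\<^bsub>H\<^esub> a \<in> W" if a: "a \<in> W" for c a
    proof -
      obtain v b where *: "a = v \<oplus>\<^bsub>H\<^esub> b \<odot>\<^bsub>H\<^esub> u" "v \<in> V"
        using a by (auto simp: W_def)
      have "c \<odot>\<^bsub>H\<^esub> a = c \<odot>\<^bsub>H\<^esub> v \<oplus>\<^bsub>H\<^esub> (c * b) \<odot>\<^bsub>H\<^esub> u"
        by (rule ip_eqI) (use * u V_car in \<open>simp_all add: ip_simps algebra_simps\<close>)
      then show ?thesis using WI VE(4) * by simp
    qed
  qed
  have coeff: "cmod c * d \<le> hnorm H (v \<oplus>\<^bsub>H\<^esub> c \<odot>\<^bsub>H\<^esub> u)" if v: "v \<in> V" for v c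
  proof (cases "c = 0")
    case False
    have "v \<oplus>\<^bsub>H\<^esub> c \<odot>\<^bsub>H\<^esub> u = c \<odot>\<^bsub>H\<^esub> (u \<ominus>\<^bsub>H\<^esub> (- inverse c) \<odot>\<^bsub>H\<^esub> v)"
      by (rule ip_eqI) (use False v u V_car in \<open>simp_all add: ip_simps algebra_simps\<close>)
    moreover have "(- inverse c) \<odot>\<^bsub>H\<^esub> v \<in> V"
      using VE(4)[of "- inverse c" v] v by simp
    ultimately show ?thesis
      using d(2) u V_car[OF v] by (simp add: hnorm_smult mult_left_mono)
  qed (use v u V_car in simp)
  have "totally_bounded {w \<in> W. hnorm H w \<le> C}" for C
  proof -
    define B where "B = C / d"
    have "{w \<in> W. hnorm H w \<le> C} \<subseteq>
        {s \<oplus>\<^bsub>H\<^esub> t | s t. s \<in> {v \<in> V. hnorm H v \<le> C + B * hnorm H u} \<and>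
                   t \<in> {c \<odot>\<^bsub>H\<^esub> u | c. cmod c \<le> B}}"
    proof
      fix w assume w: "w \<in> {w \<in> W. hnorm H w \<le> C}"
      then obtain v c where vc: "w = v \<oplus>\<^bsub>H\<^esub> c \<odot>\<^bsub>H\<^esub> u" "v \<in> V" by (auto simp: W_def)
      have vH: "v \<in> carrier H" using vc V_car by simp
      have c: "cmod c \<le> B"
        using coeff[OF vc(2), of c] w vc(1) d(1) by (simp add: B_def pos_le_divide_eq)
      have "v \<ominus>\<^bsub>H\<^esub> \<ominus>\<^bsub>H\<^esub> (c \<odot>\<^bsub>H\<^esub> u) = w"
        by (rule ip_eqI) (use vc vH u in \<open>simp_all add: ip_simps\<close>)
      then have "hnorm H v \<le> hnorm H w + cmod c * hnorm H u"
        using hnorm_le_diff[of v "\<ominus>\<^bsub>H\<^esub> (c \<odot>\<^bsub>H\<^esub> u)"] vH u by (simp add: hnorm_minus hnorm_smult)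
      also have "\<dots> \<le> C + B * hnorm H u"
        using w c u by (intro add_mono mult_right_mono) auto
      finally show "w \<in> {s \<oplus>\<^bsub>H\<^esub> t | s t. s \<in> {v \<in> V. hnorm H v \<le> C + B * hnorm H u} \<and>
                   t \<in> {c \<odot>\<^bsub>H\<^esub> u | c. cmod c \<le> B}}"
        using vc c by blast
    qed
    moreover have "totally_bounded {v \<in> V. hnorm H v \<le> C + B * hnorm H u}"
      using V by (simp add: boundedly_compact_def)
    ultimately show ?thesis
      using totally_bounded_sum totally_bounded_scalars[OF u] totally_bounded_subset by blast
  qed
  moreover have "V \<subseteq> W"
    using WI[of _ 0] u V_car smult_l_null[of u] by fastforce
  moreover have "u \<in> W"
    using WI[OF V0, of 1] u smult_one[of u] by simp
  ultimately show ?thesis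
    using subW unfolding boundedly_compact_def by blast
qed

lemma finite_boundedly_compact:
  assumes "finite F" "F \<subseteq> carrier H"
  shows "\<exists>V. boundedly_compact V \<and> F \<subseteq> V"
  using assms
proof (induction F rule: finite_induct)
  case empty
  have "submodule {\<zero>\<^bsub>H\<^esub>} complex_ring H" by (rule submoduleI') auto
  moreover have "totally_bounded {v \<in> {\<zero>\<^bsub>H\<^esub>}. hnorm H v \<le> C}" for C
    unfolding totally_bounded_def
    by (auto intro!: exI[of _ "{\<zero>\<^bsub>H\<^esub>}"] simp: diff_eq_zero_iff)
  ultimately show ?case unfolding boundedly_compact_def by blast
next
  case (insert u F)
  then obtain V where V: "boundedly_compact V" "F \<subseteq> V" by auto
  then obtain W where "boundedly_compact W" "insert u V \<subseteq> W"
    using boundedly_compact_insert[of V u] insert.prems by auto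
  then show ?case using V by blast
qed

lemma compact_operatorI:
  assumes T: "bounded_operator H T"
    and tb: "totally_bounded (T ` {v \<in> carrier H. hnorm H v \<le> 1})"
  shows "compact_operator H T"
proof -
  let ?S = "T ` {v \<in> carrier H. hnorm H v \<le> 1}"
  have SH: "?S \<subseteq> carrier H" using tb by (simp add: totally_bounded_def)
  have "metric.mtotally_bounded ?S"
    unfolding metric.mtotally_bounded_def
  proof (intro allI impI)
    fix e :: real assume "e > 0"
    then have e2: "e/2 > 0" by simp
    obtain F where F: "finite F" "F \<subseteq> carrier H" "\<And>x. x \<in> ?S \<Longrightarrow> \<exists>u\<in>F. hnorm H (x \<ominus>\<^bsub>H\<^esub> u) < e/2"
      using tb e2 unfolding totally_bounded_def by meson
    define G where "G = {u \<in> F. \<exists>x\<in>?S. hnorm H (x \<ominus>\<^bsub>H\<^esub> u) < e/2}"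
    \<comment> \<open>Every useful centre is replaced by a nearby point of the image itself, as
      \<open>mtotally_bounded\<close> demands; this doubles the radius.\<close>
    define g where "g u = (SOME x. x \<in> ?S \<and> hnorm H (x \<ominus>\<^bsub>H\<^esub> u) < e/2)" for u
    have g: "g u \<in> ?S \<and> hnorm H (g u \<ominus>\<^bsub>H\<^esub> u) < e/2" if "u \<in> G" for u
      unfolding g_def by (rule someI_ex) (use that in \<open>auto simp: G_def\<close>)
    have "x \<in> (\<Union>y\<in>g ` G. metric.mball y e)" if x: "x \<in> ?S" for x
    proof -
      obtain u where u: "u \<in> F" "hnorm H (x \<ominus>\<^bsub>H\<^esub> u) < e/2" using F(3)[OF x] by blast
      then have uG: "u \<in> G" using x unfolding G_def by blast
      have car: "x \<in> carrier H" "u \<in> carrier H" "g u \<in> carrier H"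
        using x u F(2) g[OF uG] SH by blast+
      have "hnorm H (g u \<ominus>\<^bsub>H\<^esub> x) < e"
        using hnorm_diff_triangle[of "g u" u x] hnorm_diff_commute[of x u] car u(2) g[OF uG] by simp
      then show ?thesis
        using car uG by (auto simp: metric.in_mball hdist_def)
    qed
    moreover have "g ` G \<subseteq> ?S" using g by blast
    moreover have "finite (g ` G)" using F(1) by (simp add: G_def)
    ultimately show "\<exists>K. finite K \<and> K \<subseteq> ?S \<and> ?S \<subseteq> (\<Union>x\<in>K. metric.mball x e)"
      by blast
  qed
  then have "compactin metric.mtopology (metric.mtopology closure_of ?S)"
    using metric.mtotally_bounded_eq_compact_closure_of[OF mcomplete, of ?S]
    by blast
  then show ?thesis
    using T by (simp add: compact_operator_def htopology_def)
qed

end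


section \<open>Operators\<close>

context hilbert
begin

lemma bounded_operator_closed: "bounded_operator H T \<Longrightarrow> v \<in> carrier H \<Longrightarrow> T v \<in> carrier H"
  by (auto simp: bounded_operator_def)

lemma bounded_operator_add:
  "bounded_operator H T \<Longrightarrow> v \<in> carrier H \<Longrightarrow> w \<in> carrier H \<Longrightarrow> T (v \<oplus>\<^bsub>H\<^esub> w) = T v \<oplus>\<^bsub>H\<^esub> T w"
  by (auto simp: bounded_operator_def)

lemma bounded_operator_smult:
  "bounded_operator H T \<Longrightarrow> v \<in> carrier H \<Longrightarrow> T (c \<odot>\<^bsub>H\<^esub> v) = c \<odot>\<^bsub>H\<^esub> T v"
  by (auto simp: bounded_operator_def)

lemma smult_0 [simp]: "v \<in> carrier H \<Longrightarrow> 0 \<odot>\<^bsub>H\<^esub> v = \<zero>\<^bsub>H\<^esub>"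
  using smult_l_null[of v] by simp

lemma smult_1 [simp]: "v \<in> carrier H \<Longrightarrow> 1 \<odot>\<^bsub>H\<^esub> v = v"
  using smult_one[of v] by simp

lemma diff_eq_add_smult:
  "v \<in> carrier H \<Longrightarrow> w \<in> carrier H \<Longrightarrow> v \<ominus>\<^bsub>H\<^esub> w = v \<oplus>\<^bsub>H\<^esub> (-1) \<odot>\<^bsub>H\<^esub> w"
  by (rule ip_eqI) (simp_all add: ip_simps)

lemma bounded_operator_zero: "bounded_operator H T \<Longrightarrow> T \<zero>\<^bsub>H\<^esub> = \<zero>\<^bsub>H\<^esub>"
  using bounded_operator_smult[of T "\<zero>\<^bsub>H\<^esub>" 0] bounded_operator_closed[of T "\<zero>\<^bsub>H\<^esub>"] by simp

lemma bounded_operator_diff: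
  "bounded_operator H T \<Longrightarrow> v \<in> carrier H \<Longrightarrow> w \<in> carrier H \<Longrightarrow> T (v \<ominus>\<^bsub>H\<^esub> w) = T v \<ominus>\<^bsub>H\<^esub> T w"
  by (simp add: diff_eq_add_smult bounded_operator_add bounded_operator_smult bounded_operator_closed)

lemma bounded_operator_le_operator_norm:
  assumes T: "bounded_operator H T" and v: "v \<in> carrier H"
  shows "hnorm H (T v) \<le> operator_norm H T * hnorm H v"
proof (cases "v = \<zero>\<^bsub>H\<^esub>")
  case True
  then show ?thesis using T by (simp add: bounded_operator_zero)
next
  case False
  then have pos: "hnorm H v > 0" using v hnorm_eq_0[of v] hnorm_nonneg[of v] by linarith
  obtain C where C: "\<And>v. v \<in> carrier H \<Longrightarrow> hnorm H (T v) \<le> C * hnorm H v"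
    using T unfolding bounded_operator_def by blast
  have "hnorm H (T u) \<le> \<bar>C\<bar>" if u: "u \<in> carrier H" "hnorm H u \<le> 1" for u
  proof -
    have "hnorm H (T u) \<le> \<bar>C\<bar> * hnorm H u"
      using C[OF u(1)] u(1) by (meson abs_ge_self hnorm_nonneg mult_right_mono order_trans)
    also have "\<dots> \<le> \<bar>C\<bar> * 1" by (rule mult_left_mono) (use u in auto)
    finally show ?thesis by simp
  qed
  \<comment> \<open>The supremum of real numbers in \<open>operator_norm\<close> is meaningful only
    over a set that is bounded above.\<close>
  then have bdd: "bdd_above ((\<lambda>u. hnorm H (T u)) ` {u \<in> carrier H. hnorm H u \<le> 1})"
    by (intro bdd_aboveI[of _ "\<bar>C\<bar>"]) auto
  define u where "u = of_real (inverse (hnorm H v)) \<odot>\<^bsub>H\<^esub> v"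
  have u: "u \<in> carrier H" "hnorm H u = 1"
    using v pos by (simp_all add: u_def hnorm_smult norm_inverse)
  have "inverse (hnorm H v) * hnorm H (T v) = hnorm H (T u)"
    unfolding u_def using v T pos
    by (simp add: bounded_operator_smult hnorm_smult bounded_operator_closed norm_inverse)
  also have "\<dots> \<le> operator_norm H T"
    unfolding operator_norm_def by (rule cSUP_upper[OF _ bdd]) (use u in simp)
  finally show ?thesis using pos by (simp add: field_simps)
qed

lemma operator_norm_le:
  assumes "C \<ge> 0" and T: "\<And>v. v \<in> carrier H \<Longrightarrow> hnorm H (T v) \<le> C * hnorm H v"
  shows "operator_norm H T \<le> C"
  unfolding operator_norm_def
proof (rule cSUP_least)
  have "\<zero>\<^bsub>H\<^esub> \<in> {v \<in> carrier H. hnorm H v \<le> 1}" by simp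
  then show "{v \<in> carrier H. hnorm H v \<le> 1} \<noteq> {}" by blast
  fix v assume "v \<in> {v \<in> carrier H. hnorm H v \<le> 1}"
  then have "hnorm H (T v) \<le> C * hnorm H v" "C * hnorm H v \<le> C * 1"
    using T assms(1) by (auto intro!: mult_left_mono simp del: mult_1_right)
  then show "hnorm H (T v) \<le> C" by simp
qed

lemma operator_norm_nonneg:
  assumes T: "bounded_operator H T"
  shows "0 \<le> operator_norm H T"
proof (cases "carrier H = {\<zero>\<^bsub>H\<^esub>}")
  case True
  then have "{v \<in> carrier H. hnorm H v \<le> 1} = {\<zero>\<^bsub>H\<^esub>}" by auto
  then show ?thesis using T by (simp add: operator_norm_def bounded_operator_zero)
next
  case False
  then obtain v where v: "v \<in> carrier H" "v \<noteq> \<zero>\<^bsub>H\<^esub>" using M.zero_closed by blast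
  have "0 \<le> operator_norm H T * hnorm H v"
    using bounded_operator_le_operator_norm[OF T v(1)] hnorm_nonneg[OF bounded_operator_closed[OF T v(1)]]
    by linarith
  moreover have "hnorm H v > 0" using v hnorm_eq_0[of v] hnorm_nonneg[of v] by linarith
  ultimately show ?thesis by (simp add: zero_le_mult_iff)
qed

lemma compact_operator_totally_bounded:
  assumes T: "compact_operator H T"
  shows "totally_bounded (T ` {v \<in> carrier H. hnorm H v \<le> 1})"
proof -
  let ?S = "T ` {v \<in> carrier H. hnorm H v \<le> 1}"
  have SH: "?S \<subseteq> carrier H"
    using T bounded_operator_closed by (auto simp: compact_operator_def)
  then have "metric.mtotally_bounded ?S"
    using T metric.mtotally_bounded_eq_compact_closure_of[OF mcomplete, of ?S]
    by (simp add: compact_operator_def htopology_def)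
  then have *: "\<exists>K. finite K \<and> K \<subseteq> ?S \<and> ?S \<subseteq> (\<Union>x\<in>K. metric.mball x e)" if "e > 0" for e
    using that unfolding metric.mtotally_bounded_def by blast
  show ?thesis
    unfolding totally_bounded_def
  proof (intro conjI allI impI SH)
    fix e :: real assume "e > 0"
    obtain K where K: "finite K" "K \<subseteq> ?S" "?S \<subseteq> (\<Union>x\<in>K. metric.mball x e)"
      using *[OF \<open>e > 0\<close>] by blast
    have "\<exists>u\<in>K. hnorm H (x \<ominus>\<^bsub>H\<^esub> u) < e" if x: "x \<in> ?S" for x
    proof -
      obtain u where u: "u \<in> K" "x \<in> metric.mball u e" using x K(3) by blast
      then have "u \<in> carrier H" "x \<in> carrier H" "hnorm H (u \<ominus>\<^bsub>H\<^esub> x) < e"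
        by (auto simp: metric.in_mball hdist_def)
      then show ?thesis using u(1) hnorm_diff_commute by metis
    qed
    then show "\<exists>F. finite F \<and> F \<subseteq> carrier H \<and> (\<forall>x\<in>?S. \<exists>u\<in>F. hnorm H (x \<ominus>\<^bsub>H\<^esub> u) < e)"
      using K(1) subset_trans[OF K(2) SH] by (intro exI[of _ K]) simp
  qed
qed

end

locale star_rep =
  fixes A :: "'x star_algebra" and H :: "'h inner_space" and \<pi> :: "'x \<Rightarrow> 'h \<Rightarrow> 'h"
  assumes star_rep: "star_representation A H \<pi>"
begin

sublocale hilbert H
  by unfold_locales (use star_rep in \<open>simp add: star_representation_def\<close>)

lemma rep_bounded: "a \<in> carrier A \<Longrightarrow> bounded_operator H (\<pi> a)"
  using star_rep by (simp add: star_representation_def)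

lemma rep_closed [simp]: "a \<in> carrier A \<Longrightarrow> v \<in> carrier H \<Longrightarrow> \<pi> a v \<in> carrier H"
  using rep_bounded bounded_operator_closed by blast

lemma rep_add:
  "a \<in> carrier A \<Longrightarrow> b \<in> carrier A \<Longrightarrow> v \<in> carrier H \<Longrightarrow> \<pi> (a \<oplus>\<^bsub>A\<^esub> b) v = \<pi> a v \<oplus>\<^bsub>H\<^esub> \<pi> b v"
  using star_rep by (simp add: star_representation_def)

lemma rep_smult: "a \<in> carrier A \<Longrightarrow> v \<in> carrier H \<Longrightarrow> \<pi> (c \<odot>\<^bsub>A\<^esub> a) v = c \<odot>\<^bsub>H\<^esub> \<pi> a v"
  using star_rep by (simp add: star_representation_def)

lemma rep_mult:
  "a \<in> carrier A \<Longrightarrow> b \<in> carrier A \<Longrightarrow> v \<in> carrier H \<Longrightarrow> \<pi> (a \<otimes>\<^bsub>A\<^esub> b) v = \<pi> a (\<pi> b v)"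
  using star_rep by (simp add: star_representation_def)

lemma rep_star:
  "a \<in> carrier A \<Longrightarrow> v \<in> carrier H \<Longrightarrow> w \<in> carrier H \<Longrightarrow> ip (\<pi> (star A a) v) w = ip v (\<pi> a w)"
  using star_rep by (simp add: star_representation_def)

end


section \<open>Seminormed *-algebras and their completions\<close>

text \<open>The identities \<open>(a b)\<^sup>* = b\<^sup>* a\<^sup>*\<close> and \<open>a\<^sup>*\<^sup>* = a\<close> are only required up to elements of seminorm 0,
  and associativity not at all: for the seminorm of a group algebra the representations alone yield
  this much, without any theorem of Fubini type.\<close>

locale seminormed_star_algebra =
  fixes A :: "('x::ab_group_add) star_algebra" and p :: "'x \<Rightarrow> real"
  assumes add_A: "add A = (+)" and zero_A: "zero A = 0"
    and zero_mem: "0 \<in> carrier A"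
    and add_mem: "a \<in> carrier A \<Longrightarrow> b \<in> carrier A \<Longrightarrow> a + b \<in> carrier A"
    and smult_mem: "a \<in> carrier A \<Longrightarrow> c \<odot>\<^bsub>A\<^esub> a \<in> carrier A"
    and mult_mem: "a \<in> carrier A \<Longrightarrow> b \<in> carrier A \<Longrightarrow> a \<otimes>\<^bsub>A\<^esub> b \<in> carrier A"
    and star_mem: "a \<in> carrier A \<Longrightarrow> star A a \<in> carrier A"
    and smult_minus: "a \<in> carrier A \<Longrightarrow> (-1) \<odot>\<^bsub>A\<^esub> a = - a"
    and smult_half: "a \<in> carrier A \<Longrightarrow> (1/2) \<odot>\<^bsub>A\<^esub> a + (1/2) \<odot>\<^bsub>A\<^esub> a = a"
    and smult_inverse: "a \<in> carrier A \<Longrightarrow> c \<noteq> 0 \<Longrightarrow> c \<odot>\<^bsub>A\<^esub> (inverse c \<odot>\<^bsub>A\<^esub> a) = a"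
    and smult_diff: "a \<in> carrier A \<Longrightarrow> b \<in> carrier A \<Longrightarrow> c \<odot>\<^bsub>A\<^esub> (a - b) = c \<odot>\<^bsub>A\<^esub> a - c \<odot>\<^bsub>A\<^esub> b"
    and mult_diff_left: "a \<in> carrier A \<Longrightarrow> b \<in> carrier A \<Longrightarrow> d \<in> carrier A \<Longrightarrow>
          (a - b) \<otimes>\<^bsub>A\<^esub> d = a \<otimes>\<^bsub>A\<^esub> d - b \<otimes>\<^bsub>A\<^esub> d"
    and mult_diff_right: "a \<in> carrier A \<Longrightarrow> b \<in> carrier A \<Longrightarrow> d \<in> carrier A \<Longrightarrow>
          d \<otimes>\<^bsub>A\<^esub> (a - b) = d \<otimes>\<^bsub>A\<^esub> a - d \<otimes>\<^bsub>A\<^esub> b"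
    and star_diff: "a \<in> carrier A \<Longrightarrow> b \<in> carrier A \<Longrightarrow> star A (a - b) = star A a - star A b"
    and star_smult: "a \<in> carrier A \<Longrightarrow> star A (c \<odot>\<^bsub>A\<^esub> a) = cnj c \<odot>\<^bsub>A\<^esub> star A a"
    and p_nonneg: "a \<in> carrier A \<Longrightarrow> 0 \<le> p a"
    and p_add: "a \<in> carrier A \<Longrightarrow> b \<in> carrier A \<Longrightarrow> p (a + b) \<le> p a + p b"
    and p_smult: "a \<in> carrier A \<Longrightarrow> p (c \<odot>\<^bsub>A\<^esub> a) \<le> cmod c * p a"
    and p_mult: "a \<in> carrier A \<Longrightarrow> b \<in> carrier A \<Longrightarrow> p (a \<otimes>\<^bsub>A\<^esub> b) \<le> p a * p b"
    and p_star: "a \<in> carrier A \<Longrightarrow> p (star A a) \<le> p a"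
    and p_star_mult: "a \<in> carrier A \<Longrightarrow> b \<in> carrier A \<Longrightarrow>
          p (star A (a \<otimes>\<^bsub>A\<^esub> b) - star A b \<otimes>\<^bsub>A\<^esub> star A a) = 0"
    and p_star_star: "a \<in> carrier A \<Longrightarrow> p (star A (star A a) - a) = 0"
begin

lemma minus_mem: "a \<in> carrier A \<Longrightarrow> - a \<in> carrier A"
  using smult_mem[of a "-1"] smult_minus[of a] by simp

lemma diff_mem: "a \<in> carrier A \<Longrightarrow> b \<in> carrier A \<Longrightarrow> a - b \<in> carrier A"
  using add_mem[of a "- b"] minus_mem[of b] by simp

lemmas mem_intros = zero_mem add_mem smult_mem mult_mem star_mem minus_mem diff_mem

text \<open>\<open>A\<close> is not known to be an abelian group in the algebraic sense, so its
  subtraction is evaluated directly from the description of the inverse.\<close>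

lemma a_minus_A: "a \<in> carrier A \<Longrightarrow> b \<in> carrier A \<Longrightarrow> a \<ominus>\<^bsub>A\<^esub> b = a - b"
proof -
  assume ab: "a \<in> carrier A" "b \<in> carrier A"
  have "\<ominus>\<^bsub>A\<^esub> b = - b"
    unfolding a_inv_def m_inv_def
    by (rule the_equality)
      (auto simp: add_A zero_A ab minus_mem eq_neg_iff_add_eq_0 add.commute)
  then show ?thesis by (simp add: a_minus_def add_A)
qed

lemma smult_zero: "c \<odot>\<^bsub>A\<^esub> 0 = 0"
  using smult_diff[of 0 0 c] zero_mem by simp

lemma smult_add: "a \<in> carrier A \<Longrightarrow> b \<in> carrier A \<Longrightarrow> c \<odot>\<^bsub>A\<^esub> (a + b) = c \<odot>\<^bsub>A\<^esub> a + c \<odot>\<^bsub>A\<^esub> b"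
  using smult_diff[of a "0 - b" c] smult_diff[of 0 b c] smult_zero[of c]
  by (simp add: mem_intros)

lemma star_add: "a \<in> carrier A \<Longrightarrow> b \<in> carrier A \<Longrightarrow> star A (a + b) = star A a + star A b"
  using star_diff[of a "0 - b"] star_diff[of 0 b] star_diff[of 0 0] by (simp add: mem_intros)

lemma p_zero [simp]: "p 0 = 0"
  using p_smult[of 0 0] p_nonneg[of 0] zero_mem by (simp add: smult_zero)

lemma p_minus: "a \<in> carrier A \<Longrightarrow> p (- a) = p a"
  using p_smult[of a "-1"] p_smult[of "- a" "-1"] smult_minus[of a] smult_minus[of "- a"] minus_mem[of a]
  by simp

lemma p_diff_commute: "a \<in> carrier A \<Longrightarrow> b \<in> carrier A \<Longrightarrow> p (a - b) = p (b - a)"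
  using p_minus[of "a - b"] diff_mem[of a b] by simp

lemma p_diff: "a \<in> carrier A \<Longrightarrow> b \<in> carrier A \<Longrightarrow> p (a - b) \<le> p a + p b"
  using p_add[of a "- b"] p_minus[of b] minus_mem[of b] by simp

lemma p_triangle:
  assumes "a \<in> carrier A" "b \<in> carrier A" "c \<in> carrier A"
  shows "p (a - c) \<le> p (a - b) + p (b - c)"
  using p_add[of "a - b" "b - c"] assms by (simp add: mem_intros)

lemma p_mult_diff:
  assumes "a \<in> carrier A" "b \<in> carrier A" "a' \<in> carrier A" "b' \<in> carrier A"
  shows "p (a \<otimes>\<^bsub>A\<^esub> b - a' \<otimes>\<^bsub>A\<^esub> b') \<le> p (a - a') * p b + p a' * p (b - b')"
proof -
  have "a \<otimes>\<^bsub>A\<^esub> b - a' \<otimes>\<^bsub>A\<^esub> b' = (a - a') \<otimes>\<^bsub>A\<^esub> b + a' \<otimes>\<^bsub>A\<^esub> (b - b')"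
    using assms by (simp add: mult_diff_left mult_diff_right)
  also have "p \<dots> \<le> p ((a - a') \<otimes>\<^bsub>A\<^esub> b) + p (a' \<otimes>\<^bsub>A\<^esub> (b - b'))"
    using assms by (intro p_add mem_intros)
  also have "\<dots> \<le> p (a - a') * p b + p a' * p (b - b')"
    using assms by (intro add_mono p_mult mem_intros)
  finally show ?thesis .
qed

subsection \<open>Cauchy sequences\<close>

abbreviation cauchy :: "(nat \<Rightarrow> 'x) \<Rightarrow> bool" where
  "cauchy s \<equiv> s \<in> Cauchy_sequences A p"

lemma cauchy_iff:
  "cauchy s \<longleftrightarrow> (\<forall>n. s n \<in> carrier A) \<and> (\<forall>e>0. \<exists>N. \<forall>m\<ge>N. \<forall>n\<ge>N. p (s m - s n) < e)"
  unfolding Cauchy_sequences_def by (auto simp: a_minus_A image_subset_iff)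

lemma cauchy_mem: "cauchy s \<Longrightarrow> s n \<in> carrier A"
  by (simp add: cauchy_iff)

lemma cauchyD:
  assumes "cauchy s" "e > 0"
  obtains N where "\<And>m n. m \<ge> N \<Longrightarrow> n \<ge> N \<Longrightarrow> p (s m - s n) < e"
  using assms unfolding cauchy_iff by meson

lemma cauchy_const: "a \<in> carrier A \<Longrightarrow> cauchy (\<lambda>_. a)"
  by (simp add: cauchy_iff)

lemma cauchy_bounded:
  assumes s: "cauchy s"
  obtains B where "B > 0" "\<And>n. p (s n) \<le> B"
proof -
  obtain N where N: "\<And>m n. m \<ge> N \<Longrightarrow> n \<ge> N \<Longrightarrow> p (s m - s n) < 1"
    using cauchyD[OF s, of 1] by auto
  define B where "B = Max ((\<lambda>n. p (s n)) ` {..N}) + 1"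
  have B: "p (s n) \<le> B - 1" if "n \<le> N" for n
    unfolding B_def using that by (auto intro!: Max_ge)
  have "p (s n) \<le> B" for n
  proof (cases "n \<le> N")
    case False
    then have "p (s n - s N) < 1" using N by simp
    moreover have "p (s n) \<le> p (s n - s N) + p (s N)"
      using p_add[of "s n - s N" "s N"] s by (simp add: cauchy_mem mem_intros)
    ultimately show ?thesis using B[of N] by simp
  qed (use B[of n] in simp)
  moreover have "B > 0"
    using B[of N] p_nonneg[of "s N"] s by (simp add: cauchy_mem)
  ultimately show ?thesis using that by blast
qed

definition null :: "(nat \<Rightarrow> 'x) \<Rightarrow> (nat \<Rightarrow> 'x) \<Rightarrow> bool" where
  "null s t \<longleftrightarrow> cauchy s \<and> cauchy t \<and> (\<lambda>n. p (s n - t n)) \<longlonglongrightarrow> 0"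

lemma null_relation_iff: "(s, t) \<in> null_relation A p \<longleftrightarrow> null s t"
  unfolding null_relation_def null_def by (auto simp: cauchy_mem a_minus_A)

lemma tendsto_p_0:
  assumes "\<And>n. a n \<in> carrier A" "\<And>n. p (a n) \<le> b n" "b \<longlonglongrightarrow> 0"
  shows "(\<lambda>n. p (a n)) \<longlonglongrightarrow> 0"
  by (rule tendsto_sandwich[OF _ _ tendsto_const assms(3)]) (use assms p_nonneg in auto)

lemma null_refl: "cauchy s \<Longrightarrow> null s s"
  by (simp add: null_def)

lemma null_sym: "null s t \<Longrightarrow> null t s"
  unfolding null_def using p_diff_commute[OF cauchy_mem cauchy_mem, of s t] by auto

lemma null_trans:
  assumes "null s t" "null t u"
  shows "null s u"
proof -
  have "(\<lambda>n. p (s n - u n)) \<longlonglongrightarrow> 0"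
  proof (rule tendsto_p_0)
    show "(\<lambda>n. p (s n - t n) + p (t n - u n)) \<longlonglongrightarrow> 0"
      using assms by (auto simp: null_def intro: tendsto_add_zero)
  qed (use assms in \<open>simp_all add: null_def mem_intros cauchy_mem p_triangle\<close>)
  then show ?thesis using assms by (simp add: null_def)
qed

definition cls :: "(nat \<Rightarrow> 'x) \<Rightarrow> (nat \<Rightarrow> 'x) set" where
  "cls s = null_relation A p `` {s}"

lemma in_cls: "t \<in> cls s \<longleftrightarrow> null s t"
  by (simp add: cls_def null_relation_iff)

lemma cls_eq:
  assumes "null s t"
  shows "cls s = cls t"
proof (rule Set.set_eqI)
  show "u \<in> cls s \<longleftrightarrow> u \<in> cls t" for u
    using assms null_sym[OF assms] null_trans[of t s u] null_trans[of s t u] unfolding in_cls by blast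
qed

lemma carrier_completion: "carrier (completion A p) = cls ` {s. cauchy s}"
  by (auto simp: completion_def quotient_def cls_def)

lemma cauchy_add:
  assumes "cauchy s" "cauchy t"
  shows "cauchy (\<lambda>n. s n + t n)"
  unfolding cauchy_iff
proof (intro conjI allI impI)
  fix e :: real assume "e > 0"
  then have e: "e/2 > 0" by simp
  obtain N where N: "\<And>m n. m \<ge> N \<Longrightarrow> n \<ge> N \<Longrightarrow> p (s m - s n) < e/2"
    using cauchyD[OF assms(1) e] by blast
  obtain N' where N': "\<And>m n. m \<ge> N' \<Longrightarrow> n \<ge> N' \<Longrightarrow> p (t m - t n) < e/2"
    using cauchyD[OF assms(2) e] by blast
  have "p (s m + t m - (s n + t n)) < e" if "m \<ge> max N N'" "n \<ge> max N N'" for m n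
  proof -
    have "p (s m + t m - (s n + t n)) \<le> p (s m - s n) + p (t m - t n)"
      using p_add[of "s m - s n" "t m - t n"] assms
      by (simp add: cauchy_mem mem_intros algebra_simps)
    then show ?thesis using N[of m n] N'[of m n] that by simp
  qed
  then show "\<exists>N. \<forall>m\<ge>N. \<forall>n\<ge>N. p (s m + t m - (s n + t n)) < e" by blast
qed (use assms in \<open>simp add: cauchy_mem mem_intros\<close>)

lemma null_add:
  assumes "null s s'" "null t t'"
  shows "null (\<lambda>n. s n + t n) (\<lambda>n. s' n + t' n)"
  unfolding null_def
proof (intro conjI tendsto_p_0)
  show "(\<lambda>n. p (s n - s' n) + p (t n - t' n)) \<longlonglongrightarrow> 0"
    using assms by (auto simp: null_def intro: tendsto_add_zero)
  fix n
  show "p (s n + t n - (s' n + t' n)) \<le> p (s n - s' n) + p (t n - t' n)"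
    using p_add[of "s n - s' n" "t n - t' n"] assms
    by (simp add: null_def cauchy_mem mem_intros algebra_simps)
qed (use assms in \<open>simp_all add: null_def cauchy_add mem_intros cauchy_mem\<close>)

lemma cauchy_smult:
  assumes "cauchy s"
  shows "cauchy (\<lambda>n. c \<odot>\<^bsub>A\<^esub> s n)"
  unfolding cauchy_iff
proof (intro conjI allI impI)
  fix e :: real assume "e > 0"
  then have e: "e / (cmod c + 1) > 0" by (simp add: add_nonneg_pos)
  obtain N where N: "\<And>m n. m \<ge> N \<Longrightarrow> n \<ge> N \<Longrightarrow> p (s m - s n) < e / (cmod c + 1)"
    using cauchyD[OF assms(1) e] by blast
  have "p (c \<odot>\<^bsub>A\<^esub> s m - c \<odot>\<^bsub>A\<^esub> s n) < e" if "m \<ge> N" "n \<ge> N" for m n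
  proof -
    have "p (c \<odot>\<^bsub>A\<^esub> s m - c \<odot>\<^bsub>A\<^esub> s n) \<le> cmod c * p (s m - s n)"
      using p_smult[of "s m - s n" c] assms by (simp add: smult_diff cauchy_mem mem_intros)
    also have "\<dots> \<le> (cmod c + 1) * p (s m - s n)"
      using assms by (intro mult_right_mono p_nonneg mem_intros) (auto simp: cauchy_mem)
    also have "\<dots> < e"
      using N[OF that] by (simp add: pos_less_divide_eq add_nonneg_pos mult.commute)
    finally show ?thesis .
  qed
  then show "\<exists>N. \<forall>m\<ge>N. \<forall>n\<ge>N. p (c \<odot>\<^bsub>A\<^esub> s m - c \<odot>\<^bsub>A\<^esub> s n) < e" by blast
qed (use assms in \<open>simp add: cauchy_mem mem_intros\<close>)

lemma null_smult:
  assumes "null s s'"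
  shows "null (\<lambda>n. c \<odot>\<^bsub>A\<^esub> s n) (\<lambda>n. c \<odot>\<^bsub>A\<^esub> s' n)"
  unfolding null_def
proof (intro conjI tendsto_p_0)
  show "(\<lambda>n. cmod c * p (s n - s' n)) \<longlonglongrightarrow> 0"
    using assms tendsto_mult_right_zero by (auto simp: null_def)
  fix n
  show "p (c \<odot>\<^bsub>A\<^esub> s n - c \<odot>\<^bsub>A\<^esub> s' n) \<le> cmod c * p (s n - s' n)"
    using p_smult[of "s n - s' n" c] assms
    by (simp add: null_def smult_diff cauchy_mem mem_intros)
qed (use assms in \<open>simp_all add: null_def cauchy_smult mem_intros cauchy_mem\<close>)

lemma cauchy_star:
  assumes "cauchy s"
  shows "cauchy (\<lambda>n. star A (s n))"
  unfolding cauchy_iff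
proof (intro conjI allI impI)
  fix e :: real assume "e > 0"
  then obtain N where N: "\<And>m n. m \<ge> N \<Longrightarrow> n \<ge> N \<Longrightarrow> p (s m - s n) < e"
    using cauchyD[OF assms(1)] by blast
  have "p (star A (s m) - star A (s n)) < e" if "m \<ge> N" "n \<ge> N" for m n
    using p_star[of "s m - s n"] N[OF that] assms by (simp add: star_diff cauchy_mem mem_intros)
  then show "\<exists>N. \<forall>m\<ge>N. \<forall>n\<ge>N. p (star A (s m) - star A (s n)) < e" by blast
qed (use assms in \<open>simp add: cauchy_mem mem_intros\<close>)

lemma null_star:
  assumes "null s s'"
  shows "null (\<lambda>n. star A (s n)) (\<lambda>n. star A (s' n))"
  unfolding null_def
proof (intro conjI tendsto_p_0)
  show "(\<lambda>n. p (s n - s' n)) \<longlonglongrightarrow> 0"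
    using assms by (auto simp: null_def)
  fix n
  show "p (star A (s n) - star A (s' n)) \<le> p (s n - s' n)"
    using p_star[of "s n - s' n"] assms by (simp add: null_def star_diff cauchy_mem mem_intros)
qed (use assms in \<open>simp_all add: null_def cauchy_star mem_intros cauchy_mem\<close>)

lemma cauchy_mult:
  assumes s: "cauchy s" and t: "cauchy t"
  shows "cauchy (\<lambda>n. s n \<otimes>\<^bsub>A\<^esub> t n)"
  unfolding cauchy_iff
proof (intro conjI allI impI)
  fix e :: real assume "e > 0"
  obtain B where B: "B > 0" "\<And>n. p (s n) \<le> B" using cauchy_bounded[OF s] by blast
  obtain C where C: "C > 0" "\<And>n. p (t n) \<le> C" using cauchy_bounded[OF t] by blast
  have e: "e / (2 * C) > 0" "e / (2 * B) > 0" using \<open>e > 0\<close> B C by simp_all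
  obtain N where N: "\<And>m n. m \<ge> N \<Longrightarrow> n \<ge> N \<Longrightarrow> p (s m - s n) < e / (2 * C)"
    using cauchyD[OF s e(1)] by blast
  obtain N' where N': "\<And>m n. m \<ge> N' \<Longrightarrow> n \<ge> N' \<Longrightarrow> p (t m - t n) < e / (2 * B)"
    using cauchyD[OF t e(2)] by blast
  have "p (s m \<otimes>\<^bsub>A\<^esub> t m - s n \<otimes>\<^bsub>A\<^esub> t n) < e" if "m \<ge> max N N'" "n \<ge> max N N'" for m n
  proof -
    have "p (s m \<otimes>\<^bsub>A\<^esub> t m - s n \<otimes>\<^bsub>A\<^esub> t n) \<le> p (s m - s n) * p (t m) + p (s n) * p (t m - t n)"
      using s t by (intro p_mult_diff cauchy_mem)
    also have "\<dots> \<le> p (s m - s n) * C + B * p (t m - t n)"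
      using s t B C by (intro add_mono mult_left_mono mult_right_mono p_nonneg mem_intros cauchy_mem)
    also have "\<dots> < e / (2 * C) * C + B * (e / (2 * B))"
      using N[of m n] N'[of m n] B C that
      by (intro add_strict_mono mult_strict_right_mono mult_strict_left_mono) auto
    also have "\<dots> = e" using B C by simp
    finally show ?thesis .
  qed
  then show "\<exists>N. \<forall>m\<ge>N. \<forall>n\<ge>N. p (s m \<otimes>\<^bsub>A\<^esub> t m - s n \<otimes>\<^bsub>A\<^esub> t n) < e" by blast
qed (use assms in \<open>simp add: cauchy_mem mem_intros\<close>)

lemma null_mult:
  assumes s: "null s s'" and t: "null t t'"
  shows "null (\<lambda>n. s n \<otimes>\<^bsub>A\<^esub> t n) (\<lambda>n. s' n \<otimes>\<^bsub>A\<^esub> t' n)"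
proof -
  have cau: "cauchy s" "cauchy s'" "cauchy t" "cauchy t'" using s t by (auto simp: null_def)
  obtain B where B: "B > 0" "\<And>n. p (s' n) \<le> B" using cauchy_bounded[OF cau(2)] by blast
  obtain C where C: "C > 0" "\<And>n. p (t n) \<le> C" using cauchy_bounded[OF cau(3)] by blast
  have "(\<lambda>n. p (s n \<otimes>\<^bsub>A\<^esub> t n - s' n \<otimes>\<^bsub>A\<^esub> t' n)) \<longlonglongrightarrow> 0"
  proof (rule tendsto_p_0)
    show "(\<lambda>n. p (s n - s' n) * C + B * p (t n - t' n)) \<longlonglongrightarrow> 0"
      using s t unfolding null_def
      by (intro tendsto_add_zero tendsto_mult_left_zero tendsto_mult_right_zero) auto
    fix n
    have "p (s n \<otimes>\<^bsub>A\<^esub> t n - s' n \<otimes>\<^bsub>A\<^esub> t' n) \<le> p (s n - s' n) * p (t n) + p (s' n) * p (t n - t' n)"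
      using cau by (intro p_mult_diff cauchy_mem)
    also have "\<dots> \<le> p (s n - s' n) * C + B * p (t n - t' n)"
      using cau B C by (intro add_mono mult_left_mono mult_right_mono p_nonneg mem_intros cauchy_mem)
    finally show "p (s n \<otimes>\<^bsub>A\<^esub> t n - s' n \<otimes>\<^bsub>A\<^esub> t' n) \<le> p (s n - s' n) * C + B * p (t n - t' n)" .
  qed (use cau in \<open>simp_all add: null_def mem_intros cauchy_mem\<close>)
  then show ?thesis using cau by (simp add: null_def cauchy_mult)
qed

text \<open>Classes ignore initial segments, so a bound on a tail of a sequence is as good as a
  bound on all of it; \<open>rho_le\<close> relies on this.\<close>

lemma null_shift:
  assumes s: "cauchy s"
  shows "null s (\<lambda>n. s (n + N))"
  unfolding null_def
proof (intro conjI s)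
  have *: "\<exists>M. \<forall>n\<ge>M. \<forall>m\<ge>n. p (s n - s m) < e" if "e > 0" for e
    using cauchyD[OF s that] by (metis order_trans)
  show "cauchy (\<lambda>n. s (n + N))"
    using s unfolding cauchy_iff by (meson trans_le_add1)
  show "(\<lambda>n. p (s n - s (n + N))) \<longlonglongrightarrow> 0"
  proof (rule LIMSEQ_I)
    fix e :: real assume "e > 0"
    then show "\<exists>M. \<forall>n\<ge>M. norm (p (s n - s (n + N)) - 0) < e"
      using *[of e] p_nonneg[OF diff_mem[OF cauchy_mem[OF s] cauchy_mem[OF s]]] by fastforce
  qed
qed

text \<open>Equivalent representatives contribute the same class, so the union in
  \<open>completion\<close> collapses to a single class.\<close>

lemma Union_cls:
  assumes "cauchy s" "\<And>s'. null s s' \<Longrightarrow> null (f s) (f s')"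
  shows "(\<Union>s'\<in>cls s. null_relation A p `` {f s'}) = cls (f s)"
proof -
  have "null_relation A p `` {f s'} = cls (f s)" if "s' \<in> cls s" for s'
    using cls_eq[OF assms(2)[of s']] that unfolding in_cls by (simp add: cls_def)
  moreover have "s \<in> cls s" using null_refl[OF assms(1)] by (simp add: in_cls)
  ultimately show ?thesis by blast
qed

lemma Union2_cls:
  assumes "cauchy s" "cauchy t"
    "\<And>s' t'. null s s' \<Longrightarrow> null t t' \<Longrightarrow> null (f s t) (f s' t')"
  shows "(\<Union>s'\<in>cls s. \<Union>t'\<in>cls t. null_relation A p `` {f s' t'}) = cls (f s t)"
proof -
  have "null_relation A p `` {f s' t'} = cls (f s t)" if "s' \<in> cls s" "t' \<in> cls t" for s' t'
    using cls_eq[OF assms(3)[of s' t']] that unfolding in_cls by (simp add: cls_def)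
  moreover have "s \<in> cls s" "t \<in> cls t" using null_refl assms by (auto simp: in_cls)
  ultimately show ?thesis by blast
qed

lemma completion_add:
  "cauchy s \<Longrightarrow> cauchy t \<Longrightarrow> cls s \<oplus>\<^bsub>completion A p\<^esub> cls t = cls (\<lambda>n. s n + t n)"
  unfolding completion_def by (simp add: add_A Union2_cls null_add)

lemma completion_mult:
  "cauchy s \<Longrightarrow> cauchy t \<Longrightarrow> cls s \<otimes>\<^bsub>completion A p\<^esub> cls t = cls (\<lambda>n. s n \<otimes>\<^bsub>A\<^esub> t n)"
  unfolding completion_def by (simp add: Union2_cls null_mult)

lemma completion_smult:
  "cauchy s \<Longrightarrow> c \<odot>\<^bsub>completion A p\<^esub> cls s = cls (\<lambda>n. c \<odot>\<^bsub>A\<^esub> s n)"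
  unfolding completion_def by (simp add: Union_cls null_smult)

lemma completion_star:
  "cauchy s \<Longrightarrow> star (completion A p) (cls s) = cls (\<lambda>n. star A (s n))"
  unfolding completion_def by (simp add: Union_cls null_star)

subsection \<open>Square roots\<close>

text \<open>For \<open>p a < 1\<close> the iterates converge to a solution \<open>c\<close> of \<open>2 c - c\<^sup>2 = a\<close>, that is to
  \<open>1 - sqrt (1 - a)\<close>.\<close>

primrec root_iter :: "'x \<Rightarrow> nat \<Rightarrow> 'x" where
  "root_iter a 0 = 0"
| "root_iter a (Suc k) = (1/2) \<odot>\<^bsub>A\<^esub> (a + root_iter a k \<otimes>\<^bsub>A\<^esub> root_iter a k)"

lemma root_iter_mem: "a \<in> carrier A \<Longrightarrow> root_iter a k \<in> carrier A"
  by (induction k) (simp_all add: mem_intros)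

lemma p_half: "a \<in> carrier A \<Longrightarrow> p ((1/2) \<odot>\<^bsub>A\<^esub> a) \<le> p a / 2"
  using p_smult[of a "1/2"] by simp

text \<open>The ball of radius \<open>q\<close> is preserved because (q + q^2)/2 is at most q for q
  below 1.\<close>

lemma root_iter_le:
  assumes a: "a \<in> carrier A" "p a \<le> q" and q: "q < 1"
  shows "p (root_iter a k) \<le> q"
proof (induction k)
  case 0
  show ?case using a p_nonneg[of a] by simp
next
  case (Suc k)
  have q0: "0 \<le> q" using a p_nonneg[of a] by simp
  let ?c = "root_iter a k"
  have c: "?c \<in> carrier A" using a by (simp add: root_iter_mem)
  have "p (?c \<otimes>\<^bsub>A\<^esub> ?c) \<le> p ?c * p ?c" using c by (simp add: p_mult)
  also have "\<dots> \<le> q * q" using Suc c q0 by (intro mult_mono p_nonneg)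
  also have "\<dots> \<le> q" using q q0 by (simp add: mult_left_le)
  finally have "p (a + ?c \<otimes>\<^bsub>A\<^esub> ?c) \<le> q + q"
    using p_add[of a "?c \<otimes>\<^bsub>A\<^esub> ?c"] a c by (simp add: mem_intros)
  then show ?case
    using p_half[of "a + ?c \<otimes>\<^bsub>A\<^esub> ?c"] a c by (simp add: mem_intros)
qed

text \<open>Steps shrink by the factor \<open>q\<close>: half of d^2 - c^2 = (d - c) d + c (d - c)
  is estimated with \<open>c\<close> and \<open>d\<close> of seminorm at most
  \<open>q\<close>.\<close>

lemma root_iter_step:
  assumes a: "a \<in> carrier A" "p a \<le> q" and q: "q < 1"
  shows "p (root_iter a (Suc k) - root_iter a k) \<le> q ^ Suc k"
proof (induction k)
  case 0
  have "p ((1/2) \<odot>\<^bsub>A\<^esub> (a + 0 \<otimes>\<^bsub>A\<^esub> 0)) \<le> p a / 2"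
    using p_half[of a] a mult_diff_left[of 0 0 0] by (simp add: mem_intros)
  then show ?case using a p_nonneg[of a] by simp
next
  case (Suc k)
  have q0: "0 \<le> q" using a p_nonneg[of a] by simp
  define c d where "c = root_iter a k" and "d = root_iter a (Suc k)"
  have cd: "c \<in> carrier A" "d \<in> carrier A" using a by (simp_all only: c_def d_def root_iter_mem)
  have bd: "p c \<le> q" "p d \<le> q" unfolding c_def d_def using a q by (intro root_iter_le; simp)+
  have "(1/2) \<odot>\<^bsub>A\<^esub> (a + d \<otimes>\<^bsub>A\<^esub> d) - (1/2) \<odot>\<^bsub>A\<^esub> (a + c \<otimes>\<^bsub>A\<^esub> c) = (1/2) \<odot>\<^bsub>A\<^esub> (d \<otimes>\<^bsub>A\<^esub> d - c \<otimes>\<^bsub>A\<^esub> c)"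
    using a cd by (simp add: smult_diff[symmetric] mem_intros)
  then have "root_iter a (Suc (Suc k)) - root_iter a (Suc k) = (1/2) \<odot>\<^bsub>A\<^esub> (d \<otimes>\<^bsub>A\<^esub> d - c \<otimes>\<^bsub>A\<^esub> c)"
    by (simp add: c_def d_def)
  also have "p \<dots> \<le> p (d \<otimes>\<^bsub>A\<^esub> d - c \<otimes>\<^bsub>A\<^esub> c) / 2"
    using cd by (intro p_half mem_intros)
  also have "\<dots> \<le> (p (d - c) * p d + p c * p (d - c)) / 2"
    using p_mult_diff[of d d c c] cd by simp
  also have "\<dots> \<le> (q ^ Suc k * q + q * q ^ Suc k) / 2"
    using Suc bd cd q0 unfolding c_def[symmetric] d_def[symmetric]
    by (intro divide_right_mono add_mono mult_mono p_nonneg mem_intros) auto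
  also have "\<dots> = q ^ Suc (Suc k)" by simp
  finally show ?case .
qed

text \<open>Twice the next iterate is \<open>a\<close> plus the square of the current one, so the
  defect of the current one is twice a step of the iteration.\<close>

lemma root_iter_residual:
  assumes a: "a \<in> carrier A" "p a \<le> q" and q: "q < 1"
  shows "p (root_iter a k + root_iter a k - root_iter a k \<otimes>\<^bsub>A\<^esub> root_iter a k - a) \<le> 2 * q ^ Suc k"
proof -
  define c d where "c = root_iter a k" and "d = root_iter a (Suc k)"
  have cd: "c \<in> carrier A" "d \<in> carrier A" using a by (simp_all only: c_def d_def root_iter_mem)
  have "d + d = a + c \<otimes>\<^bsub>A\<^esub> c"
    using smult_half[of "a + c \<otimes>\<^bsub>A\<^esub> c"] a cd by (simp add: d_def c_def mem_intros)
  then have "c + c - c \<otimes>\<^bsub>A\<^esub> c - a = (c - d) + (c - d)"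
    by (simp add: algebra_simps)
  also have "p \<dots> \<le> p (d - c) + p (d - c)"
    using p_add[of "c - d" "c - d"] p_diff_commute[of c d] cd by (simp add: mem_intros)
  also have "\<dots> \<le> 2 * q ^ Suc k"
    using root_iter_step[OF a q, of k] unfolding c_def d_def by linarith
  finally show ?thesis by (simp add: c_def)
qed

text \<open>Self-adjointness passes through the iteration only up to seminorm 0, because the
  involution reverses products only in that sense.\<close>

lemma root_iter_star:
  assumes a: "a \<in> carrier A" "p (star A a - a) = 0"
  shows "p (star A (root_iter a k) - root_iter a k) = 0"
proof (induction k)
  case 0
  show ?case using star_diff[of 0 0] by (simp add: mem_intros)
next
  case (Suc k)
  define c where "c = root_iter a k"
  have c: "c \<in> carrier A" using a by (simp add: c_def root_iter_mem)
  have IH: "p (star A c - c) = 0" using Suc by (simp add: c_def)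
  have "p (star A c \<otimes>\<^bsub>A\<^esub> star A c - c \<otimes>\<^bsub>A\<^esub> c) \<le> 0"
    using p_mult_diff[of "star A c" "star A c" c c] c IH by (simp add: mem_intros)
  then have "p (star A (c \<otimes>\<^bsub>A\<^esub> c) - c \<otimes>\<^bsub>A\<^esub> c) \<le> 0"
    using p_triangle[of "star A (c \<otimes>\<^bsub>A\<^esub> c)" "star A c \<otimes>\<^bsub>A\<^esub> star A c" "c \<otimes>\<^bsub>A\<^esub> c"] p_star_mult[of c c] c
    by (simp add: mem_intros)
  then have "p ((star A a - a) + (star A (c \<otimes>\<^bsub>A\<^esub> c) - c \<otimes>\<^bsub>A\<^esub> c)) \<le> 0"
    using p_add[of "star A a - a" "star A (c \<otimes>\<^bsub>A\<^esub> c) - c \<otimes>\<^bsub>A\<^esub> c"] a c by (simp add: mem_intros)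
  then have *: "p (star A (a + c \<otimes>\<^bsub>A\<^esub> c) - (a + c \<otimes>\<^bsub>A\<^esub> c)) \<le> 0"
    using a c by (simp add: star_add mem_intros algebra_simps)
  have "star A (root_iter a (Suc k)) - root_iter a (Suc k)
      = (1/2) \<odot>\<^bsub>A\<^esub> (star A (a + c \<otimes>\<^bsub>A\<^esub> c) - (a + c \<otimes>\<^bsub>A\<^esub> c))"
    using a c by (simp add: star_smult smult_diff mem_intros flip: c_def)
  also have "p \<dots> \<le> 0"
    using p_half[of "star A (a + c \<otimes>\<^bsub>A\<^esub> c) - (a + c \<otimes>\<^bsub>A\<^esub> c)"] * a c by (simp add: mem_intros)
  finally show ?case
    using p_nonneg[of "star A (root_iter a (Suc k)) - root_iter a (Suc k)"] a
      root_iter_mem[of a "Suc k"] by (simp add: mem_intros del: root_iter.simps)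
qed

text \<open>The iteration runs along the diagonal, \<open>n\<close> rounds on the
  \<open>n\<close>-th term, so that the defects tend to 0. Up to these defects the solution depends
  on \<open>s\<close> in a Lipschitz way, with constant 1/(2(1 - q)), which makes the result a
  Cauchy sequence.\<close>

lemma root_sequence:
  assumes s: "cauchy s" and q: "\<And>n. p (s n) \<le> q" "q < 1"
  defines "t \<equiv> \<lambda>n. root_iter (s n) n"
  shows "cauchy t" and "null (\<lambda>n. t n + t n + (-1) \<odot>\<^bsub>A\<^esub> (t n \<otimes>\<^bsub>A\<^esub> t n)) s"
proof -
  have sm: "s n \<in> carrier A" for n using s by (rule cauchy_mem)
  have tm: "t n \<in> carrier A" for n unfolding t_def using sm by (rule root_iter_mem)
  have tq: "p (t n) \<le> q" for n unfolding t_def using sm q by (rule root_iter_le)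
  have q0: "0 \<le> q" using q(1)[of 0] p_nonneg[OF sm[of 0]] by simp
  define r where "r n = t n + t n - t n \<otimes>\<^bsub>A\<^esub> t n - s n" for n
  have rm: "r n \<in> carrier A" for n unfolding r_def by (intro mem_intros sm tm)
  have pr: "p (r n) \<le> 2 * q ^ Suc n" for n
    unfolding r_def t_def using sm q by (rule root_iter_residual)
  have "(\<lambda>n. 2 * q ^ Suc n) \<longlonglongrightarrow> 2 * 0"
    using q0 q(2) by (intro tendsto_mult tendsto_const LIMSEQ_Suc LIMSEQ_power_zero) auto
  then have lim: "(\<lambda>n. p (r n)) \<longlonglongrightarrow> 0"
    using tendsto_p_0[OF rm pr] by simp
  \<comment> \<open>Subtracting the two quadratic equations leaves t m^2 - t n^2 on the right; its
    seminorm is at most 2 q p(u), which is absorbed on the left.\<close>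
  have key: "2 * (1 - q) * p (t m - t n) \<le> p (s m - s n) + p (r m) + p (r n)" for m n
  proof -
    define u where "u = t m - t n"
    have um: "u \<in> carrier A" unfolding u_def by (intro mem_intros tm)
    have "u + u = ((s m - s n) + (t m \<otimes>\<^bsub>A\<^esub> t m - t n \<otimes>\<^bsub>A\<^esub> t n)) + (r m - r n)"
      by (simp add: u_def r_def algebra_simps)
    also have "p \<dots> \<le> p ((s m - s n) + (t m \<otimes>\<^bsub>A\<^esub> t m - t n \<otimes>\<^bsub>A\<^esub> t n)) + p (r m - r n)"
      by (intro p_add mem_intros sm tm rm)
    also have "\<dots> \<le> p (s m - s n) + p (t m \<otimes>\<^bsub>A\<^esub> t m - t n \<otimes>\<^bsub>A\<^esub> t n) + (p (r m) + p (r n))"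
      by (intro add_mono p_add p_diff mem_intros sm tm rm)
    also have "p (t m \<otimes>\<^bsub>A\<^esub> t m - t n \<otimes>\<^bsub>A\<^esub> t n) \<le> p u * p (t m) + p (t n) * p u"
      unfolding u_def by (intro p_mult_diff tm)
    also have "\<dots> \<le> p u * q + q * p u"
      by (intro add_mono mult_left_mono mult_right_mono tq p_nonneg um)
    finally have "p (u + u) \<le> p (s m - s n) + 2 * q * p u + (p (r m) + p (r n))"
      by simp
    moreover have "2 * p u \<le> p (u + u)"
      using p_half[of "u + u"] smult_half[OF um] smult_add[OF um um, of "1/2"] um
      by (simp add: mem_intros)
    ultimately show ?thesis by (simp add: u_def algebra_simps)
  qed
  show ct: "cauchy t"
    unfolding cauchy_iff
  proof (intro conjI allI impI tm)
    fix e :: real assume e: "e > 0"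
    \<comment> \<open>Three terms below \<open>d\<close> add up to less than 3/2 (1 - q) e, within
      the allowed 2 (1 - q) e.\<close>
    define d where "d = e * (1 - q) / 2"
    have d: "d > 0" using e q(2) by (simp add: d_def)
    obtain N where N: "\<And>m n. m \<ge> N \<Longrightarrow> n \<ge> N \<Longrightarrow> p (s m - s n) < d"
      using cauchyD[OF s d] by blast
    obtain N' where N': "\<And>n. n \<ge> N' \<Longrightarrow> p (r n) < d"
      using LIMSEQ_D[OF lim d] by (auto simp: abs_less_iff)
    have "p (t m - t n) < e" if "m \<ge> max N N'" "n \<ge> max N N'" for m n
    proof -
      have "2 * (1 - q) * p (t m - t n) < 3 * d"
        using key[of m n] N[of m n] N'[of m] N'[of n] that by simp
      also have "\<dots> \<le> 2 * (1 - q) * e" using e q(2) by (simp add: d_def)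
      finally show ?thesis using q(2) by simp
    qed
    then show "\<exists>N. \<forall>m\<ge>N. \<forall>n\<ge>N. p (t m - t n) < e" by blast
  qed
  have eq: "t n + t n + (-1) \<odot>\<^bsub>A\<^esub> (t n \<otimes>\<^bsub>A\<^esub> t n) - s n = r n" for n
    using smult_minus[of "t n \<otimes>\<^bsub>A\<^esub> t n"] tm by (simp add: r_def mem_intros)
  show "null (\<lambda>n. t n + t n + (-1) \<odot>\<^bsub>A\<^esub> (t n \<otimes>\<^bsub>A\<^esub> t n)) s"
    unfolding null_def eq using s ct lim by (simp add: cauchy_add cauchy_smult cauchy_mult)
qed

end

subsection \<open>Automatic continuity\<close>

locale completion_rep = seminormed_star_algebra A p + star_rep "completion A p" H \<Psi>
  for A :: "('x::ab_group_add) star_algebra" and p :: "'x \<Rightarrow> real"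
    and H :: "'h inner_space" and \<Psi> :: "(nat \<Rightarrow> 'x) set \<Rightarrow> 'h \<Rightarrow> 'h"
begin

abbreviation \<rho> :: "(nat \<Rightarrow> 'x) \<Rightarrow> 'h \<Rightarrow> 'h" where "\<rho> s \<equiv> \<Psi> (cls s)"

lemma cls_mem: "cauchy s \<Longrightarrow> cls s \<in> carrier (completion A p)"
  by (simp add: carrier_completion)

lemma rho_closed: "cauchy s \<Longrightarrow> v \<in> carrier H \<Longrightarrow> \<rho> s v \<in> carrier H"
  using rep_closed cls_mem by simp

lemma rho_add:
  "cauchy s \<Longrightarrow> cauchy t \<Longrightarrow> v \<in> carrier H \<Longrightarrow> \<rho> (\<lambda>n. s n + t n) v = \<rho> s v \<oplus>\<^bsub>H\<^esub> \<rho> t v"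
  using rep_add[of "cls s" "cls t" v] by (simp add: completion_add cls_mem)

lemma rho_smult: "cauchy s \<Longrightarrow> v \<in> carrier H \<Longrightarrow> \<rho> (\<lambda>n. c \<odot>\<^bsub>A\<^esub> s n) v = c \<odot>\<^bsub>H\<^esub> \<rho> s v"
  using rep_smult[of "cls s" v c] by (simp add: completion_smult cls_mem)

lemma rho_mult:
  "cauchy s \<Longrightarrow> cauchy t \<Longrightarrow> v \<in> carrier H \<Longrightarrow> \<rho> (\<lambda>n. s n \<otimes>\<^bsub>A\<^esub> t n) v = \<rho> s (\<rho> t v)"
  using rep_mult[of "cls s" "cls t" v] by (simp add: completion_mult cls_mem)

lemma rho_star:
  "cauchy s \<Longrightarrow> v \<in> carrier H \<Longrightarrow> w \<in> carrier H \<Longrightarrow> ip (\<rho> (\<lambda>n. star A (s n)) v) w = ip v (\<rho> s w)"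
  using rep_star[of "cls s" v w] by (simp add: completion_star cls_mem)

lemma rho_diff:
  assumes "cauchy s" "cauchy t" "v \<in> carrier H"
  shows "\<rho> (\<lambda>n. s n - t n) v = \<rho> s v \<ominus>\<^bsub>H\<^esub> \<rho> t v"
proof -
  have "(\<lambda>n. s n - t n) = (\<lambda>n. s n + (-1) \<odot>\<^bsub>A\<^esub> t n)"
    using assms by (simp add: smult_minus cauchy_mem)
  then show ?thesis
    using assms by (simp add: rho_add rho_smult cauchy_smult diff_eq_add_smult rho_closed)
qed

text \<open>With \<open>2 t - t\<^sup>2 = y\<^sup>* y\<close> and \<open>t\<close> self-adjoint,
  \<open>\<parallel>v - t v\<parallel>\<^sup>2 = \<parallel>v\<parallel>\<^sup>2 - \<parallel>y v\<parallel>\<^sup>2\<close>.\<close>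

lemma rho_contractive:
  assumes y: "cauchy y" and q: "\<And>n. p (y n) \<le> q" "q < 1" and v: "v \<in> carrier H"
  shows "hnorm H (\<rho> y v) \<le> hnorm H v"
proof -
  have ym: "y n \<in> carrier A" for n using y by (rule cauchy_mem)
  have q0: "0 \<le> q" using q(1)[of 0] p_nonneg[OF ym[of 0]] by simp
  define s where "s n = star A (y n) \<otimes>\<^bsub>A\<^esub> y n" for n
  have s: "cauchy s" unfolding s_def using y by (intro cauchy_mult cauchy_star)
  have sm: "s n \<in> carrier A" for n using s by (rule cauchy_mem)
  have ps: "p (s n) \<le> q * q" for n
  proof -
    have "p (s n) \<le> p (star A (y n)) * p (y n)" unfolding s_def by (intro p_mult mem_intros ym)
    also have "\<dots> \<le> q * q"
      by (intro mult_mono p_nonneg mem_intros ym q q0 order_trans[OF p_star q(1)])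
    finally show ?thesis .
  qed
  have q2: "q * q < 1" using q0 q(2) mult_left_le[of q q] by linarith
  have star_s: "p (star A (s n) - s n) = 0" for n
  proof -
    have "p (star A (s n) - s n) \<le> p (star A (s n) - star A (y n) \<otimes>\<^bsub>A\<^esub> star A (star A (y n)))
        + p (star A (y n) \<otimes>\<^bsub>A\<^esub> star A (star A (y n)) - s n)"
      by (intro p_triangle mem_intros sm ym)
    also have "\<dots> \<le> 0 + (p (star A (y n) - star A (y n)) * p (star A (star A (y n)))
        + p (star A (y n)) * p (star A (star A (y n)) - y n))"
      unfolding s_def by (intro add_mono p_mult_diff mem_intros ym)
        (simp add: p_star_mult mem_intros ym)
    finally show ?thesis
      using p_nonneg[of "star A (s n) - s n"] by (simp add: p_star_star ym sm mem_intros)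
  qed
  define t where "t n = root_iter (s n) n" for n
  have t: "cauchy t" unfolding t_def using s ps q2 by (rule root_sequence)
  have tts: "null (\<lambda>n. t n + t n + (-1) \<odot>\<^bsub>A\<^esub> (t n \<otimes>\<^bsub>A\<^esub> t n)) s"
    unfolding t_def using s ps q2 by (rule root_sequence)
  have tm: "t n \<in> carrier A" for n using t by (rule cauchy_mem)
  have "p (star A (t n) - t n) = 0" for n
    unfolding t_def using sm star_s by (rule root_iter_star)
  \<comment> \<open>In the completion, seminorm 0 means equality, so \<open>t\<close> acts as an
    exactly self-adjoint operator.\<close>
  then have "null (\<lambda>n. star A (t n)) t" using t by (simp add: null_def cauchy_star)
  then have star_t: "\<rho> (\<lambda>n. star A (t n)) = \<rho> t" by (simp add: cls_eq)
  have "\<rho> s v = \<rho> (\<lambda>n. t n + t n + (-1) \<odot>\<^bsub>A\<^esub> (t n \<otimes>\<^bsub>A\<^esub> t n)) v"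
    using cls_eq[OF tts] by simp
  also have "\<dots> = (\<rho> t v \<oplus>\<^bsub>H\<^esub> \<rho> t v) \<oplus>\<^bsub>H\<^esub> (-1) \<odot>\<^bsub>H\<^esub> \<rho> t (\<rho> t v)"
    using t v by (simp add: rho_add rho_smult rho_mult cauchy_add cauchy_smult cauchy_mult)
  finally have rs: "\<rho> s v = (\<rho> t v \<oplus>\<^bsub>H\<^esub> \<rho> t v) \<oplus>\<^bsub>H\<^esub> (-1) \<odot>\<^bsub>H\<^esub> \<rho> t (\<rho> t v)" .
  have tv: "\<rho> t v \<in> carrier H" "\<rho> t (\<rho> t v) \<in> carrier H" "\<rho> y v \<in> carrier H"
    using t y v by (simp_all add: rho_closed)
  have "ip (\<rho> s v) v = ip (\<rho> y v) (\<rho> y v)"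
    unfolding s_def using y v tv by (simp add: rho_mult rho_star cauchy_star)
  moreover have "ip (\<rho> t (\<rho> t v)) v = ip (\<rho> t v) (\<rho> t v)"
    using rho_star[OF t tv(1) v] by (simp add: star_t)
  moreover have "ip v (\<rho> t v) = ip (\<rho> t v) v"
    using rho_star[OF t v v] by (simp add: star_t)
  ultimately have "ip (v \<ominus>\<^bsub>H\<^esub> \<rho> t v) (v \<ominus>\<^bsub>H\<^esub> \<rho> t v) = ip v v - ip (\<rho> y v) (\<rho> y v)"
    using v tv unfolding rs by (simp add: ip_simps algebra_simps)
  then have "0 \<le> (hnorm H v)\<^sup>2 - (hnorm H (\<rho> y v))\<^sup>2"
    using ip_Re_nonneg[of "v \<ominus>\<^bsub>H\<^esub> \<rho> t v"] v tv by (simp add: hnorm_power2)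
  then have "(hnorm H (\<rho> y v))\<^sup>2 \<le> (hnorm H v)\<^sup>2" by simp
  then show ?thesis
    by (rule power2_le_imp_le) (use v in simp)
qed

text \<open>Automatic continuity: rescaling by D > C makes the sequence strictly contractive for
  \<open>p\<close>, so \<open>rho_contractive\<close> applies; then D decreases to C.\<close>

lemma rho_le:
  assumes x: "cauchy x" and C: "\<And>n. n \<ge> N \<Longrightarrow> p (x n) \<le> C" and v: "v \<in> carrier H"
  shows "hnorm H (\<rho> x v) \<le> C * hnorm H v"
proof -
  define z where "z n = x (n + N)" for n
  have xz: "null x z" unfolding z_def using x by (rule null_shift)
  then have z: "cauchy z" by (simp add: null_def)
  have pz: "p (z n) \<le> C" for n using C by (simp add: z_def)
  have zm: "z n \<in> carrier A" for n using z by (rule cauchy_mem)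
  have C0: "0 \<le> C" using pz[of 0] p_nonneg[OF zm[of 0]] by simp
  have "hnorm H (\<rho> z v) \<le> D * hnorm H v" if D: "D > C" for D
  proof -
    define c where "c = complex_of_real D"
    have D0: "D > 0" using D C0 by simp
    then have c: "c \<noteq> 0" "cmod c = D" "cmod (inverse c) = inverse D"
      by (simp_all add: c_def norm_inverse)
    define y where "y n = inverse c \<odot>\<^bsub>A\<^esub> z n" for n
    have y: "cauchy y" unfolding y_def using z by (rule cauchy_smult)
    have zy: "z = (\<lambda>n. c \<odot>\<^bsub>A\<^esub> y n)" using c(1) zm by (simp add: y_def smult_inverse)
    have "p (y n) \<le> C / D" for n
    proof -
      have "p (y n) \<le> inverse D * p (z n)"
        unfolding y_def using p_smult[OF zm, of "inverse c" n] c(3) by simp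
      also have "\<dots> \<le> inverse D * C" using D0 pz by (intro mult_left_mono) auto
      finally show ?thesis by (simp add: field_simps)
    qed
    moreover have "C / D < 1" using D D0 by simp
    ultimately have "hnorm H (\<rho> y v) \<le> hnorm H v" using rho_contractive[OF y] v by blast
    then show ?thesis
      using D0 c(2) y v by (simp add: zy rho_smult hnorm_smult rho_closed mult_left_mono)
  qed
  then have "hnorm H (\<rho> z v) \<le> C * hnorm H v + e" if "e > 0" for e
  proof -
    have "e / (hnorm H v + 1) > 0" using that v by (simp add: add_nonneg_pos)
    then have "hnorm H (\<rho> z v) \<le> (C + e / (hnorm H v + 1)) * hnorm H v"
      using \<open>\<And>D. D > C \<Longrightarrow> hnorm H (\<rho> z v) \<le> D * hnorm H v\<close> by simp
    also have "\<dots> = C * hnorm H v + e * (hnorm H v / (hnorm H v + 1))"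
      by (simp add: algebra_simps)
    also have "\<dots> \<le> C * hnorm H v + e * 1"
      using that v by (intro add_left_mono mult_left_mono) (auto simp: divide_le_eq add_nonneg_pos)
    finally show ?thesis by simp
  qed
  then show ?thesis
    unfolding cls_eq[OF xz] by (rule field_le_epsilon)
qed

end

text \<open>Constant sequences restrict a representation of the completion to \<open>A\<close>. By
  \<open>rho_le\<close> the restricted operators approximate all others in norm, so closed subspaces
  invariant under \<open>A\<close> are invariant under the completion, and compactness carries over
  to the limits. The space stays the same, hence the Hilbert spaces in the hypothesis have the type
  prescribed for the completion.\<close>

theorem (in seminormed_star_algebra) CCR_completion:
  assumes compact: "\<And>(H :: ((nat \<Rightarrow> 'x) set \<Rightarrow> complex) inner_space) \<pi>.
      irreducible_representation A H \<pi> \<Longrightarrow>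
      (\<And>f v. f \<in> carrier A \<Longrightarrow> v \<in> carrier H \<Longrightarrow> hnorm H (\<pi> f v) \<le> p f * hnorm H v) \<Longrightarrow>
      (\<And>f. f \<in> carrier A \<Longrightarrow> compact_operator H (\<pi> f))"
  shows "CCR_algebra (completion A p)"
  unfolding CCR_algebra_def
proof (intro allI impI ballI)
  fix H :: "((nat \<Rightarrow> 'x) set \<Rightarrow> complex) inner_space" and \<Psi> a
  assume irr: "irreducible_representation (completion A p) H \<Psi>"
    and a: "a \<in> carrier (completion A p)"
  interpret completion_rep A p H \<Psi>
    by unfold_locales (use irr in \<open>simp add: irreducible_representation_def\<close>)
  define \<pi> where "\<pi> f = \<rho> (\<lambda>_. f)" for f
  have cc: "cauchy (\<lambda>_. f)" if "f \<in> carrier A" for f using that by (rule cauchy_const)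
  have bound: "hnorm H (\<pi> f v) \<le> p f * hnorm H v" if "f \<in> carrier A" "v \<in> carrier H" for f v
    unfolding \<pi>_def using rho_le[OF cc[OF that(1)], of 0 "p f" v] that by simp
  have approx: "\<exists>f\<in>carrier A. \<forall>v\<in>carrier H. hnorm H (\<Psi> a v \<ominus>\<^bsub>H\<^esub> \<pi> f v) \<le> e * hnorm H v"
    if a: "a \<in> carrier (completion A p)" and e: "e > 0" for a e
  proof -
    obtain s where s: "a = cls s" "cauchy s" using a by (auto simp: carrier_completion)
    obtain N where N: "\<And>m n. m \<ge> N \<Longrightarrow> n \<ge> N \<Longrightarrow> p (s m - s n) < e"
      using cauchyD[OF s(2) e] by blast
    have sN: "s N \<in> carrier A" using s(2) by (rule cauchy_mem)
    have cauchy': "cauchy (\<lambda>n. s n - s N)"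
      using cauchy_add[OF s(2) cc[OF minus_mem[OF sN]]] by simp
    have "hnorm H (\<Psi> a v \<ominus>\<^bsub>H\<^esub> \<pi> (s N) v) \<le> e * hnorm H v" if "v \<in> carrier H" for v
      using rho_le[OF cauchy', of N e v] N that rho_diff[OF s(2) cc[OF sN], of v]
      by (simp add: s(1) \<pi>_def less_imp_le)
    then show ?thesis using sN by blast
  qed
  have rep: "star_representation A H \<pi>"
    unfolding star_representation_def
  proof (intro conjI ballI allI)
    show "hilbert_space H" by (rule hilbert_space)
    fix f assume f: "f \<in> carrier A"
    show "bounded_operator H (\<pi> f)"
      unfolding \<pi>_def by (rule rep_bounded[OF cls_mem[OF cc[OF f]]])
    fix v assume v: "v \<in> carrier H"
    show "\<pi> (c \<odot>\<^bsub>A\<^esub> f) v = c \<odot>\<^bsub>H\<^esub> \<pi> f v" for c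
      unfolding \<pi>_def using rho_smult[OF cc[OF f] v] .
    fix g assume g: "g \<in> carrier A"
    show "\<pi> (f \<oplus>\<^bsub>A\<^esub> g) v = \<pi> f v \<oplus>\<^bsub>H\<^esub> \<pi> g v"
      unfolding \<pi>_def add_A using rho_add[OF cc[OF f] cc[OF g] v] .
    show "\<pi> (f \<otimes>\<^bsub>A\<^esub> g) v = \<pi> f (\<pi> g v)"
      unfolding \<pi>_def using rho_mult[OF cc[OF f] cc[OF g] v] .
  next
    fix f v w assume "f \<in> carrier A" "v \<in> carrier H" "w \<in> carrier H"
    then show "ip (\<pi> (star A f) v) w = ip v (\<pi> f w)"
      unfolding \<pi>_def using rho_star[OF cc] by blast
  qed
  have irr': "irreducible_representation A H \<pi>"
    unfolding irreducible_representation_def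
  proof (intro conjI allI impI rep)
    show "carrier H \<noteq> {\<zero>\<^bsub>H\<^esub>}" using irr by (simp add: irreducible_representation_def)
    fix W assume W: "submodule W complex_ring H \<and> closedin (htopology H) W \<and>
      (\<forall>f\<in>carrier A. \<pi> f ` W \<subseteq> W)"
    then have WH: "W \<subseteq> carrier H" and clo: "hclosure W \<subseteq> W" by (auto simp: closedin_iff)
    have "\<Psi> b ` W \<subseteq> W" if b: "b \<in> carrier (completion A p)" for b
    proof
      fix u assume "u \<in> \<Psi> b ` W"
      then obtain v where v: "v \<in> W" "u = \<Psi> b v" by blast
      have vH: "v \<in> carrier H" using v WH by blast
      have "u \<in> hclosure W"
        unfolding hclosure_def
      proof (intro CollectI conjI allI impI)
        show "u \<in> carrier H" using v vH b by simp
        fix e :: real assume e: "e > 0"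
        then have d: "e / (hnorm H v + 1) > 0" using vH by (simp add: add_nonneg_pos)
        obtain f where f: "f \<in> carrier A"
          "hnorm H (\<Psi> b v \<ominus>\<^bsub>H\<^esub> \<pi> f v) \<le> e / (hnorm H v + 1) * hnorm H v"
          using approx[OF b d] vH by blast
        have "e / (hnorm H v + 1) * hnorm H v < e / (hnorm H v + 1) * (hnorm H v + 1)"
          using d by (intro mult_strict_left_mono) auto
        also have "\<dots> = e" using hnorm_nonneg[OF vH] by simp
        finally show "\<exists>s\<in>W. hnorm H (u \<ominus>\<^bsub>H\<^esub> s) < e"
          using f v W by (intro bexI[of _ "\<pi> f v"]) auto
      qed
      then show "u \<in> W" using clo by blast
    qed
    then show "W = {\<zero>\<^bsub>H\<^esub>} \<or> W = carrier H"
      using irr W unfolding irreducible_representation_def by blast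
  qed
  show "compact_operator H (\<Psi> a)"
  proof (rule compact_operatorI)
    show "bounded_operator H (\<Psi> a)" using a by (rule rep_bounded)
    show "totally_bounded (\<Psi> a ` {v \<in> carrier H. hnorm H v \<le> 1})"
    proof (rule totally_bounded_approx)
      show "\<Psi> a ` {v \<in> carrier H. hnorm H v \<le> 1} \<subseteq> carrier H" using a by auto
      fix e :: real assume "e > 0"
      then have e2: "e/2 > 0" by simp
      obtain f where f: "f \<in> carrier A"
        "\<And>v. v \<in> carrier H \<Longrightarrow> hnorm H (\<Psi> a v \<ominus>\<^bsub>H\<^esub> \<pi> f v) \<le> e/2 * hnorm H v"
        using approx[OF a e2] by blast
      have "compact_operator H (\<pi> f)" using compact[OF irr' bound f(1)] .
      then have tb: "totally_bounded (\<pi> f ` {v \<in> carrier H. hnorm H v \<le> 1})"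
        by (rule compact_operator_totally_bounded)
      have "hnorm H (\<Psi> a v \<ominus>\<^bsub>H\<^esub> \<pi> f v) < e" if "v \<in> carrier H" "hnorm H v \<le> 1" for v
      proof -
        have "e/2 * hnorm H v \<le> e/2 * 1" using that e2 by (intro mult_left_mono) auto
        then show ?thesis using f(2)[OF that(1)] \<open>e > 0\<close> by linarith
      qed
      then show "\<exists>S. totally_bounded S \<and>
          (\<forall>x\<in>\<Psi> a ` {v \<in> carrier H. hnorm H v \<le> 1}. \<exists>y\<in>S. hnorm H (x \<ominus>\<^bsub>H\<^esub> y) < e)"
        using tb by (intro exI[of _ "\<pi> f ` {v \<in> carrier H. hnorm H v \<le> 1}"]) auto
    qed
  qed
qed


section \<open>Totally disconnected groups\<close>

lemma sum_fun_apply: "(\<Sum>i\<in>I. f i) x = (\<Sum>i\<in>I. f i x)"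
  by (induction I rule: infinite_finite_induct) simp_all

text \<open>The \<open>K n\<close> are compact open subgroups forming a base at the identity.
  \<open>openin_iff\<close> prescribes the topology by the cosets x K n; \<open>K_conj\<close> makes
  multiplication and inversion continuous for it, and \<open>K_separating\<close> makes it
  Hausdorff.\<close>

locale td_group = group G for G :: "('a, 'm) monoid_scheme" (structure) +
  fixes X :: "'a topology" and K :: "nat \<Rightarrow> 'a set"
  assumes K_subgroup: "subgroup (K n) G"
    and K_decreasing: "m \<le> n \<Longrightarrow> K n \<subseteq> K m"
    and K_conj: "x \<in> carrier G \<Longrightarrow> \<exists>m. \<forall>k\<in>K m. inv x \<otimes> k \<otimes> x \<in> K n"
    and K_separating: "x \<in> carrier G \<Longrightarrow> (\<And>n. x \<in> K n) \<Longrightarrow> x = \<one>"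
    and openin_iff: "openin X U \<longleftrightarrow> U \<subseteq> carrier G \<and> (\<forall>x\<in>U. \<exists>n. \<forall>k\<in>K n. x \<otimes> k \<in> U)"
    and K_compact: "compactin X (K n)"
begin

lemma K_carrier: "k \<in> K n \<Longrightarrow> k \<in> carrier G"
  using subgroup.subset[OF K_subgroup] by blast

lemma K_one: "\<one> \<in> K n"
  using subgroup.one_closed[OF K_subgroup] .

lemma K_mult: "k \<in> K n \<Longrightarrow> l \<in> K n \<Longrightarrow> k \<otimes> l \<in> K n"
  using subgroup.m_closed[OF K_subgroup] .

lemma K_inv: "k \<in> K n \<Longrightarrow> inv k \<in> K n"
  using subgroup.m_inv_closed[OF K_subgroup] .

lemma K_conj': "x \<in> carrier G \<Longrightarrow> \<exists>m\<ge>l. \<forall>m'\<ge>m. \<forall>k\<in>K m'. inv x \<otimes> k \<otimes> x \<in> K n"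
proof -
  assume "x \<in> carrier G"
  then obtain m where "\<forall>k\<in>K m. inv x \<otimes> k \<otimes> x \<in> K n" using K_conj by blast
  then show ?thesis
    using K_decreasing by (intro exI[of _ "max l m"]) (auto simp: subset_eq)
qed

lemmas G_assoc = m_assoc and G_closed = m_closed and G_one = one_closed

lemma inv_mult_cancel:
  "x \<in> carrier G \<Longrightarrow> y \<in> carrier G \<Longrightarrow> inv x \<otimes> (x \<otimes> y) = y"
  "x \<in> carrier G \<Longrightarrow> y \<in> carrier G \<Longrightarrow> x \<otimes> (inv x \<otimes> y) = y"
  by (simp_all add: m_assoc[symmetric])

lemma topspace_X: "topspace X = carrier G"
proof
  show "topspace X \<subseteq> carrier G" using openin_iff[of "topspace X"] by simp
  have "openin X (carrier G)" unfolding openin_iff by (auto simp: K_carrier)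
  then show "carrier G \<subseteq> topspace X" by (rule openin_subset)
qed

section \<open>Left cosets of the subgroups \<open>K n\<close>\<close>

definition coset :: "'a \<Rightarrow> nat \<Rightarrow> 'a set" where
  "coset x n = {y \<in> carrier G. inv x \<otimes> y \<in> K n}"

lemma coset_carrier: "y \<in> coset x n \<Longrightarrow> y \<in> carrier G"
  by (simp add: coset_def)

lemma coset_self: "x \<in> carrier G \<Longrightarrow> x \<in> coset x n"
  by (simp add: coset_def K_one)

lemma coset_mult: "x \<in> carrier G \<Longrightarrow> k \<in> K n \<Longrightarrow> x \<otimes> k \<in> coset x n"
  by (simp add: coset_def K_carrier inv_mult_cancel)

lemma coset_eq_image: "x \<in> carrier G \<Longrightarrow> coset x n = (\<lambda>k. x \<otimes> k) ` K n"
proof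
  assume x: "x \<in> carrier G"
  show "coset x n \<subseteq> (\<lambda>k. x \<otimes> k) ` K n"
  proof
    fix y assume "y \<in> coset x n"
    then show "y \<in> (\<lambda>k. x \<otimes> k) ` K n"
      using x by (intro image_eqI[of _ _ "inv x \<otimes> y"]) (auto simp: coset_def inv_mult_cancel)
  qed
  show "(\<lambda>k. x \<otimes> k) ` K n \<subseteq> coset x n" using x coset_mult by auto
qed

lemma l_coset_eq_coset: "x \<in> carrier G \<Longrightarrow> x <# K n = coset x n"
  by (auto simp: coset_eq_image l_coset_def)

lemma coset_one: "coset \<one> n = K n"
  by (auto simp: coset_eq_image K_carrier intro!: image_eqI)

lemma coset_decreasing: "m \<le> n \<Longrightarrow> coset x n \<subseteq> coset x m"
  using K_decreasing by (auto simp: coset_def)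

lemma coset_eq:
  assumes x: "x \<in> carrier G" and y: "y \<in> coset x n"
  shows "coset y n = coset x n"
proof -
  have yc: "y \<in> carrier G" using y by (rule coset_carrier)
  have k: "inv x \<otimes> y \<in> K n" using y by (simp add: coset_def)
  have "inv y \<otimes> z \<in> K n \<longleftrightarrow> inv x \<otimes> z \<in> K n" if z: "z \<in> carrier G" for z
  proof
    have 1: "inv x \<otimes> z = (inv x \<otimes> y) \<otimes> (inv y \<otimes> z)"
      using x yc z by (simp add: m_assoc inv_mult_cancel)
    then show "inv y \<otimes> z \<in> K n \<Longrightarrow> inv x \<otimes> z \<in> K n" using k K_mult by simp
    have 2: "inv y \<otimes> z = inv (inv x \<otimes> y) \<otimes> (inv x \<otimes> z)"
      using x yc z by (simp add: inv_mult_group m_assoc inv_mult_cancel)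
    then show "inv x \<otimes> z \<in> K n \<Longrightarrow> inv y \<otimes> z \<in> K n" using k K_mult K_inv by simp
  qed
  then show ?thesis by (auto simp: coset_def)
qed

lemma coset_mult_eq: "x \<in> carrier G \<Longrightarrow> k \<in> K n \<Longrightarrow> coset (x \<otimes> k) n = coset x n"
  by (rule coset_eq[OF _ coset_mult])

lemma coset_sym: "x \<in> carrier G \<Longrightarrow> y \<in> coset x n \<Longrightarrow> x \<in> coset y n"
  using coset_eq coset_self by blast

lemma coset_translate:
  "g \<in> carrier G \<Longrightarrow> x \<in> carrier G \<Longrightarrow> y \<in> carrier G \<Longrightarrow> g \<otimes> y \<in> coset (g \<otimes> x) n \<longleftrightarrow> y \<in> coset x n"
  by (simp add: coset_def inv_mult_group m_assoc inv_mult_cancel)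

lemma openin_iff_coset: "openin X U \<longleftrightarrow> U \<subseteq> carrier G \<and> (\<forall>x\<in>U. \<exists>n. coset x n \<subseteq> U)"
proof -
  have "(\<forall>k\<in>K n. x \<otimes> k \<in> U) \<longleftrightarrow> coset x n \<subseteq> U" if "x \<in> carrier G" for x n
    using that by (auto simp: coset_eq_image)
  then show ?thesis unfolding openin_iff by (meson subsetD)
qed

lemma openin_coset: "x \<in> carrier G \<Longrightarrow> openin X (coset x n)"
  unfolding openin_iff_coset using coset_carrier coset_eq by blast

lemma continuous_left_mult:
  assumes "g \<in> carrier G"
  shows "continuous_map X X (\<lambda>x. g \<otimes> x)"
  unfolding continuous_map_def topspace_X
proof (intro conjI allI impI)
  fix U assume U: "openin X U"
  show "openin X {x \<in> carrier G. g \<otimes> x \<in> U}"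
    unfolding openin_iff
  proof (intro conjI ballI)
    fix x assume "x \<in> {x \<in> carrier G. g \<otimes> x \<in> U}"
    then obtain n where "\<forall>k\<in>K n. g \<otimes> x \<otimes> k \<in> U" "x \<in> carrier G"
      using U unfolding openin_iff by blast
    then show "\<exists>n. \<forall>k\<in>K n. x \<otimes> k \<in> {x \<in> carrier G. g \<otimes> x \<in> U}"
      using assms by (auto simp: m_assoc K_carrier)
  qed auto
qed (use assms in auto)

lemma compactin_coset: "x \<in> carrier G \<Longrightarrow> compactin X (coset x n)"
  using image_compactin[OF K_compact continuous_left_mult] by (simp add: coset_eq_image)

lemma Hausdorff_X: "Hausdorff_space X"
  unfolding Hausdorff_space_def topspace_X
proof (intro allI impI, elim conjE)
  fix x y assume xy: "x \<in> carrier G" "y \<in> carrier G" "x \<noteq> y"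
  have "\<exists>n. inv x \<otimes> y \<notin> K n"
  proof (rule ccontr)
    assume "\<not> ?thesis"
    then have "inv x \<otimes> y = \<one>" using K_separating[of "inv x \<otimes> y"] xy by auto
    then show False using xy inv_mult_cancel(2)[of x y] by simp
  qed
  then obtain n where n: "y \<notin> coset x n" using xy by (auto simp: coset_def)
  have "disjnt (coset x n) (coset y n)"
    unfolding disjnt_iff
  proof (intro allI notI, elim conjE)
    fix z assume "z \<in> coset x n" "z \<in> coset y n"
    then have "coset y n = coset x n"
      using coset_eq[OF xy(1), of z n] coset_eq[OF xy(2), of z n] by (metis (no_types))
    then show False using n coset_self[OF xy(2), of n] by simp
  qed
  then show "\<exists>U V. openin X U \<and> openin X V \<and> x \<in> U \<and> y \<in> V \<and> disjnt U V"
    using xy by (intro exI[of _ "coset x n"] exI[of _ "coset y n"]) (simp add: openin_coset coset_self)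
qed

lemma continuous_mult: "continuous_map (prod_topology X X) X (\<lambda>(x, y). x \<otimes> y)"
  unfolding continuous_map_def
proof (intro conjI allI impI)
  fix U assume U: "openin X U"
  show "openin (prod_topology X X) {z \<in> topspace (prod_topology X X). (case z of (x, y) \<Rightarrow> x \<otimes> y) \<in> U}"
    unfolding openin_prod_topology_alt
  proof (intro allI impI)
    fix x y assume "(x, y) \<in> {z \<in> topspace (prod_topology X X). (case z of (x, y) \<Rightarrow> x \<otimes> y) \<in> U}"
    then have xy: "x \<in> carrier G" "y \<in> carrier G" "x \<otimes> y \<in> U" by (auto simp: topspace_X)
    then obtain n where n: "\<And>k. k \<in> K n \<Longrightarrow> x \<otimes> y \<otimes> k \<in> U" using U unfolding openin_iff by blast
    obtain m where m: "\<And>k. k \<in> K m \<Longrightarrow> inv y \<otimes> k \<otimes> y \<in> K n" using K_conj[OF xy(2)] by blast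
    have "a \<otimes> b \<in> U" if a: "a \<in> coset x m" and b: "b \<in> coset y n" for a b
    proof -
      obtain k where k: "k \<in> K m" "a = x \<otimes> k" using a xy by (auto simp: coset_eq_image)
      obtain l where l: "l \<in> K n" "b = y \<otimes> l" using b xy by (auto simp: coset_eq_image)
      \<comment> \<open>Moving \<open>k\<close> past \<open>y\<close> conjugates it, and
        \<open>m\<close> was chosen to keep the conjugate in \<open>K n\<close>.\<close>
      have "a \<otimes> b = x \<otimes> y \<otimes> ((inv y \<otimes> k \<otimes> y) \<otimes> l)"
        using k l xy K_carrier[OF k(1)] K_carrier[OF l(1)] by (simp add: m_assoc inv_mult_cancel)
      then show ?thesis using n[OF K_mult[OF m[OF k(1)] l(1)]] by simp
    qed
    then show "\<exists>V W. openin X V \<and> openin X W \<and> x \<in> V \<and> y \<in> W \<and>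
        V \<times> W \<subseteq> {z \<in> topspace (prod_topology X X). (case z of (x, y) \<Rightarrow> x \<otimes> y) \<in> U}"
      using xy openin_coset coset_self coset_carrier
      by (intro exI[of _ "coset x m"] exI[of _ "coset y n"]) (auto simp: topspace_X)
  qed
qed (auto simp: topspace_X)

lemma continuous_inv: "continuous_map X X (\<lambda>x. inv x)"
  unfolding continuous_map_def topspace_X
proof (intro conjI allI impI)
  fix U assume U: "openin X U"
  show "openin X {x \<in> carrier G. inv x \<in> U}"
    unfolding openin_iff
  proof (intro conjI ballI)
    fix x assume "x \<in> {x \<in> carrier G. inv x \<in> U}"
    then have x: "x \<in> carrier G" "inv x \<in> U" by auto
    then obtain n where n: "\<And>k. k \<in> K n \<Longrightarrow> inv x \<otimes> k \<in> U" using U unfolding openin_iff by blast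
    obtain m where m: "\<And>k. k \<in> K m \<Longrightarrow> inv (inv x) \<otimes> k \<otimes> inv x \<in> K n"
      using K_conj[of "inv x"] x by blast
    have "inv (x \<otimes> k) \<in> U" if k: "k \<in> K m" for k
    proof -
      \<comment> \<open>Inversion turns the right factor \<open>k\<close> into a left one; moving it
        back to the right costs a conjugation by \<open>inv x\<close>.\<close>
      have "inv (x \<otimes> k) = inv x \<otimes> (inv (inv x) \<otimes> inv k \<otimes> inv x)"
        using x K_carrier[OF k] by (simp add: inv_mult_group m_assoc inv_mult_cancel)
      then show ?thesis using n[OF m[OF K_inv[OF k]]] by simp
    qed
    then show "\<exists>n. \<forall>k\<in>K n. x \<otimes> k \<in> {x \<in> carrier G. inv x \<in> U}"
      using x K_carrier by blast
  qed auto
qed auto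

lemma locally_compact_group_X: "locally_compact_group G X"
  unfolding locally_compact_group_def topological_group_def
proof (intro conjI)
  show "group G" by (rule is_group)
  show "locally_compact_space X"
    unfolding locally_compact_space_def topspace_X
  proof (intro ballI exI conjI)
    fix x assume "x \<in> carrier G"
    then show "openin X (coset x 0)" "compactin X (coset x 0)" "x \<in> coset x 0" "coset x 0 \<subseteq> coset x 0"
      by (simp_all add: openin_coset compactin_coset coset_self)
  qed
qed (use topspace_X continuous_mult continuous_inv Hausdorff_X in auto)

lemma compactin_carrier: "compactin X C \<Longrightarrow> C \<subseteq> carrier G"
  using compactin_subset_topspace topspace_X by blast

text \<open>The level may vary from point to point, as the proof of uniform continuity
  requires.\<close>

lemma compactin_coset_cover:
  assumes C: "compactin X C"
  obtains R where "finite R" "R \<subseteq> C" "C \<subseteq> (\<Union>x\<in>R. coset x (N x))"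
proof -
  have CG: "C \<subseteq> carrier G" using C by (rule compactin_carrier)
  have "\<exists>F. finite F \<and> F \<subseteq> (\<lambda>x. coset x (N x)) ` C \<and> C \<subseteq> \<Union>F"
  proof (rule compactinD[OF C])
    show "openin X U" if "U \<in> (\<lambda>x. coset x (N x)) ` C" for U
      using that CG openin_coset by blast
    show "C \<subseteq> \<Union> ((\<lambda>x. coset x (N x)) ` C)"
      using CG coset_self by blast
  qed
  then obtain F where F: "finite F" "F \<subseteq> (\<lambda>x. coset x (N x)) ` C" "C \<subseteq> \<Union>F" by blast
  obtain R where "R \<subseteq> C" "finite R" "F = (\<lambda>x. coset x (N x)) ` R"
    using finite_subset_image[OF F(1,2)] by blast
  then show ?thesis using that[of R] F(3) by simp
qed

text \<open>Cosets of one level are equal or disjoint, so a finite cover has no overlaps once each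
  coset is given a single representative, chosen in \<open>C\<close>.\<close>

lemma coset_transversal:
  assumes C: "compactin X C"
  obtains R where "finite R" "R \<subseteq> C" "\<And>x. x \<in> C \<Longrightarrow> \<exists>!r. r \<in> R \<and> x \<in> coset r n"
proof -
  have CG: "C \<subseteq> carrier G" using C by (rule compactin_carrier)
  obtain R0 where R0: "finite R0" "R0 \<subseteq> C" "C \<subseteq> (\<Union>x\<in>R0. coset x n)"
    using compactin_coset_cover[OF C, of "\<lambda>_. n"] by blast
  define F where "F = (\<lambda>x. coset x n) ` R0"
  have F: "finite F" "F \<subseteq> (\<lambda>x. coset x n) ` C" "C \<subseteq> \<Union>F"
    using R0 by (auto simp: F_def)
  define r where "r Q = (SOME x. x \<in> C \<and> coset x n = Q)" for Q
  have r: "r Q \<in> C \<and> coset (r Q) n = Q" if "Q \<in> F" for Q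
    unfolding r_def by (rule someI_ex) (use that F(2) in auto)
  have "\<exists>!q. q \<in> r ` F \<and> x \<in> coset q n" if x: "x \<in> C" for x
  proof -
    obtain Q where Q: "Q \<in> F" "x \<in> Q" using x F(3) by blast
    have uniq: "q = r Q" if "q \<in> r ` F" "x \<in> coset q n" for q
    proof -
      obtain P where P: "P \<in> F" "q = r P" using \<open>q \<in> r ` F\<close> by blast
      have "q \<in> carrier G" "r Q \<in> carrier G" using r[OF P(1)] r[OF Q(1)] P(2) CG by auto
      then have "coset x n = coset q n" "coset x n = coset (r Q) n"
        using coset_eq that(2) Q(2) r[OF Q(1)] by blast+
      then show ?thesis using P r[OF P(1)] r[OF Q(1)] by simp
    qed
    have "r Q \<in> r ` F \<and> x \<in> coset (r Q) n" using Q r[OF Q(1)] by simp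
    then show ?thesis
      by (rule ex1I) (use uniq in blast)
  qed
  moreover have "r ` F \<subseteq> C" using r by blast
  ultimately show ?thesis using that[of "r ` F"] F(1) by simp
qed

lemma continuous_iff:
  fixes f :: "'a \<Rightarrow> 'b::metric_space"
  shows "continuous_map X euclidean f \<longleftrightarrow>
    (\<forall>x\<in>carrier G. \<forall>e>0. \<exists>n. \<forall>y\<in>coset x n. dist (f y) (f x) < e)"
proof
  assume f: "continuous_map X euclidean f"
  show "\<forall>x\<in>carrier G. \<forall>e>0. \<exists>n. \<forall>y\<in>coset x n. dist (f y) (f x) < e"
  proof (intro ballI allI impI)
    fix x and e :: real assume x: "x \<in> carrier G" and e: "e > 0"
    have "openin X {y \<in> carrier G. f y \<in> ball (f x) e}"
      using openin_continuous_map_preimage[OF f, of "ball (f x) e"] by (simp add: topspace_X)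
    then obtain n where "coset x n \<subseteq> {y \<in> carrier G. f y \<in> ball (f x) e}"
      unfolding openin_iff_coset using x e by auto
    then show "\<exists>n. \<forall>y\<in>coset x n. dist (f y) (f x) < e" by (auto simp: dist_commute)
  qed
next
  assume *: "\<forall>x\<in>carrier G. \<forall>e>0. \<exists>n. \<forall>y\<in>coset x n. dist (f y) (f x) < e"
  show "continuous_map X euclidean f"
    unfolding continuous_map_def topspace_X
  proof (intro conjI allI impI)
    fix U :: "'b set" assume "openin euclidean U"
    then have U: "open U" by simp
    show "openin X {x \<in> carrier G. f x \<in> U}"
      unfolding openin_iff_coset
    proof (intro conjI ballI)
      fix x assume x: "x \<in> {x \<in> carrier G. f x \<in> U}"
      then obtain e where e: "e > 0" "\<And>z. dist z (f x) < e \<Longrightarrow> z \<in> U"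
        using U unfolding open_dist by blast
      then obtain n where "\<forall>y\<in>coset x n. dist (f y) (f x) < e" using * x by blast
      then show "\<exists>n. coset x n \<subseteq> {x \<in> carrier G. f x \<in> U}" using e coset_carrier by blast
    qed auto
  qed auto
qed

section \<open>Continuous functions with compact support\<close>

abbreviation Cc :: "('a \<Rightarrow> complex) set" where "Cc \<equiv> compactly_supported G X"

text \<open>In a Hausdorff space the compact set \<open>C\<close> is closed, so it contains the
  closure of the set where \<open>f\<close> does not vanish.\<close>

lemma Cc_I:
  assumes "continuous_map X euclidean f" "compactin X C" "\<And>x. x \<notin> C \<Longrightarrow> f x = 0"
  shows "f \<in> Cc"
proof -
  have "closedin X C" using assms(2) Hausdorff_X compactin_imp_closedin by blast
  moreover have "{x \<in> carrier G. f x \<noteq> 0} \<subseteq> C" using assms(3) by blast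
  ultimately have "X closure_of {x \<in> carrier G. f x \<noteq> 0} \<subseteq> C"
    by (simp add: closure_of_minimal)
  then have "compactin X (X closure_of {x \<in> carrier G. f x \<noteq> 0})"
    using closed_compactin[OF assms(2)] closedin_closure_of by simp
  then show ?thesis
    unfolding compactly_supported_def using assms(1,3) compactin_carrier[OF assms(2)] by auto
qed

lemma Cc_continuous: "f \<in> Cc \<Longrightarrow> continuous_map X euclidean f"
  by (simp add: compactly_supported_def)

lemma Cc_support:
  assumes "f \<in> Cc"
  obtains C where "compactin X C" "\<And>x. x \<notin> C \<Longrightarrow> f x = 0"
proof -
  have "{x \<in> carrier G. f x \<noteq> 0} \<subseteq> X closure_of {x \<in> carrier G. f x \<noteq> 0}"
    by (rule closure_of_subset) (auto simp: topspace_X)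
  then have "f x = 0" if "x \<notin> X closure_of {x \<in> carrier G. f x \<noteq> 0}" for x
    using that assms unfolding compactly_supported_def by blast
  then show ?thesis using that assms by (auto simp: compactly_supported_def)
qed

lemma Cc_outside: "f \<in> Cc \<Longrightarrow> x \<notin> carrier G \<Longrightarrow> f x = 0"
  by (simp add: compactly_supported_def)

lemma Cc_zero: "0 \<in> Cc"
  by (rule Cc_I[of _ "{}"]) (auto simp: zero_fun_def)

lemma Cc_add:
  assumes f: "f \<in> Cc" and g: "g \<in> Cc"
  shows "f + g \<in> Cc"
proof -
  obtain C where C: "compactin X C" "\<And>x. x \<notin> C \<Longrightarrow> f x = 0" using Cc_support[OF f] by blast
  obtain D where D: "compactin X D" "\<And>x. x \<notin> D \<Longrightarrow> g x = 0" using Cc_support[OF g] by blast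
  show ?thesis
  proof (rule Cc_I[of _ "C \<union> D"])
    show "continuous_map X euclidean (f + g)"
      using Cc_continuous[OF f] Cc_continuous[OF g]
      by (simp add: continuous_map_atin plus_fun_def tendsto_add)
  qed (use C D compactin_Un in auto)
qed

lemma Cc_smult:
  assumes f: "f \<in> Cc"
  shows "(\<lambda>x. c * f x) \<in> Cc"
proof -
  obtain C where C: "compactin X C" "\<And>x. x \<notin> C \<Longrightarrow> f x = 0" using Cc_support[OF f] by blast
  show ?thesis
    by (rule Cc_I[OF _ C(1)])
      (use Cc_continuous[OF f] C(2) in \<open>simp_all add: continuous_map_atin tendsto_mult_left\<close>)
qed

lemma Cc_minus: "f \<in> Cc \<Longrightarrow> - f \<in> Cc"
  using Cc_smult[of f "-1"] by (simp add: fun_Compl_def)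

lemma Cc_diff: "f \<in> Cc \<Longrightarrow> g \<in> Cc \<Longrightarrow> f - g \<in> Cc"
  using Cc_add[of f "- g"] Cc_minus[of g] by simp

lemma Cc_star:
  assumes f: "f \<in> Cc"
  shows "(\<lambda>x. if x \<in> carrier G then cnj (f (inv x)) else 0) \<in> Cc"
proof -
  obtain C where C: "compactin X C" "\<And>x. x \<notin> C \<Longrightarrow> f x = 0" using Cc_support[OF f] by blast
  have "continuous_map X euclidean (\<lambda>x. cnj (f (inv x)))"
    using continuous_map_compose[OF continuous_inv Cc_continuous[OF f]]
    by (simp add: continuous_map_atin o_def tendsto_cnj)
  then have "continuous_map X euclidean (\<lambda>x. if x \<in> carrier G then cnj (f (inv x)) else 0)"
    by (rule continuous_map_eq) (simp add: topspace_X)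
  then show ?thesis
  proof (rule Cc_I)
    show "compactin X ((\<lambda>x. inv x) ` C)" by (rule image_compactin[OF C(1) continuous_inv])
    fix x assume "x \<notin> (\<lambda>x. inv x) ` C"
    then have "inv x \<notin> C" if "x \<in> carrier G"
      using that by (metis image_eqI inv_inv)
    then show "(if x \<in> carrier G then cnj (f (inv x)) else 0) = 0" using C(2) by simp
  qed
qed

lemma Cc_uniformly_continuous:
  assumes f: "f \<in> Cc" and e: "e > 0"
  obtains n where "\<And>x k. x \<in> carrier G \<Longrightarrow> k \<in> K n \<Longrightarrow> dist (f (x \<otimes> k)) (f x) < e"
proof -
  obtain C where C: "compactin X C" "\<And>x. x \<notin> C \<Longrightarrow> f x = 0" using Cc_support[OF f] by blast
  have CG: "C \<subseteq> carrier G" using C(1) by (rule compactin_carrier)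
  have e2: "e/2 > 0" using e by simp
  have "\<forall>x\<in>carrier G. \<exists>n. \<forall>y\<in>coset x n. dist (f y) (f x) < e/2"
    using Cc_continuous[OF f] e2 unfolding continuous_iff by blast
  then obtain N where N: "\<And>x y. x \<in> carrier G \<Longrightarrow> y \<in> coset x (N x) \<Longrightarrow> dist (f y) (f x) < e/2"
    by metis
  obtain R where R: "finite R" "R \<subseteq> C" "C \<subseteq> (\<Union>x\<in>R. coset x (N x))"
    using compactin_coset_cover[OF C(1)] by blast
  define n where "n = Max (insert 0 (N ` R))"
  have n: "N r \<le> n" if "r \<in> R" for r unfolding n_def using that R(1) by (intro Max_ge) auto
  have near: "dist (f (x \<otimes> k)) (f x) < e" if x: "x \<in> C" and k: "k \<in> K n" for x k
  proof -
    obtain r where r: "r \<in> R" "x \<in> coset r (N r)" using x R(3) by blast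
    have car: "r \<in> carrier G" "x \<in> carrier G" using r x R(2) CG by auto
    have "k \<in> K (N r)" using k K_decreasing[OF n[OF r(1)]] by blast
    then have "x \<otimes> k \<in> coset r (N r)"
      using coset_mult[of x k "N r"] coset_eq[of r x "N r"] car r by simp
    then show ?thesis
      using N[OF car(1) r(2)] N[OF car(1), of "x \<otimes> k"] dist_triangle_half_l by blast
  qed
  have "dist (f (x \<otimes> k)) (f x) < e" if x: "x \<in> carrier G" and k: "k \<in> K n" for x k
  proof (cases "x \<in> C")
    case False
    show ?thesis
    proof (cases "x \<otimes> k \<in> C")
      \<comment> \<open>Only the far end lies in \<open>C\<close>: the estimate is applied there,
        and \<open>inv k\<close> leads back to \<open>x\<close>.\<close>
      case True
      have "(x \<otimes> k) \<otimes> inv k = x" using x K_carrier[OF k] by (simp add: m_assoc)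
      then show ?thesis using near[OF True K_inv[OF k]] by (simp add: dist_commute)
    qed (use False C(2) e in simp)
  qed (use near k in simp)
  then show ?thesis using that by blast
qed

end


section \<open>Convolution on totally disconnected unimodular groups\<close>

locale unimodular_td_group = td_group +
  fixes M :: "'a measure"
  assumes haar: "haar_measure G X M"
    and right_invariant: "g \<in> carrier G \<Longrightarrow> E \<in> sets M \<Longrightarrow> emeasure M (E #> g) = emeasure M E"
    and K_pos: "emeasure M (K n) \<noteq> 0"
begin

lemma space_M: "space M = carrier G"
  using haar by (simp add: haar_measure_def)

lemma open_sets: "openin X U \<Longrightarrow> U \<in> sets M"
  using haar by (auto simp: haar_measure_def)

lemma compact_sets:
  assumes C: "compactin X C"
  shows "C \<in> sets M"
proof -
  have "openin X (carrier G - C)"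
    using compactin_imp_closedin[OF Hausdorff_X C] by (simp add: closedin_def topspace_X)
  then have "space M - (carrier G - C) \<in> sets M" using open_sets by blast
  moreover have "space M - (carrier G - C) = C" using compactin_carrier[OF C] by (auto simp: space_M)
  ultimately show ?thesis by simp
qed

lemma compact_finite: "compactin X C \<Longrightarrow> emeasure M C < \<infinity>"
  using haar by (simp add: haar_measure_def)

lemma coset_sets [measurable, simp]: "x \<in> carrier G \<Longrightarrow> coset x n \<in> sets M"
  by (rule open_sets[OF openin_coset])

lemma K_sets: "K n \<in> sets M"
  using coset_sets[of \<one> n] by (simp add: coset_one)

definition w :: "nat \<Rightarrow> real" where "w n = measure M (K n)"

lemma emeasure_K: "emeasure M (K n) = ennreal (w n)"
  unfolding w_def using compact_finite[OF K_compact] by (simp add: emeasure_eq_ennreal_measure less_top)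

lemma w_pos: "w n > 0"
  using K_pos[of n] unfolding emeasure_K by (simp add: ennreal_eq_0_iff)

lemma emeasure_coset: "x \<in> carrier G \<Longrightarrow> emeasure M (coset x n) = ennreal (w n)"
proof -
  assume x: "x \<in> carrier G"
  have "emeasure M (x <# K n) = emeasure M (K n)"
    using haar x K_sets[of n] by (simp add: haar_measure_def)
  then show ?thesis using x by (simp add: l_coset_eq_coset emeasure_K)
qed

lemma measure_coset: "x \<in> carrier G \<Longrightarrow> measure M (coset x n) = w n"
  using w_pos[of n] by (simp add: measure_def emeasure_coset)

lemma borel_measurable_continuous:
  fixes f :: "'a \<Rightarrow> complex"
  assumes "continuous_map X euclidean f"
  shows "f \<in> borel_measurable M"
proof (rule borel_measurableI)
  fix S :: "complex set" assume "open S"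
  then have "openin X {x \<in> topspace X. f x \<in> S}"
    using assms by (simp add: openin_continuous_map_preimage)
  moreover have "{x \<in> topspace X. f x \<in> S} = f -` S \<inter> space M" by (auto simp: topspace_X space_M)
  ultimately show "f -` S \<inter> space M \<in> sets M" using open_sets by simp
qed

lemma integrable_compact:
  fixes f :: "'a \<Rightarrow> complex"
  assumes f: "continuous_map X euclidean f" and C: "compactin X C"
    and 0: "\<And>x. x \<in> carrier G \<Longrightarrow> x \<notin> C \<Longrightarrow> f x = 0"
  shows "integrable M f"
proof -
  have "compact (f ` C)" using image_compactin[OF C f] by simp
  then have "bounded (f ` C)" by (rule compact_imp_bounded)
  then obtain B where B: "\<And>x. x \<in> C \<Longrightarrow> norm (f x) \<le> B"
    unfolding bounded_iff by auto
  show ?thesis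
  proof (rule integrableI_bounded_set)
    show "C \<in> sets M" using C by (rule compact_sets)
    show "f \<in> borel_measurable M" using f by (rule borel_measurable_continuous)
    show "emeasure M C < \<infinity>" using C by (rule compact_finite)
    show "AE x in M. x \<in> C \<longrightarrow> norm (f x) \<le> B" using B by simp
    show "AE x in M. x \<notin> C \<longrightarrow> f x = 0"
      by (rule AE_I2) (use 0 in \<open>simp add: space_M\<close>)
  qed
qed

lemma Cc_integrable: "f \<in> Cc \<Longrightarrow> integrable M f"
  using Cc_support integrable_compact Cc_continuous by metis

abbreviation A :: "('a \<Rightarrow> complex) star_algebra" where "A \<equiv> convolution_algebra G X M"

definition conv :: "('a \<Rightarrow> complex) \<Rightarrow> ('a \<Rightarrow> complex) \<Rightarrow> 'a \<Rightarrow> complex" where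
  "conv f h x = (if x \<in> carrier G then LINT y|M. f y * h (inv y \<otimes> x) else 0)"

definition L1 :: "('a \<Rightarrow> complex) \<Rightarrow> real" where "L1 f = (LINT x|M. cmod (f x))"

text \<open>\<open>K 0\<close> has positive finite measure, so comparing it with its translate
  leaves 1 as the only possible factor.\<close>

lemma modular_function_1:
  assumes g: "g \<in> carrier G"
  shows "modular_function G M g = 1"
  unfolding modular_function_def
proof (rule the_equality)
  show "0 < (1::real) \<and> (\<forall>E\<in>sets M. emeasure M (E #> g) = ennreal 1 * emeasure M E)"
    using right_invariant g by simp
  fix c :: real assume c: "0 < c \<and> (\<forall>E\<in>sets M. emeasure M (E #> g) = ennreal c * emeasure M E)"
  then have "ennreal (w 0) = ennreal c * ennreal (w 0)"
    using right_invariant[OF g K_sets[of 0]] K_sets[of 0] by (simp add: emeasure_K)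
  also have "\<dots> = ennreal (c * w 0)" using c w_pos[of 0] by (simp add: ennreal_mult)
  finally show "c = 1" using c w_pos[of 0] by simp
qed

lemma carrier_A: "carrier A = Cc" by (simp add: convolution_algebra_def)
lemma mult_A: "f \<otimes>\<^bsub>A\<^esub> h = conv f h" by (simp add: convolution_algebra_def conv_def fun_eq_iff)
lemma zero_A: "\<zero>\<^bsub>A\<^esub> = 0" by (simp add: convolution_algebra_def zero_fun_def)
lemma add_A: "f \<oplus>\<^bsub>A\<^esub> h = f + h" by (simp add: convolution_algebra_def plus_fun_def)
lemma smult_A: "c \<odot>\<^bsub>A\<^esub> f = (\<lambda>x. c * f x)" by (simp add: convolution_algebra_def)
lemma star_A: "star A f = (\<lambda>x. if x \<in> carrier G then cnj (f (inv x)) else 0)"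
  by (auto simp: convolution_algebra_def fun_eq_iff modular_function_1)

lemma integrand_continuous:
  assumes f: "f \<in> Cc" and h: "h \<in> Cc" and x: "x \<in> carrier G"
  shows "continuous_map X euclidean (\<lambda>y. f y * h (inv y \<otimes> x))"
proof -
  have "continuous_map X (prod_topology X X) (\<lambda>y. (inv y, x))"
    using x continuous_inv by (intro continuous_map_pairedI) (auto simp: topspace_X)
  then have "continuous_map X X ((\<lambda>(a, b). a \<otimes> b) \<circ> (\<lambda>y. (inv y, x)))"
    using continuous_mult by (rule continuous_map_compose)
  then have "continuous_map X euclidean (h \<circ> ((\<lambda>(a, b). a \<otimes> b) \<circ> (\<lambda>y. (inv y, x))))"
    using Cc_continuous[OF h] by (rule continuous_map_compose)
  then show ?thesis
    using Cc_continuous[OF f] by (simp add: continuous_map_atin o_def tendsto_mult)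
qed

lemma integrand_integrable:
  assumes f: "f \<in> Cc" and h: "h \<in> Cc" and x: "x \<in> carrier G"
  shows "integrable M (\<lambda>y. f y * h (inv y \<otimes> x))"
proof -
  obtain C where C: "compactin X C" "\<And>x. x \<notin> C \<Longrightarrow> f x = 0" using Cc_support[OF f] by blast
  then show ?thesis
    using integrable_compact[OF integrand_continuous[OF f h x] C(1)] by simp
qed

lemma conv_diff_left:
  assumes "f \<in> Cc" "f' \<in> Cc" "h \<in> Cc"
  shows "conv (f - f') h = conv f h - conv f' h"
  using assms by (auto simp: conv_def fun_eq_iff left_diff_distrib integrand_integrable)

lemma conv_diff_right:
  assumes "f \<in> Cc" "h \<in> Cc" "h' \<in> Cc"
  shows "conv f (h - h') = conv f h - conv f h'"
  using assms by (auto simp: conv_def fun_eq_iff right_diff_distrib integrand_integrable)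

lemma L1_nonneg: "0 \<le> L1 f"
  by (simp add: L1_def)

lemma conv_Cc:
  assumes f: "f \<in> Cc" and h: "h \<in> Cc"
  shows "conv f h \<in> Cc"
proof -
  obtain C where C: "compactin X C" "\<And>x. x \<notin> C \<Longrightarrow> f x = 0" using Cc_support[OF f] by blast
  obtain D where D: "compactin X D" "\<And>x. x \<notin> D \<Longrightarrow> h x = 0" using Cc_support[OF h] by blast
  have CG: "C \<subseteq> carrier G" using C(1) by (rule compactin_carrier)
  show ?thesis
  proof (rule Cc_I)
    have "compactin (prod_topology X X) (C \<times> D)" using C D by (simp add: compactin_Times)
    then show "compactin X ((\<lambda>(x, y). x \<otimes> y) ` (C \<times> D))"
      by (rule image_compactin[OF _ continuous_mult])
    show "conv f h x = 0" if x: "x \<notin> (\<lambda>(x, y). x \<otimes> y) ` (C \<times> D)" for x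
    proof (cases "x \<in> carrier G")
      case True
      have "f y * h (inv y \<otimes> x) = 0" for y
      proof (cases "y \<in> C \<and> inv y \<otimes> x \<in> D")
        case yes: True
        then have "x = (\<lambda>(x, y). x \<otimes> y) (y, inv y \<otimes> x)"
          using True CG by (auto simp: inv_mult_cancel)
        then show ?thesis using x yes by (metis SigmaI image_eqI)
      qed (use C D in auto)
      then show ?thesis by (simp only: conv_def) simp
    qed (simp add: conv_def)
    show "continuous_map X euclidean (conv f h)"
      unfolding continuous_iff
    proof (intro ballI allI impI)
      fix x and e :: real assume x: "x \<in> carrier G" and e: "e > 0"
      define d where "d = e / (L1 f + 1)"
      have L: "L1 f + 1 > 0" using L1_nonneg[of f] by simp
      have d: "d > 0" using e L by (simp add: d_def)
      obtain n where n: "\<And>x k. x \<in> carrier G \<Longrightarrow> k \<in> K n \<Longrightarrow> dist (h (x \<otimes> k)) (h x) < d"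
        using Cc_uniformly_continuous[OF h d] by blast
      have "dist (conv f h z) (conv f h x) < e" if z: "z \<in> coset x n" for z
      proof -
        obtain k where k: "k \<in> K n" "z = x \<otimes> k" using z x by (auto simp: coset_eq_image)
        have zG: "z \<in> carrier G" using z by (rule coset_carrier)
        have "conv f h z - conv f h x = (LINT y|M. f y * h (inv y \<otimes> z) - f y * h (inv y \<otimes> x))"
          using x zG f h by (simp add: conv_def integrand_integrable)
        also have "cmod \<dots> \<le> (LINT y|M. cmod (f y * h (inv y \<otimes> z) - f y * h (inv y \<otimes> x)))"
          by (rule integral_norm_bound)
        also have "\<dots> \<le> (LINT y|M. cmod (f y) * d)"
        proof (rule integral_mono)
          show "integrable M (\<lambda>y. cmod (f y * h (inv y \<otimes> z) - f y * h (inv y \<otimes> x)))"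
            using f h x zG by (intro integrable_norm Bochner_Integration.integrable_diff integrand_integrable)
          show "integrable M (\<lambda>y. cmod (f y) * d)"
            using Cc_integrable[OF f] by simp
          fix y assume "y \<in> space M"
          then have y: "y \<in> carrier G" by (simp add: space_M)
          \<comment> \<open>All arguments of \<open>h\<close> move by the same right factor
            \<open>k\<close>, so uniform continuity bounds the change independently of
            \<open>y\<close>.\<close>
          have "inv y \<otimes> z = (inv y \<otimes> x) \<otimes> k"
            using k x y by (simp add: m_assoc K_carrier)
          then have "cmod (h (inv y \<otimes> z) - h (inv y \<otimes> x)) \<le> d"
            using n[of "inv y \<otimes> x" k] x y k(1) by (simp add: dist_norm less_imp_le)
          then show "cmod (f y * h (inv y \<otimes> z) - f y * h (inv y \<otimes> x)) \<le> cmod (f y) * d"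
            by (simp add: right_diff_distrib[symmetric] norm_mult mult_left_mono)
        qed
        also have "\<dots> = L1 f * d" by (simp add: L1_def)
        also have "\<dots> < (L1 f + 1) * d" using d by simp
        also have "\<dots> = e" using L by (simp add: d_def)
        finally show ?thesis by (simp add: dist_norm)
      qed
      then show "\<exists>n. \<forall>y\<in>coset x n. dist (conv f h y) (conv f h x) < e" by blast
    qed
  qed
qed

subsection \<open>Normalised indicator functions of cosets\<close>

definition \<delta> :: "'a \<Rightarrow> nat \<Rightarrow> 'a \<Rightarrow> complex" where
  "\<delta> g n x = of_real (indicator (coset g n) x / w n)"

lemma \<delta>_outside: "x \<notin> carrier G \<Longrightarrow> \<delta> g n x = 0"
  by (simp add: \<delta>_def coset_def)

lemma \<delta>_Cc:
  assumes g: "g \<in> carrier G"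
  shows "\<delta> g n \<in> Cc"
proof (rule Cc_I)
  show "compactin X (coset g n)" using g by (rule compactin_coset)
  show "continuous_map X euclidean (\<delta> g n)"
    unfolding continuous_iff
  proof (intro ballI allI impI)
    fix x and e :: real assume x: "x \<in> carrier G" "e > 0"
    have "y \<in> coset g n \<longleftrightarrow> x \<in> coset g n" if "y \<in> coset x n" for y
      using coset_eq[OF x(1) that] coset_eq[OF g, of x n] coset_eq[OF g, of y n] coset_self[OF x(1), of n] that
      by blast
    then show "\<exists>m. \<forall>y\<in>coset x m. dist (\<delta> g n y) (\<delta> g n x) < e"
      by (intro exI[of _ n] ballI) (use x in \<open>simp add: \<delta>_def indicator_def\<close>)
  qed
qed (auto simp: \<delta>_def)

lemma \<delta>_cong: "coset g n = coset h n \<Longrightarrow> \<delta> g n = \<delta> h n"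
  by (simp add: \<delta>_def fun_eq_iff)

lemma \<delta>_mult_K: "g \<in> carrier G \<Longrightarrow> k \<in> K n \<Longrightarrow> \<delta> (g \<otimes> k) n = \<delta> g n"
  by (rule \<delta>_cong[OF coset_mult_eq])

text \<open>For y = g k with k in K n, y h K m = g h (inv h k h) K m = g h K m, so the averaging
  over \<open>K n\<close> is absorbed. In a representation, the average over a small coset of
  \<open>g\<close> thus acts like translation by \<open>g\<close>.\<close>

lemma conv_\<delta>_absorb_left:
  assumes g: "g \<in> carrier G" and h: "h \<in> carrier G"
    and conj: "\<And>k. k \<in> K n \<Longrightarrow> inv h \<otimes> k \<otimes> h \<in> K m"
  shows "conv (\<delta> g n) (\<delta> h m) = \<delta> (g \<otimes> h) m"
proof
  fix x
  show "conv (\<delta> g n) (\<delta> h m) x = \<delta> (g \<otimes> h) m x"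
  proof (cases "x \<in> carrier G")
    case x: True
    have eq: "inv y \<otimes> x \<in> coset h m \<longleftrightarrow> x \<in> coset (g \<otimes> h) m" if y: "y \<in> coset g n" for y
    proof -
      obtain k where k: "k \<in> K n" "y = g \<otimes> k" using y g by (auto simp: coset_eq_image)
      define l where "l = inv h \<otimes> inv k \<otimes> h"
      have l: "l \<in> K m" unfolding l_def by (rule conj[OF K_inv[OF k(1)]])
      have kG: "k \<in> carrier G" using k(1) by (rule K_carrier)
      define z where "z = inv (g \<otimes> h) \<otimes> x"
      have zG: "z \<in> carrier G" using g h x by (simp add: z_def)
      have "inv h \<otimes> (inv y \<otimes> x) = l \<otimes> z"
        unfolding l_def z_def using g h x kG k(2) by (simp add: inv_mult_group m_assoc inv_mult_cancel)
      moreover have "l \<otimes> z \<in> K m \<longleftrightarrow> z \<in> K m"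
        using K_mult[OF l] K_mult[OF K_inv[OF l], of "l \<otimes> z"] K_carrier[OF l] zG
        by (auto simp: inv_mult_cancel)
      ultimately show ?thesis using g h x k kG by (simp add: coset_def z_def)
    qed
    have "conv (\<delta> g n) (\<delta> h m) x = (LINT y|M. indicator (coset g n) y *\<^sub>R (of_real (1 / w n) * \<delta> (g \<otimes> h) m x))"
    proof -
      have "\<delta> g n y * \<delta> h m (inv y \<otimes> x)
          = indicator (coset g n) y *\<^sub>R (of_real (1 / w n) * \<delta> (g \<otimes> h) m x)" for y
        using eq[of y] by (cases "y \<in> coset g n") (simp_all add: \<delta>_def indicator_def)
      then show ?thesis unfolding conv_def using x by simp
    qed
    also have "\<dots> = w n *\<^sub>R (of_real (1 / w n) * \<delta> (g \<otimes> h) m x)"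
      using g by (simp add: measure_coset emeasure_coset)
    also have "\<dots> = \<delta> (g \<otimes> h) m x" using w_pos[of n] by (simp add: scaleR_conv_of_real)
    finally show ?thesis .
  qed (simp add: conv_def \<delta>_outside)
qed

text \<open>\<open>\<delta> g n\<close> is invariant under right translation by \<open>K n\<close>,
  which contains k K l, so averaging over that coset changes nothing. Here the right invariance of
  the measure enters.\<close>

lemma conv_\<delta>_absorb_right:
  assumes g: "g \<in> carrier G" and k: "k \<in> K n" and nl: "n \<le> l"
  shows "conv (\<delta> g n) (\<delta> k l) = \<delta> g n"
proof
  fix x
  have kG: "k \<in> carrier G" using k by (rule K_carrier)
  show "conv (\<delta> g n) (\<delta> k l) x = \<delta> g n x"
  proof (cases "x \<in> carrier G")
    case x: True
    \<comment> \<open>The set of those y at which the second factor in the convolution integral for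
      \<open>x\<close> does not vanish.\<close>
    define S where "S = coset x l #> inv k"
    have S_mem: "y \<in> S \<longleftrightarrow> inv y \<otimes> x \<in> coset k l" if y: "y \<in> carrier G" for y
    proof -
      have "y \<in> S \<longleftrightarrow> y \<otimes> k \<in> coset x l"
      proof
        assume "y \<in> S"
        then obtain z where "z \<in> coset x l" "y = z \<otimes> inv k" by (auto simp: S_def r_coset_def)
        then show "y \<otimes> k \<in> coset x l" using kG coset_carrier by (simp add: m_assoc)
      next
        assume *: "y \<otimes> k \<in> coset x l"
        have "y = (y \<otimes> k) \<otimes> inv k" using y kG by (simp add: m_assoc)
        then show "y \<in> S" using * unfolding S_def r_coset_def by blast
      qed
      also have "\<dots> \<longleftrightarrow> x \<in> coset (y \<otimes> k) l"
        using coset_sym[OF x] coset_sym[of "y \<otimes> k" x l] y kG by auto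
      also have "\<dots> \<longleftrightarrow> inv y \<otimes> x \<in> coset k l"
        using x y kG by (simp add: coset_def inv_mult_group m_assoc)
      finally show ?thesis .
    qed
    have S_sets: "S \<in> sets M" and S_meas: "emeasure M S = ennreal (w l)"
    proof -
      have "continuous_map X X (\<lambda>y. y \<otimes> k)"
      proof -
        have "continuous_map X (prod_topology X X) (\<lambda>y. (y, k))"
          using kG by (intro continuous_map_pairedI) (auto simp: topspace_X)
        from continuous_map_compose[OF this continuous_mult] show ?thesis by (simp add: o_def)
      qed
      then have "openin X {y \<in> topspace X. y \<otimes> k \<in> coset x l}"
        by (rule openin_continuous_map_preimage[OF _ openin_coset[OF x]])
      moreover have "{y \<in> topspace X. y \<otimes> k \<in> coset x l} = S"
      proof -
        have "y \<in> carrier G" "y \<otimes> k \<in> coset x l" if "y \<in> S" for y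
          using that kG coset_carrier by (auto simp: S_def r_coset_def m_assoc)
        moreover have "y \<in> S" if "y \<in> carrier G" "y \<otimes> k \<in> coset x l" for y
        proof -
          have "y = (y \<otimes> k) \<otimes> inv k" using that kG by (simp add: m_assoc)
          then show "y \<in> S" using that unfolding S_def r_coset_def by blast
        qed
        ultimately show ?thesis by (auto simp: topspace_X)
      qed
      ultimately show "S \<in> sets M" using open_sets by simp
      show "emeasure M S = ennreal (w l)"
        unfolding S_def using right_invariant[of "inv k" "coset x l"] kG x by (simp add: emeasure_coset)
    qed
    have sub: "y \<in> coset g n \<longleftrightarrow> x \<in> coset g n" if y: "y \<in> carrier G" "y \<in> S" for y
    proof -
      have "inv y \<otimes> x \<in> coset k n" using y S_mem coset_decreasing[OF nl] by blast
      also have "coset k n = K n" using coset_mult_eq[of \<one> k n] k kG by (simp add: coset_one)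
      finally have "x \<in> coset y n" using x by (simp add: coset_def)
      then show ?thesis
        using coset_eq[OF y(1), of x n] coset_eq[OF g, of x n] coset_eq[OF g, of y n]
          coset_self[OF x, of n] coset_self[OF y(1), of n] by blast
    qed
    have "conv (\<delta> g n) (\<delta> k l) x = (LINT y|M. indicator S y *\<^sub>R (of_real (1 / w l) * \<delta> g n x))"
    proof -
      have "\<delta> g n y * \<delta> k l (inv y \<otimes> x)
          = indicator S y *\<^sub>R (of_real (1 / w l) * \<delta> g n x)" if "y \<in> space M" for y
        using S_mem[of y] sub[of y] that
        by (cases "y \<in> S") (simp_all add: \<delta>_def indicator_def space_M)
      then show ?thesis
        unfolding conv_def using x by (simp cong: Bochner_Integration.integral_cong)
    qed
    also have "\<dots> = w l *\<^sub>R (of_real (1 / w l) * \<delta> g n x)"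
      using S_sets S_meas w_pos[of l] by (simp add: measure_def)
    also have "\<dots> = \<delta> g n x" using w_pos[of l] by (simp add: scaleR_conv_of_real)
    finally show ?thesis .
  qed (simp add: conv_def \<delta>_outside)
qed

text \<open>A coset of \<open>K n\<close> splits into cosets of \<open>K l\<close> with
  representatives g k, where the elements k do not depend on \<open>g\<close>. This uniformity lets
  \<open>E_refine_cong\<close> compare two averages term by term.\<close>

lemma \<delta>_refine:
  assumes nl: "n \<le> l"
  obtains R where "finite R" "R \<subseteq> K n"
    "\<And>g. g \<in> carrier G \<Longrightarrow> \<delta> g n = (\<Sum>k\<in>R. (\<lambda>x. of_real (w l / w n) * \<delta> (g \<otimes> k) l x))"
proof -
  obtain R where R: "finite R" "R \<subseteq> K n" "\<And>x. x \<in> K n \<Longrightarrow> \<exists>!r. r \<in> R \<and> x \<in> coset r l"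
    using coset_transversal[OF K_compact] by blast
  have "\<delta> g n x = (\<Sum>k\<in>R. (\<lambda>x. of_real (w l / w n) * \<delta> (g \<otimes> k) l x)) x" if g: "g \<in> carrier G" for g x
  proof (cases "x \<in> coset g n")
    case True
    then have xG: "x \<in> carrier G" and "inv g \<otimes> x \<in> K n" by (auto simp: coset_def)
    then obtain r where r: "r \<in> R" "inv g \<otimes> x \<in> coset r l"
      "\<And>k. k \<in> R \<Longrightarrow> inv g \<otimes> x \<in> coset k l \<Longrightarrow> k = r" using R(3) by blast
    have mem: "x \<in> coset (g \<otimes> k) l \<longleftrightarrow> k = r" if "k \<in> R" for k
    proof -
      have "x \<in> coset (g \<otimes> k) l \<longleftrightarrow> inv g \<otimes> x \<in> coset k l"
        using coset_translate[of g k "inv g \<otimes> x" l] g xG K_carrier that R(2)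
        by (auto simp: inv_mult_cancel)
      then show ?thesis using r that by blast
    qed
    have "(\<Sum>k\<in>R. of_real (w l / w n) * \<delta> (g \<otimes> k) l x) = (\<Sum>k\<in>R. if k = r then of_real (1 / w n) else 0)"
      by (rule sum.cong) (use w_pos[of l] in \<open>auto simp: \<delta>_def indicator_def mem\<close>)
    also have "\<dots> = \<delta> g n x" using r(1) R(1) True by (simp add: \<delta>_def)
    finally show ?thesis by (simp add: sum_fun_apply)
  next
    case False
    have "x \<notin> coset (g \<otimes> k) l" if "k \<in> R" for k
      using False coset_decreasing[OF nl] coset_mult_eq[OF g, of k n] R(2) that by blast
    then have "(\<Sum>k\<in>R. of_real (w l / w n) * \<delta> (g \<otimes> k) l x) = 0"
      by (intro sum.neutral) (simp add: \<delta>_def)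
    then show ?thesis using False by (simp add: sum_fun_apply \<delta>_def)
  qed
  then show ?thesis using that[OF R(1,2)] by blast
qed

text \<open>The level can be forced above any \<open>n0\<close> because continuity of
  \<open>f\<close> only improves with it; \<open>rep_mem\<close> uses this to test fine averages
  only.\<close>

lemma step_dense:
  assumes f: "f \<in> Cc" and e: "e > 0"
  obtains n R c where "n \<ge> n0" "finite R" "R \<subseteq> carrier G"
    "L1 (f - (\<Sum>r\<in>R. (\<lambda>x. c r * \<delta> r n x))) < e"
proof -
  obtain C where C: "compactin X C" "\<And>x. x \<notin> C \<Longrightarrow> f x = 0" using Cc_support[OF f] by blast
  obtain Q where Q: "finite Q" "Q \<subseteq> C" "\<And>x. x \<in> C \<Longrightarrow> \<exists>!r. r \<in> Q \<and> x \<in> coset r 0"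
    using coset_transversal[OF C(1)] by blast
  have QG: "Q \<subseteq> carrier G" using Q(2) compactin_carrier[OF C(1)] by blast
  \<comment> \<open>A union of cosets of \<open>K 0\<close>, hence of cosets of every level. All
    step functions live on this one set of finite measure, whatever the level, so the uniform error
    \<open>d\<close> controls the integral.\<close>
  define D where "D = (\<Union>r\<in>Q. coset r 0)"
  have D: "compactin X D" unfolding D_def
    using Q(1) QG compactin_coset by (intro compactin_Union) auto
  have DG: "D \<subseteq> carrier G" using D by (rule compactin_carrier)
  have CD: "C \<subseteq> D" unfolding D_def using Q(3) by blast
  have Dsets: "D \<in> sets M" using D by (rule compact_sets)
  define d where "d = e / (measure M D + 1)"
  have d: "d > 0" using e by (simp add: d_def add_nonneg_pos)
  obtain N where N: "\<And>x k. x \<in> carrier G \<Longrightarrow> k \<in> K N \<Longrightarrow> dist (f (x \<otimes> k)) (f x) < d"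
    using Cc_uniformly_continuous[OF f d] by blast
  define n where "n = max n0 N"
  obtain R where R: "finite R" "R \<subseteq> D" "\<And>x. x \<in> D \<Longrightarrow> \<exists>!r. r \<in> R \<and> x \<in> coset r n"
    using coset_transversal[OF D] by blast
  \<comment> \<open>The factor undoes the normalisation of \<open>\<delta>\<close>, so that the step
    function has the value \<open>f r\<close> on the coset of \<open>r\<close>.\<close>
  define c where "c r = f r * of_real (w n)" for r
  define s where "s = (\<Sum>r\<in>R. (\<lambda>x. c r * \<delta> r n x))"
  have s_apply: "s x = (\<Sum>r\<in>R. c r * \<delta> r n x)" for x by (simp add: s_def sum_fun_apply)
  have coset_D: "coset r n \<subseteq> D" if r: "r \<in> D" for r
  proof -
    obtain q where q: "q \<in> Q" "r \<in> coset q 0" using r by (auto simp: D_def)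
    then have "coset r 0 = coset q 0" using QG by (intro coset_eq) auto
    then show ?thesis using q coset_decreasing[of 0 n r] by (auto simp: D_def)
  qed
  have bound: "cmod ((f - s) x) \<le> d * indicator D x" for x
  proof (cases "x \<in> D")
    case True
    then obtain r where r: "r \<in> R" "x \<in> coset r n" "\<And>k. k \<in> R \<Longrightarrow> x \<in> coset k n \<Longrightarrow> k = r"
      using R(3) by blast
    have mem: "x \<in> coset k n \<longleftrightarrow> k = r" if "k \<in> R" for k using r that by blast
    have "s x = (\<Sum>k\<in>R. if k = r then f r else 0)"
      unfolding s_apply
    proof (rule sum.cong[OF refl])
      show "c k * \<delta> k n x = (if k = r then f r else 0)" if "k \<in> R" for k
        using w_pos[of n] mem[OF that] by (simp add: \<delta>_def c_def indicator_def)
    qed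
    then have sx: "s x = f r" using R(1) r(1) by simp
    have rG: "r \<in> carrier G" using r(1) R(2) DG by blast
    have "x \<in> coset r N" using r(2) coset_decreasing[of N n r] by (auto simp: n_def)
    then obtain k where "k \<in> K N" "x = r \<otimes> k" using rG by (auto simp: coset_eq_image)
    then show ?thesis using N[OF rG, of k] True sx by (simp add: dist_norm less_imp_le)
  next
    case False
    have "x \<notin> coset r n" if "r \<in> R" for r using False coset_D R(2) that by blast
    then have "s x = 0" unfolding s_apply by (intro sum.neutral) (simp add: \<delta>_def)
    then show ?thesis using False CD C(2) by auto
  qed
  have sum_Cc: "(\<Sum>r\<in>S. (\<lambda>x. c r * \<delta> r n x)) \<in> Cc" if "finite S" "S \<subseteq> carrier G" for S
    using that by (induction S rule: finite_induct) (auto intro!: Cc_zero Cc_add Cc_smult \<delta>_Cc)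
  have "s \<in> Cc" unfolding s_def using R(1,2) DG by (intro sum_Cc) auto
  then have int: "integrable M (f - s)" using f by (intro Cc_integrable Cc_diff)
  have "L1 (f - s) \<le> (LINT x|M. d * indicator D x)"
    unfolding L1_def using bound Dsets compact_finite[OF D]
    by (intro integral_mono integrable_norm int) auto
  also have "\<dots> = d * measure M D" using DG by (simp add: space_M Int_absorb2)
  also have "\<dots> < d * (measure M D + 1)" using d by simp
  also have "\<dots> = e"
    using measure_nonneg[of M D] by (simp add: d_def add_nonneg_eq_0_iff)
  finally show ?thesis
    using that[of n R c] R(1,2) DG unfolding s_def n_def by auto
qed

end


section \<open>The universal norm\<close>

text \<open>It carries the zero representation, which keeps the set of operator norms in the
  universal norm nonempty.\<close>

definition zero_space :: "'h \<Rightarrow> 'h inner_space" where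
  "zero_space z = \<lparr>carrier = {z}, mult = (\<lambda>_ _. z), one = z, zero = z, add = (\<lambda>_ _. z),
     smult = (\<lambda>_ _. z), inner_prod = (\<lambda>_ _. 0)\<rparr>"

lemma hilbert_space_zero_space: "hilbert_space (zero_space z)"
proof -
  have "abelian_group (zero_space z)"
    by (rule abelian_groupI) (auto simp: zero_space_def)
  then have "Module.module complex_ring (zero_space z)"
    by (intro moduleI cring_complex_ring) (auto simp: zero_space_def)
  moreover interpret Metric_space "carrier (zero_space z)" "hdist (zero_space z)"
    by unfold_locales (auto simp: hdist_def hnorm_def zero_space_def)
  have "finite (carrier (zero_space z))" by (simp add: zero_space_def)
  then have "compact_space mtopology" by (simp add: compact_space_def finite_imp_compactin)
  then have "mcomplete"
    by (rule compact_space_imp_mcomplete)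
  ultimately show ?thesis
    unfolding hilbert_space_def by (simp add: zero_space_def)
qed

context unimodular_td_group
begin

definition contractive_rep :: "'h inner_space \<Rightarrow> (('a \<Rightarrow> complex) \<Rightarrow> 'h \<Rightarrow> 'h) \<Rightarrow> bool" where
  "contractive_rep H \<pi> \<longleftrightarrow>
     star_representation A H \<pi> \<and> (\<forall>h\<in>Cc. operator_norm H (\<pi> h) \<le> L1 h)"

abbreviation p :: "('a \<Rightarrow> complex) \<Rightarrow> real" where "p \<equiv> universal_norm G X M"

definition operator_norms :: "('a \<Rightarrow> complex) \<Rightarrow> real set" where
  "operator_norms f = {operator_norm H (\<pi> f) |
     (H :: (('a \<Rightarrow> complex) \<Rightarrow> complex) inner_space) \<pi>. contractive_rep H \<pi>}"

lemma p_eq: "p f = Sup (operator_norms f)"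
  by (simp add: universal_norm_def operator_norms_def contractive_rep_def L1_def)

lemma operator_norms_nonempty: "operator_norms f \<noteq> {}"
proof -
  let ?H = "zero_space (0 :: ('a \<Rightarrow> complex) \<Rightarrow> complex)" and ?\<pi> = "\<lambda>_ (v :: ('a \<Rightarrow> complex) \<Rightarrow> complex). v"
  have car: "carrier ?H = {0}" by (simp add: zero_space_def)
  have "star_representation A ?H ?\<pi>"
    unfolding star_representation_def
    by (intro conjI hilbert_space_zero_space) (auto simp: zero_space_def bounded_operator_def hnorm_def)
  moreover have "operator_norm ?H (?\<pi> h) = 0" for h
  proof -
    have "{v \<in> carrier ?H. hnorm ?H v \<le> 1} = {0}" by (auto simp: zero_space_def hnorm_def)
    then show ?thesis unfolding operator_norm_def by (simp add: hnorm_def zero_space_def)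
  qed
  ultimately have "contractive_rep ?H ?\<pi>" by (simp add: contractive_rep_def L1_nonneg)
  then show ?thesis unfolding operator_norms_def by blast
qed

lemma p_le:
  assumes "\<And>(H :: (('a \<Rightarrow> complex) \<Rightarrow> complex) inner_space) \<pi>.
    contractive_rep H \<pi> \<Longrightarrow> operator_norm H (\<pi> f) \<le> C"
  shows "p f \<le> C"
  unfolding p_eq by (rule cSup_least[OF operator_norms_nonempty]) (use assms in \<open>auto simp: operator_norms_def\<close>)

lemma p_ge:
  assumes "contractive_rep (H :: (('a \<Rightarrow> complex) \<Rightarrow> complex) inner_space) \<pi>" "f \<in> Cc"
  shows "operator_norm H (\<pi> f) \<le> p f"
  unfolding p_eq
proof (rule cSup_upper)
  show "operator_norm H (\<pi> f) \<in> operator_norms f" using assms(1) unfolding operator_norms_def by blast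
  show "bdd_above (operator_norms f)"
    by (rule bdd_aboveI[of _ "L1 f"]) (use assms(2) in \<open>auto simp: operator_norms_def contractive_rep_def\<close>)
qed

lemma p_le_L1: "f \<in> Cc \<Longrightarrow> p f \<le> L1 f"
  by (rule p_le) (simp add: contractive_rep_def)

lemma p_nonneg: "f \<in> Cc \<Longrightarrow> 0 \<le> p f"
proof -
  assume f: "f \<in> Cc"
  obtain H :: "(('a \<Rightarrow> complex) \<Rightarrow> complex) inner_space" and \<pi> where rep: "contractive_rep H \<pi>"
    using operator_norms_nonempty[of f] unfolding operator_norms_def by blast
  interpret star_rep A H \<pi> by unfold_locales (use rep in \<open>simp add: contractive_rep_def\<close>)
  have "0 \<le> operator_norm H (\<pi> f)" using f by (intro operator_norm_nonneg rep_bounded) (simp add: carrier_A)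
  also have "\<dots> \<le> p f" using rep f by (rule p_ge)
  finally show ?thesis .
qed

text \<open>Seminorm properties of \<open>p\<close> are inherited from operator norms: they are
  checked vector by vector in each contractive representation, where \<open>p h\<close> already
  bounds the image of every \<open>h\<close>.\<close>

lemma p_le_rep:
  assumes f: "f \<in> Cc" and C: "C \<ge> 0"
    and *: "\<And>(H :: (('a \<Rightarrow> complex) \<Rightarrow> complex) inner_space) \<pi> v. star_rep A H \<pi> \<Longrightarrow>
      (\<And>h u. h \<in> Cc \<Longrightarrow> u \<in> carrier H \<Longrightarrow> hnorm H (\<pi> h u) \<le> p h * hnorm H u) \<Longrightarrow>
      v \<in> carrier H \<Longrightarrow> hnorm H (\<pi> f v) \<le> C * hnorm H v"
  shows "p f \<le> C"
proof (rule p_le)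
  fix H :: "(('a \<Rightarrow> complex) \<Rightarrow> complex) inner_space" and \<pi>
  assume rep: "contractive_rep H \<pi>"
  interpret star_rep A H \<pi> by unfold_locales (use rep in \<open>simp add: contractive_rep_def\<close>)
  have bound: "hnorm H (\<pi> h u) \<le> p h * hnorm H u" if h: "h \<in> Cc" "u \<in> carrier H" for h u
  proof -
    have "hnorm H (\<pi> h u) \<le> operator_norm H (\<pi> h) * hnorm H u"
      using h by (intro bounded_operator_le_operator_norm rep_bounded) (simp_all add: carrier_A)
    also have "\<dots> \<le> p h * hnorm H u" using h rep by (intro mult_right_mono p_ge) auto
    finally show ?thesis .
  qed
  show "operator_norm H (\<pi> f) \<le> C"
    using C by (rule operator_norm_le) (use * bound star_rep_axioms in blast)
qed

lemma rep_diff: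
  assumes "star_rep A H \<pi>" "f \<in> Cc" "h \<in> Cc" "v \<in> carrier H"
  shows "\<pi> (f - h) v = \<pi> f v \<ominus>\<^bsub>H\<^esub> \<pi> h v"
proof -
  interpret star_rep A H \<pi> by fact
  have "f - h = f \<oplus>\<^bsub>A\<^esub> (-1) \<odot>\<^bsub>A\<^esub> h" by (simp add: add_A smult_A fun_eq_iff)
  moreover have "(-1) \<odot>\<^bsub>A\<^esub> h \<in> Cc" unfolding smult_A using assms(3) by (rule Cc_smult)
  ultimately show ?thesis
    using assms by (simp add: rep_add rep_smult carrier_A diff_eq_add_smult)
qed

lemma seminormed_star_algebra_A: "seminormed_star_algebra A p"
proof
  show "add A = (+)" by (simp add: fun_eq_iff add_A)
  show "zero A = 0" by (rule zero_A)
  show "0 \<in> carrier A" by (simp add: carrier_A Cc_zero)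
  fix a assume "a \<in> carrier A"
  then have a: "a \<in> Cc" by (simp add: carrier_A)
  show sa: "star A a \<in> carrier A" unfolding star_A carrier_A using a by (rule Cc_star)
  show ca: "c \<odot>\<^bsub>A\<^esub> a \<in> carrier A" for c unfolding smult_A carrier_A using a by (rule Cc_smult)
  show "(-1) \<odot>\<^bsub>A\<^esub> a = - a" by (simp add: smult_A fun_eq_iff)
  show "(1/2) \<odot>\<^bsub>A\<^esub> a + (1/2) \<odot>\<^bsub>A\<^esub> a = a" by (simp add: smult_A fun_eq_iff)
  show "c \<odot>\<^bsub>A\<^esub> (inverse c \<odot>\<^bsub>A\<^esub> a) = a" if "c \<noteq> 0" for c
    using that by (simp add: smult_A fun_eq_iff)
  show "star A (c \<odot>\<^bsub>A\<^esub> a) = cnj c \<odot>\<^bsub>A\<^esub> star A a" for c by (simp add: smult_A star_A fun_eq_iff)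
  show "0 \<le> p a" using a by (rule p_nonneg)
  show "p (c \<odot>\<^bsub>A\<^esub> a) \<le> cmod c * p a" for c
  proof (rule p_le_rep)
    show "c \<odot>\<^bsub>A\<^esub> a \<in> Cc" using ca[of c] by (simp add: carrier_A)
    show "0 \<le> cmod c * p a" using p_nonneg[OF a] by simp
    fix H :: "(('a \<Rightarrow> complex) \<Rightarrow> complex) inner_space" and \<pi> v
    assume rep: "star_rep A H \<pi>" and v: "v \<in> carrier H"
      and bound: "\<And>h u. h \<in> Cc \<Longrightarrow> u \<in> carrier H \<Longrightarrow> hnorm H (\<pi> h u) \<le> p h * hnorm H u"
    interpret star_rep A H \<pi> by fact
    show "hnorm H (\<pi> (c \<odot>\<^bsub>A\<^esub> a) v) \<le> cmod c * p a * hnorm H v"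
      using a v bound[OF a v] by (simp add: rep_smult carrier_A hnorm_smult mult.assoc mult_left_mono)
  qed
  \<comment> \<open>With \<open>u\<close> the image of \<open>v\<close> under
    \<open>star A a\<close>, the square of its norm is the inner product of \<open>v\<close> with
    the image of \<open>u\<close> under \<open>a\<close>, hence at most |v| p(a) |u|; dividing by
    |u| gives the bound.\<close>
  have star_bound: "p (star A a) \<le> p a"
  proof (rule p_le_rep)
    show "star A a \<in> Cc" using sa by (simp add: carrier_A)
    show "0 \<le> p a" using a by (rule p_nonneg)
    fix H :: "(('a \<Rightarrow> complex) \<Rightarrow> complex) inner_space" and \<pi> v
    assume rep: "star_rep A H \<pi>" and v: "v \<in> carrier H"
      and bound: "\<And>h u. h \<in> Cc \<Longrightarrow> u \<in> carrier H \<Longrightarrow> hnorm H (\<pi> h u) \<le> p h * hnorm H u"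
    interpret star_rep A H \<pi> by fact
    define u where "u = \<pi> (star A a) v"
    have u: "u \<in> carrier H" using sa v by (simp add: u_def)
    have au: "\<pi> a u \<in> carrier H" using a u by (simp add: carrier_A)
    have "(hnorm H u)\<^sup>2 = Re (ip u u)" using u by (rule hnorm_power2)
    also have "ip u u = ip v (\<pi> a u)" unfolding u_def
      using rep_star[of a v u] a v u by (simp add: carrier_A u_def)
    also have "Re \<dots> \<le> hnorm H v * hnorm H (\<pi> a u)"
      using Cauchy_Schwarz[OF v au] complex_Re_le_cmod order_trans by blast
    also have "\<dots> \<le> hnorm H v * (p a * hnorm H u)"
      using v bound[OF a u] by (intro mult_left_mono) auto
    finally have *: "hnorm H u * hnorm H u \<le> (p a * hnorm H v) * hnorm H u"
      by (simp add: power2_eq_square mult_ac)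
    show "hnorm H (\<pi> (star A a) v) \<le> p a * hnorm H v"
    proof (cases "hnorm H u = 0")
      case True
      then show ?thesis using p_nonneg[OF a] v by (simp add: u_def)
    next
      case False
      then have "hnorm H u > 0" using hnorm_nonneg[OF u] by linarith
      then show ?thesis using * by (simp add: u_def)
    qed
  qed
  show "p (star A a) \<le> p a" by (rule star_bound)
  show "p (star A (star A a) - a) = 0"
  proof -
    have "star A (star A a) = a" using Cc_outside[OF a] by (auto simp: star_A fun_eq_iff)
    moreover have "p 0 \<le> 0" using p_le_L1[OF Cc_zero] by (simp add: L1_def)
    ultimately show ?thesis using p_nonneg[OF Cc_zero] by simp
  qed
  fix b assume "b \<in> carrier A"
  then have b: "b \<in> Cc" by (simp add: carrier_A)
  show "a + b \<in> carrier A" using a b by (simp add: carrier_A Cc_add)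
  show ab: "a \<otimes>\<^bsub>A\<^esub> b \<in> carrier A" using a b by (simp add: carrier_A mult_A conv_Cc)
  show "c \<odot>\<^bsub>A\<^esub> (a - b) = c \<odot>\<^bsub>A\<^esub> a - c \<odot>\<^bsub>A\<^esub> b" for c
    by (simp add: smult_A fun_eq_iff algebra_simps)
  show "star A (a - b) = star A a - star A b" by (simp add: star_A fun_eq_iff)
  show "p (a + b) \<le> p a + p b"
  proof (rule p_le_rep)
    show "a + b \<in> Cc" using a b by (rule Cc_add)
    show "0 \<le> p a + p b" using p_nonneg[OF a] p_nonneg[OF b] by simp
    fix H :: "(('a \<Rightarrow> complex) \<Rightarrow> complex) inner_space" and \<pi> v
    assume rep: "star_rep A H \<pi>" and v: "v \<in> carrier H"
      and bound: "\<And>h u. h \<in> Cc \<Longrightarrow> u \<in> carrier H \<Longrightarrow> hnorm H (\<pi> h u) \<le> p h * hnorm H u"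
    interpret star_rep A H \<pi> by fact
    have "\<pi> (a + b) v = \<pi> a v \<oplus>\<^bsub>H\<^esub> \<pi> b v" using rep_add[of a b v] a b v by (simp add: carrier_A add_A)
    then have "hnorm H (\<pi> (a + b) v) \<le> hnorm H (\<pi> a v) + hnorm H (\<pi> b v)"
      using hnorm_triangle a b v by (simp add: carrier_A)
    then show "hnorm H (\<pi> (a + b) v) \<le> (p a + p b) * hnorm H v"
      using bound[OF a v] bound[OF b v] by (simp add: distrib_right)
  qed
  show "p (a \<otimes>\<^bsub>A\<^esub> b) \<le> p a * p b"
  proof (rule p_le_rep)
    show "a \<otimes>\<^bsub>A\<^esub> b \<in> Cc" using ab by (simp add: carrier_A)
    show "0 \<le> p a * p b" using p_nonneg[OF a] p_nonneg[OF b] by simp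
    fix H :: "(('a \<Rightarrow> complex) \<Rightarrow> complex) inner_space" and \<pi> v
    assume rep: "star_rep A H \<pi>" and v: "v \<in> carrier H"
      and bound: "\<And>h u. h \<in> Cc \<Longrightarrow> u \<in> carrier H \<Longrightarrow> hnorm H (\<pi> h u) \<le> p h * hnorm H u"
    interpret star_rep A H \<pi> by fact
    have bv: "\<pi> b v \<in> carrier H" using b v by (simp add: carrier_A)
    have "hnorm H (\<pi> a (\<pi> b v)) \<le> p a * hnorm H (\<pi> b v)" using bound[OF a bv] .
    also have "\<dots> \<le> p a * (p b * hnorm H v)" using bound[OF b v] p_nonneg[OF a] by (rule mult_left_mono)
    finally show "hnorm H (\<pi> (a \<otimes>\<^bsub>A\<^esub> b) v) \<le> p a * p b * hnorm H v"
      using rep_mult[of a b v] a b v by (simp add: carrier_A mult.assoc)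
  qed
  \<comment> \<open>Both elements have the same operator in every representation, because adjoints
    reverse products. This gives seminorm 0 without evaluating either convolution.\<close>
  show "p (star A (a \<otimes>\<^bsub>A\<^esub> b) - star A b \<otimes>\<^bsub>A\<^esub> star A a) = 0"
  proof -
    have mem: "star A (a \<otimes>\<^bsub>A\<^esub> b) \<in> Cc" "star A a \<in> Cc" "star A b \<in> Cc" "star A b \<otimes>\<^bsub>A\<^esub> star A a \<in> Cc" "a \<otimes>\<^bsub>A\<^esub> b \<in> Cc"
      using a b by (simp_all add: star_A mult_A Cc_star conv_Cc)
    have "p (star A (a \<otimes>\<^bsub>A\<^esub> b) - star A b \<otimes>\<^bsub>A\<^esub> star A a) \<le> 0"
    proof (rule p_le_rep)
      show "star A (a \<otimes>\<^bsub>A\<^esub> b) - star A b \<otimes>\<^bsub>A\<^esub> star A a \<in> Cc" using mem by (intro Cc_diff)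
      fix H :: "(('a \<Rightarrow> complex) \<Rightarrow> complex) inner_space" and \<pi> v
      assume rep: "star_rep A H \<pi>" and v: "v \<in> carrier H"
      interpret star_rep A H \<pi> by fact
      have "\<pi> (star A (a \<otimes>\<^bsub>A\<^esub> b)) v = \<pi> (star A b \<otimes>\<^bsub>A\<^esub> star A a) v"
      proof (rule ip_eqI)
        fix u assume u: "u \<in> carrier H"
        show "ip (\<pi> (star A (a \<otimes>\<^bsub>A\<^esub> b)) v) u = ip (\<pi> (star A b \<otimes>\<^bsub>A\<^esub> star A a) v) u"
          using a b v u mem by (simp add: rep_star rep_mult carrier_A)
      qed (use mem v in \<open>simp_all add: carrier_A\<close>)
      then show "hnorm H (\<pi> (star A (a \<otimes>\<^bsub>A\<^esub> b) - star A b \<otimes>\<^bsub>A\<^esub> star A a) v) \<le> 0 * hnorm H v"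
        using rep_diff[OF rep mem(1,4) v] mem v by (simp add: carrier_A)
    qed simp
    then show ?thesis using p_nonneg[OF Cc_diff[OF mem(1,4)]] by simp
  qed
  fix d assume "d \<in> carrier A"
  then have d: "d \<in> Cc" by (simp add: carrier_A)
  show "(a - b) \<otimes>\<^bsub>A\<^esub> d = a \<otimes>\<^bsub>A\<^esub> d - b \<otimes>\<^bsub>A\<^esub> d"
    unfolding mult_A using a b d by (rule conv_diff_left)
  show "d \<otimes>\<^bsub>A\<^esub> (a - b) = d \<otimes>\<^bsub>A\<^esub> a - d \<otimes>\<^bsub>A\<^esub> b"
    unfolding mult_A using d a b by (rule conv_diff_right)
qed

end


section \<open>Irreducible representations\<close>

context hilbert
begin

lemma submodule_preimage:
  assumes T: "bounded_operator H T" and V: "submodule V complex_ring H"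
  shows "submodule {w \<in> carrier H. T w \<in> V} complex_ring H"
proof (rule submoduleI')
  note VE = submoduleE[OF V]
  have "\<zero>\<^bsub>H\<^esub> \<in> V" using subgroup.one_closed[OF submodule.axioms(1)[OF V]] by simp
  then show "\<zero>\<^bsub>H\<^esub> \<in> {w \<in> carrier H. T w \<in> V}" using T by (simp add: bounded_operator_zero)
  show "a \<oplus>\<^bsub>H\<^esub> b \<in> {w \<in> carrier H. T w \<in> V}"
    if "a \<in> {w \<in> carrier H. T w \<in> V}" "b \<in> {w \<in> carrier H. T w \<in> V}" for a b
    using that VE(5) T by (simp add: bounded_operator_add)
  show "c \<odot>\<^bsub>H\<^esub> a \<in> {w \<in> carrier H. T w \<in> V}" if "a \<in> {w \<in> carrier H. T w \<in> V}" for c a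
    using that VE(4) T by (simp add: bounded_operator_smult)
qed auto

lemma hclosure_preimage:
  assumes T: "bounded_operator H T" and V: "V \<subseteq> carrier H" "hclosure V \<subseteq> V"
  shows "hclosure {w \<in> carrier H. T w \<in> V} \<subseteq> {w \<in> carrier H. T w \<in> V}"
proof
  fix v assume v: "v \<in> hclosure {w \<in> carrier H. T w \<in> V}"
  then have vH: "v \<in> carrier H" by (simp add: hclosure_def)
  have "T v \<in> hclosure V"
    unfolding hclosure_def
  proof (intro CollectI conjI allI impI)
    show Tv: "T v \<in> carrier H" using T vH by (rule bounded_operator_closed)
    fix e :: real assume e: "e > 0"
    have L: "operator_norm H T + 1 > 0" using operator_norm_nonneg[OF T] by simp
    then have "e / (operator_norm H T + 1) > 0" using e by simp
    then obtain w where w: "w \<in> carrier H" "T w \<in> V" "hnorm H (v \<ominus>\<^bsub>H\<^esub> w) < e / (operator_norm H T + 1)"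
      using v unfolding hclosure_def by blast
    have "hnorm H (T v \<ominus>\<^bsub>H\<^esub> T w) \<le> operator_norm H T * hnorm H (v \<ominus>\<^bsub>H\<^esub> w)"
      using bounded_operator_le_operator_norm[OF T, of "v \<ominus>\<^bsub>H\<^esub> w"] vH w T
      by (simp add: bounded_operator_diff)
    also have "\<dots> \<le> (operator_norm H T + 1) * hnorm H (v \<ominus>\<^bsub>H\<^esub> w)"
      using vH w by (intro mult_right_mono) auto
    also have "\<dots> < e" using w(3) L by (simp add: pos_less_divide_eq mult.commute)
    finally show "\<exists>s\<in>V. hnorm H (T v \<ominus>\<^bsub>H\<^esub> s) < e" using w(2) by blast
  qed
  then show "v \<in> {w \<in> carrier H. T w \<in> V}" using V vH by blast
qed

lemma hclosure_zero: "hclosure {\<zero>\<^bsub>H\<^esub>} \<subseteq> {\<zero>\<^bsub>H\<^esub>}"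
proof
  fix v assume v: "v \<in> hclosure {\<zero>\<^bsub>H\<^esub>}"
  then have vH: "v \<in> carrier H" by (simp add: hclosure_def)
  then have "hnorm H v < e" if "e > 0" for e using v that by (simp add: hclosure_def)
  then have "hnorm H v \<le> 0" using less_irrefl not_le_imp_less by blast
  then show "v \<in> {\<zero>\<^bsub>H\<^esub>}" using hnorm_nonneg[OF vH] hnorm_eq_0[OF vH] by simp
qed

text \<open>The equaliser is an intersection of kernels of the bounded operators T i - S i, and a
  kernel is the preimage of a closed subspace.\<close>

lemma equalizer_closed_submodule:
  assumes T: "\<And>i. i \<in> I \<Longrightarrow> bounded_operator H (T i)" and S: "\<And>i. i \<in> I \<Longrightarrow> bounded_operator H (S i)"
  defines "W \<equiv> {w \<in> carrier H. \<forall>i\<in>I. T i w = S i w}"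
  shows "submodule W complex_ring H" "hclosure W \<subseteq> W"
proof -
  show "submodule W complex_ring H"
    by (rule submoduleI') (use T S in \<open>auto simp: W_def bounded_operator_zero bounded_operator_add bounded_operator_smult\<close>)
  show "hclosure W \<subseteq> W"
  proof
    fix v assume v: "v \<in> hclosure W"
    then have vH: "v \<in> carrier H" by (simp add: hclosure_def)
    have "T i v = S i v" if i: "i \<in> I" for i
    proof -
      let ?D = "\<lambda>w. T i w \<ominus>\<^bsub>H\<^esub> S i w"
      note cl = bounded_operator_closed[OF T[OF i]] bounded_operator_closed[OF S[OF i]]
      have "bounded_operator H ?D"
        unfolding bounded_operator_def
      proof (intro conjI ballI allI)
        show "?D \<in> carrier H \<rightarrow> carrier H" using cl by auto
        fix v w assume vw: "v \<in> carrier H" "w \<in> carrier H"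
        show "?D (v \<oplus>\<^bsub>H\<^esub> w) = ?D v \<oplus>\<^bsub>H\<^esub> ?D w"
          by (rule ip_eqI) (use vw cl T[OF i] S[OF i] in
              \<open>simp_all add: ip_simps bounded_operator_add\<close>)
      next
        fix c v assume v: "v \<in> carrier H"
        show "?D (c \<odot>\<^bsub>H\<^esub> v) = c \<odot>\<^bsub>H\<^esub> ?D v"
          by (rule ip_eqI) (use v cl T[OF i] S[OF i] in
              \<open>simp_all add: ip_simps bounded_operator_smult algebra_simps\<close>)
      next
        have "hnorm H (?D v) \<le> (operator_norm H (T i) + operator_norm H (S i)) * hnorm H v"
          if v: "v \<in> carrier H" for v
        proof -
          have "hnorm H (?D v) \<le> hnorm H (T i v) + hnorm H (S i v)"
            using hnorm_diff_triangle[of "T i v" "\<zero>\<^bsub>H\<^esub>" "S i v"] cl v hnorm_diff_commute[of "\<zero>\<^bsub>H\<^esub>" "S i v"]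
            by simp
          then show ?thesis
            using bounded_operator_le_operator_norm[OF T[OF i] v] bounded_operator_le_operator_norm[OF S[OF i] v]
            by (simp add: distrib_right)
        qed
        then show "\<exists>C. \<forall>v\<in>carrier H. hnorm H (?D v) \<le> C * hnorm H v" by blast
      qed
      then have "hclosure {w \<in> carrier H. ?D w \<in> {\<zero>\<^bsub>H\<^esub>}} \<subseteq> {w \<in> carrier H. ?D w \<in> {\<zero>\<^bsub>H\<^esub>}}"
        by (rule hclosure_preimage) (simp_all add: hclosure_zero)
      moreover have "W \<subseteq> {w \<in> carrier H. ?D w \<in> {\<zero>\<^bsub>H\<^esub>}}" using i cl by (auto simp: W_def)
      ultimately have "?D v = \<zero>\<^bsub>H\<^esub>" using hclosure_mono v by blast
      then show ?thesis using cl vH by (simp add: diff_eq_zero_iff)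
    qed
    then show "v \<in> W" using vH by (simp add: W_def)
  qed
qed

end

section \<open>Coset averages in an irreducible representation\<close>

locale irreducible_td_rep = unimodular_td_group G X K M + star_rep "convolution_algebra G X M" H \<pi>
  for G :: "('a, 'm) monoid_scheme" (structure) and X :: "'a topology" and K :: "nat \<Rightarrow> 'a set"
    and M :: "'a measure" and H :: "'h inner_space" and \<pi> :: "('a \<Rightarrow> complex) \<Rightarrow> 'h \<Rightarrow> 'h" +
  assumes irreducible: "irreducible_representation (convolution_algebra G X M) H \<pi>"
    and rep_le_L1: "f \<in> compactly_supported G X \<Longrightarrow> v \<in> carrier H \<Longrightarrow> hnorm H (\<pi> f v) \<le> L1 f * hnorm H v"
begin

lemma Cc_rep_closed: "f \<in> Cc \<Longrightarrow> v \<in> carrier H \<Longrightarrow> \<pi> f v \<in> carrier H"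
  by (simp add: carrier_A)

text \<open>\<open>E \<one> n\<close> is the projection P of the overview for \<open>K n\<close>,
  and \<open>E g n\<close> stands for this projection followed by \<open>g\<close>.\<close>

abbreviation E :: "'a \<Rightarrow> nat \<Rightarrow> 'h \<Rightarrow> 'h" where "E g n \<equiv> \<pi> (\<delta> g n)"

lemma E_bounded: "g \<in> carrier G \<Longrightarrow> bounded_operator H (E g n)"
  by (rule rep_bounded) (simp add: carrier_A \<delta>_Cc)

lemma E_closed [simp]: "g \<in> carrier G \<Longrightarrow> v \<in> carrier H \<Longrightarrow> E g n v \<in> carrier H"
  by (simp add: carrier_A \<delta>_Cc)

lemma E_absorb_left:
  assumes "g \<in> carrier G" "h \<in> carrier G" "\<And>k. k \<in> K n \<Longrightarrow> inv h \<otimes> k \<otimes> h \<in> K m" "v \<in> carrier H"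
  shows "E g n (E h m v) = E (g \<otimes> h) m v"
  using rep_mult[of "\<delta> g n" "\<delta> h m" v] conv_\<delta>_absorb_left[OF assms(1-3)] assms
  by (simp add: carrier_A \<delta>_Cc mult_A)

lemma E_absorb_right:
  assumes "g \<in> carrier G" "k \<in> K n" "n \<le> l" "v \<in> carrier H"
  shows "E g n (E k l v) = E g n v"
  using rep_mult[of "\<delta> g n" "\<delta> k l" v] conv_\<delta>_absorb_right[OF assms(1-3)] assms K_carrier[OF assms(2)]
  by (simp add: carrier_A \<delta>_Cc mult_A)

lemma E_mult_K: "g \<in> carrier G \<Longrightarrow> k \<in> K n \<Longrightarrow> E (g \<otimes> k) n = E g n"
  by (simp add: \<delta>_mult_K)

lemma rep_0: "v \<in> carrier H \<Longrightarrow> \<pi> 0 v = \<zero>\<^bsub>H\<^esub>"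
  using rep_smult[of 0 v 0] Cc_zero by (simp add: carrier_A smult_A zero_fun_def)

lemma rep_plus: "f \<in> Cc \<Longrightarrow> h \<in> Cc \<Longrightarrow> v \<in> carrier H \<Longrightarrow> \<pi> (f + h) v = \<pi> f v \<oplus>\<^bsub>H\<^esub> \<pi> h v"
  using rep_add[of f h v] by (simp add: carrier_A add_A)

lemma rep_scale: "f \<in> Cc \<Longrightarrow> v \<in> carrier H \<Longrightarrow> \<pi> (\<lambda>x. c * f x) v = c \<odot>\<^bsub>H\<^esub> \<pi> f v"
  using rep_smult[of f v c] by (simp add: carrier_A smult_A)

lemma rep_sum_cong:
  assumes "finite R" "u \<in> carrier H" "u' \<in> carrier H"
    and "\<And>k. k \<in> R \<Longrightarrow> f k \<in> Cc \<and> f' k \<in> Cc \<and> \<pi> (f k) u = \<pi> (f' k) u'"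
  shows "sum f R \<in> Cc \<and> sum f' R \<in> Cc \<and> \<pi> (sum f R) u = \<pi> (sum f' R) u'"
  using assms(1,4)
  by (induction R rule: finite_induct) (use assms(2,3) in \<open>auto simp: Cc_zero rep_0 Cc_add rep_plus\<close>)

lemma rep_sum_mem:
  assumes "finite R" "v \<in> carrier H" and W: "submodule W complex_ring H"
    and "\<And>k. k \<in> R \<Longrightarrow> f k \<in> Cc \<and> \<pi> (f k) v \<in> W"
  shows "sum f R \<in> Cc \<and> \<pi> (sum f R) v \<in> W"
  using assms(1,4)
proof (induction R rule: finite_induct)
  case empty
  show ?case
    unfolding sum.empty rep_0[OF assms(2)]
    by (rule conjI[OF Cc_zero]) (use subgroup.one_closed[OF submodule.axioms(1)[OF W]] in simp)
next
  case (insert k R)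
  then have f: "f k \<in> Cc" "\<pi> (f k) v \<in> W" "sum f R \<in> Cc" "\<pi> (sum f R) v \<in> W" by auto
  show ?case
    unfolding sum.insert[OF insert.hyps] rep_plus[OF f(1,3) assms(2)]
    using Cc_add[OF f(1,3)] submoduleE(5)[OF W f(2,4)] by (rule conjI)
qed

text \<open>Both averages split over the same representatives of K n modulo K l, so the finer
  averages decide. Fine levels are needed because only those are absorbed by a given
  \<open>E h m\<close>.\<close>

lemma E_refine_cong:
  assumes nl: "n \<le> l" and g: "g \<in> carrier G" "g' \<in> carrier G" and u: "u \<in> carrier H" "u' \<in> carrier H"
    and *: "\<And>k. k \<in> K n \<Longrightarrow> E (g \<otimes> k) l u = E (g' \<otimes> k) l u'"
  shows "E g n u = E g' n u'"
proof -
  obtain R where R: "finite R" "R \<subseteq> K n"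
    "\<And>g. g \<in> carrier G \<Longrightarrow> \<delta> g n = (\<Sum>k\<in>R. (\<lambda>x. of_real (w l / w n) * \<delta> (g \<otimes> k) l x))"
    using \<delta>_refine[OF nl] by blast
  show ?thesis
    unfolding R(3)[OF g(1)] R(3)[OF g(2)]
  proof (rule conjunct2[OF conjunct2[OF rep_sum_cong]])
    fix k assume "k \<in> R"
    then have k: "k \<in> K n" "k \<in> carrier G" using R(2) K_carrier by auto
    have "(\<lambda>x. c * \<delta> (g \<otimes> k) l x) \<in> Cc \<and> (\<lambda>x. c * \<delta> (g' \<otimes> k) l x) \<in> Cc \<and>
        \<pi> (\<lambda>x. c * \<delta> (g \<otimes> k) l x) u = \<pi> (\<lambda>x. c * \<delta> (g' \<otimes> k) l x) u'" for c
      using *[OF k(1)] g u k(2) by (simp add: rep_scale \<delta>_Cc Cc_smult)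
    then show "(\<lambda>x. of_real (w l / w n) * \<delta> (g \<otimes> k) l x) \<in> Cc \<and>
        (\<lambda>x. of_real (w l / w n) * \<delta> (g' \<otimes> k) l x) \<in> Cc \<and>
        \<pi> (\<lambda>x. of_real (w l / w n) * \<delta> (g \<otimes> k) l x) u = \<pi> (\<lambda>x. of_real (w l / w n) * \<delta> (g' \<otimes> k) l x) u'" .
  qed (use R(1) u in auto)
qed

text \<open>Step functions of fine level are dense for the L1-norm, the representation is
  contractive for it, and \<open>W\<close> is closed.\<close>

lemma rep_mem:
  assumes W: "submodule W complex_ring H" "hclosure W \<subseteq> W" and v: "v \<in> carrier H"
    and E: "\<And>g n. g \<in> carrier G \<Longrightarrow> n \<ge> n0 \<Longrightarrow> E g n v \<in> W" and f: "f \<in> Cc"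
  shows "\<pi> f v \<in> W"
proof -
  have "\<pi> f v \<in> hclosure W"
    unfolding hclosure_def
  proof (intro CollectI conjI allI impI)
    show fv: "\<pi> f v \<in> carrier H" using f v by (rule Cc_rep_closed)
    fix e :: real assume e: "e > 0"
    then have "e / (hnorm H v + 1) > 0" using v by (simp add: add_nonneg_pos)
    then obtain n R c where R: "n \<ge> n0" "finite R" "R \<subseteq> carrier G"
      "L1 (f - (\<Sum>r\<in>R. (\<lambda>x. c r * \<delta> r n x))) < e / (hnorm H v + 1)"
      using step_dense[OF f] by blast
    define s where "s = (\<Sum>r\<in>R. (\<lambda>x. c r * \<delta> r n x))"
    have "s \<in> Cc \<and> \<pi> s v \<in> W"
      unfolding s_def
    proof (rule rep_sum_mem[OF R(2) v W(1)])
      fix r assume "r \<in> R"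
      then have r: "r \<in> carrier G" using R(3) by blast
      show "(\<lambda>x. c r * \<delta> r n x) \<in> Cc \<and> \<pi> (\<lambda>x. c r * \<delta> r n x) v \<in> W"
        using E[OF r R(1)] submoduleE(4)[OF W(1)] r v by (simp add: Cc_smult \<delta>_Cc rep_scale)
    qed
    then have s: "s \<in> Cc" "\<pi> s v \<in> W" by auto
    have "hnorm H (\<pi> f v \<ominus>\<^bsub>H\<^esub> \<pi> s v) = hnorm H (\<pi> (f - s) v)"
      using rep_diff[OF star_rep_axioms f s(1) v] by simp
    also have "\<dots> \<le> L1 (f - s) * hnorm H v" using f s v by (intro rep_le_L1 Cc_diff)
    also have "\<dots> \<le> L1 (f - s) * (hnorm H v + 1)" using L1_nonneg by (simp add: mult_left_mono)
    also have "\<dots> < e" using R(4) v unfolding s_def by (simp add: pos_less_divide_eq add_nonneg_pos)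
    finally show "\<exists>s\<in>W. hnorm H (\<pi> f v \<ominus>\<^bsub>H\<^esub> s) < e" using s(2) by blast
  qed
  then show ?thesis using W(2) by blast
qed

lemma invariant_trivial:
  assumes W: "submodule W complex_ring H" "hclosure W \<subseteq> W"
    and inv: "\<And>f v. f \<in> Cc \<Longrightarrow> v \<in> W \<Longrightarrow> \<pi> f v \<in> W"
  shows "W = {\<zero>\<^bsub>H\<^esub>} \<or> W = carrier H"
proof -
  have "closedin (htopology H) W" using W submoduleE(1)[OF W(1)] by (simp add: closedin_iff)
  moreover have "\<forall>f\<in>carrier A. \<pi> f ` W \<subseteq> W" using inv by (auto simp: carrier_A)
  ultimately show ?thesis using irreducible W(1) unfolding irreducible_representation_def by blast
qed

text \<open>Schur's lemma for an element \<open>z\<close> that \<open>\<pi>\<close> sees as a central involution: the space of vectors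
  fixed by \<open>z\<close> is invariant, and if it is zero then \<open>v + z v = 0\<close> for all \<open>v\<close>.\<close>

lemma involution_sign:
  assumes z: "z \<in> carrier G"
    and central: "\<And>x y n v. x \<in> carrier G \<Longrightarrow> y \<in> carrier G \<Longrightarrow> v \<in> carrier H \<Longrightarrow>
          E (x \<otimes> z \<otimes> y) n v = E (x \<otimes> y \<otimes> z) n v"
    and involution: "\<And>x n v. x \<in> carrier G \<Longrightarrow> v \<in> carrier H \<Longrightarrow> E (x \<otimes> z \<otimes> z) n v = E x n v"
  shows "(\<forall>x\<in>carrier G. \<forall>n. \<forall>v\<in>carrier H. E (x \<otimes> z) n v = E x n v) \<or>
         (\<forall>x\<in>carrier G. \<forall>n. \<forall>v\<in>carrier H. E (x \<otimes> z) n v = \<ominus>\<^bsub>H\<^esub> E x n v)"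
proof -
  \<comment> \<open>The vectors fixed by \<open>z\<close>, expressed through averages at all levels
    and written as an equaliser over pairs so that closedness comes for free.\<close>
  define W where "W = {v \<in> carrier H. \<forall>i\<in>carrier G \<times> UNIV. E (fst i \<otimes> z) (snd i) v = E (fst i) (snd i) v}"
  have W_iff: "v \<in> W \<longleftrightarrow> v \<in> carrier H \<and> (\<forall>x\<in>carrier G. \<forall>n. E (x \<otimes> z) n v = E x n v)" for v
    by (auto simp: W_def)
  have W: "submodule W complex_ring H" "hclosure W \<subseteq> W"
    unfolding W_def using z
    by (intro equalizer_closed_submodule[where T = "\<lambda>i. E (fst i \<otimes> z) (snd i)"] E_bounded; auto)+
  have "E y m v \<in> W" if y: "y \<in> carrier G" and v: "v \<in> W" for y m v
    unfolding W_iff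
  proof (intro conjI ballI allI)
    have vH: "v \<in> carrier H" using v by (simp add: W_iff)
    then show "E y m v \<in> carrier H" using y by simp
    fix x n assume x: "x \<in> carrier G"
    \<comment> \<open>At level \<open>l\<close> the left average is absorbed by
      \<open>E y m\<close>; then \<open>central\<close> moves \<open>z\<close> to the right end,
      where it meets a vector of \<open>W\<close>.\<close>
    obtain l where l: "n \<le> l" "\<And>k. k \<in> K l \<Longrightarrow> inv y \<otimes> k \<otimes> y \<in> K m"
      using K_conj'[OF y, of n m] by blast
    show "E (x \<otimes> z) n (E y m v) = E x n (E y m v)"
    proof (rule E_refine_cong[OF l(1)])
      fix k assume "k \<in> K n"
      then have k: "k \<in> carrier G" by (rule K_carrier)
      have "E (x \<otimes> z \<otimes> k) l (E y m v) = E (x \<otimes> z \<otimes> (k \<otimes> y)) m v"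
        using x y z k vH l(2) by (simp add: E_absorb_left G_assoc)
      also have "\<dots> = E (x \<otimes> (k \<otimes> y) \<otimes> z) m v" using x y k vH by (intro central) auto
      also have "\<dots> = E (x \<otimes> (k \<otimes> y)) m v" using v x y k by (simp add: W_iff)
      also have "\<dots> = E (x \<otimes> k) l (E y m v)"
        using x y z k vH l(2) by (simp add: E_absorb_left G_assoc)
      finally show "E (x \<otimes> z \<otimes> k) l (E y m v) = E (x \<otimes> k) l (E y m v)" .
    qed (use x y z vH in auto)
  qed
  then have "W = {\<zero>\<^bsub>H\<^esub>} \<or> W = carrier H"
    using rep_mem[OF W] submoduleE(1)[OF W(1)] by (intro invariant_trivial[OF W]) blast
  then show ?thesis
  proof
    assume "W = carrier H"
    then show ?thesis using W_iff by blast
  next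
    assume W0: "W = {\<zero>\<^bsub>H\<^esub>}"
    have "E (x \<otimes> z) n v = \<ominus>\<^bsub>H\<^esub> E x n v" if x: "x \<in> carrier G" and v: "v \<in> carrier H" for x n v
    proof -
      \<comment> \<open>The averaged form of v + z v; since \<open>z\<close> is an involution, it
        only swaps the two summands.\<close>
      define u where "u = E x n v \<oplus>\<^bsub>H\<^esub> E (x \<otimes> z) n v"
      have uH: "u \<in> carrier H" using x z v by (simp add: u_def)
      have "u \<in> W"
        unfolding W_iff
      proof (intro conjI ballI allI uH)
        fix y m assume y: "y \<in> carrier G"
        obtain l1 where l1: "\<And>l. l \<ge> l1 \<Longrightarrow> \<forall>k\<in>K l. inv x \<otimes> k \<otimes> x \<in> K n"
          using K_conj'[OF x] by blast
        obtain l2 where l2: "\<And>l. l \<ge> l2 \<Longrightarrow> \<forall>k\<in>K l. inv (x \<otimes> z) \<otimes> k \<otimes> (x \<otimes> z) \<in> K n"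
          using K_conj'[of "x \<otimes> z"] x z by blast
        define l where "l = max m (max l1 l2)"
        have Eu: "E g l u = E (g \<otimes> x) n v \<oplus>\<^bsub>H\<^esub> E (g \<otimes> x \<otimes> z) n v" if g: "g \<in> carrier G" for g
        proof -
          have "E g l u = E g l (E x n v) \<oplus>\<^bsub>H\<^esub> E g l (E (x \<otimes> z) n v)"
            unfolding u_def using g x z v by (simp add: bounded_operator_add[OF E_bounded])
          also have "E g l (E x n v) = E (g \<otimes> x) n v"
            using g x v l1[of l] by (intro E_absorb_left) (auto simp: l_def)
          also have "E g l (E (x \<otimes> z) n v) = E (g \<otimes> (x \<otimes> z)) n v"
            using g x z v l2[of l] by (intro E_absorb_left) (auto simp: l_def)
          finally show ?thesis using g x z by (simp add: G_assoc)
        qed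
        show "E (y \<otimes> z) m u = E y m u"
        proof (rule E_refine_cong)
          show "m \<le> l" by (simp add: l_def)
          fix k assume "k \<in> K m"
          then have k: "k \<in> carrier G" by (rule K_carrier)
          have 1: "E (y \<otimes> z \<otimes> k \<otimes> x) n v = E (y \<otimes> k \<otimes> x \<otimes> z) n v"
            using central[of y "k \<otimes> x" v n] x y z k v by (simp add: G_assoc)
          have "E (y \<otimes> z \<otimes> k \<otimes> x \<otimes> z) n v = E (y \<otimes> k \<otimes> x \<otimes> z \<otimes> z) n v"
            using central[of y "k \<otimes> x \<otimes> z" v n] x y z k v by (simp add: G_assoc)
          also have "\<dots> = E (y \<otimes> k \<otimes> x) n v" using involution[of "y \<otimes> k \<otimes> x"] x y z k v by simp
          finally have 2: "E (y \<otimes> z \<otimes> k \<otimes> x \<otimes> z) n v = E (y \<otimes> k \<otimes> x) n v" .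
          show "E (y \<otimes> z \<otimes> k) l u = E (y \<otimes> k) l u"
            using x y z k v by (simp add: Eu 1 2 M.a_comm)
        qed (use y z uH in auto)
      qed
      then have "E x n v \<oplus>\<^bsub>H\<^esub> E (x \<otimes> z) n v = \<zero>\<^bsub>H\<^esub>" using W0 by (simp add: u_def)
      then show ?thesis using M.minus_equality[of "E (x \<otimes> z) n v" "E x n v"] x z v by (simp add: M.a_comm)
    qed
    then show ?thesis by blast
  qed
qed

end


section \<open>Groups of Heisenberg type\<close>

text \<open>\<open>Z\<close> plays the role of the centre. By the last assumption, all \<open>g\<close> outside finitely many cosets
  of \<open>K n Z\<close> satisfy \<open>z \<in> [g, K n]\<close>.\<close>

locale heisenberg_type = unimodular_td_group +
  fixes Z :: "'a set"
  assumes Z_carrier: "Z \<subseteq> carrier G"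
    and Z_central: "z \<in> Z \<Longrightarrow> g \<in> carrier G \<Longrightarrow> z \<otimes> g = g \<otimes> z"
    and Z_involution: "z \<in> Z \<Longrightarrow> z \<otimes> z = \<one>"
    and commutator_Z: "g \<in> carrier G \<Longrightarrow> h \<in> carrier G \<Longrightarrow> \<exists>z\<in>Z. g \<otimes> h = h \<otimes> g \<otimes> z"
    and square_Z: "g \<in> carrier G \<Longrightarrow> g \<otimes> g \<in> Z"
    and commutators_cofinite: "z \<in> Z \<Longrightarrow> z \<noteq> \<one> \<Longrightarrow> \<exists>S. finite S \<and> S \<subseteq> carrier G \<and>
          (\<forall>g\<in>carrier G. (\<exists>k\<in>K n. g \<otimes> k = k \<otimes> g \<otimes> z) \<or> (\<exists>s\<in>S. \<exists>y\<in>Z. \<exists>k\<in>K n. g = s \<otimes> k \<otimes> y))"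

locale heisenberg_rep = heisenberg_type G X K M Z + irreducible_td_rep G X K M H \<pi>
  for G :: "('a, 'm) monoid_scheme" (structure) and X :: "'a topology" and K :: "nat \<Rightarrow> 'a set"
    and M :: "'a measure" and Z :: "'a set" and H :: "'h inner_space"
    and \<pi> :: "('a \<Rightarrow> complex) \<Rightarrow> 'h \<Rightarrow> 'h"
begin

lemma Z_sign:
  assumes z: "z \<in> Z"
  shows "(\<forall>x\<in>carrier G. \<forall>n. \<forall>v\<in>carrier H. E (x \<otimes> z) n v = E x n v) \<or>
         (\<forall>x\<in>carrier G. \<forall>n. \<forall>v\<in>carrier H. E (x \<otimes> z) n v = \<ominus>\<^bsub>H\<^esub> E x n v)"
proof (rule involution_sign)
  show zG: "z \<in> carrier G" using z Z_carrier by blast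
  show "E (x \<otimes> z \<otimes> y) n v = E (x \<otimes> y \<otimes> z) n v" if "x \<in> carrier G" "y \<in> carrier G" for x y n v
    using that zG Z_central[OF z] by (simp add: G_assoc)
  show "E (x \<otimes> z \<otimes> z) n v = E x n v" if "x \<in> carrier G" for x n v
    using that zG Z_involution[OF z] by (simp add: G_assoc)
qed

lemma finitely_many_values:
  assumes v: "v \<in> carrier H" and fixed: "E \<one> n v = v"
  shows "\<exists>T. finite T \<and> T \<subseteq> carrier H \<and> (\<forall>g\<in>carrier G. E \<one> n (E g n v) \<in> T)"
proof (cases "\<forall>z\<in>Z. \<forall>x\<in>carrier G. \<forall>n. \<forall>v\<in>carrier H. E (x \<otimes> z) n v = E x n v")
  case True
  have "E \<one> n (E g n v) \<in> {v, \<ominus>\<^bsub>H\<^esub> v}" if g: "g \<in> carrier G" for g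
  proof -
    have "(\<forall>x\<in>carrier G. \<forall>n. \<forall>v\<in>carrier H. E (x \<otimes> g) n v = E x n v) \<or>
         (\<forall>x\<in>carrier G. \<forall>n. \<forall>v\<in>carrier H. E (x \<otimes> g) n v = \<ominus>\<^bsub>H\<^esub> E x n v)"
    proof (rule involution_sign[OF g])
      fix x y n v assume xy: "x \<in> carrier G" "y \<in> carrier G" "v \<in> carrier H"
      obtain z where z: "z \<in> Z" "g \<otimes> y = y \<otimes> g \<otimes> z" using commutator_Z[OF g xy(2)] by blast
      then have "x \<otimes> g \<otimes> y = x \<otimes> y \<otimes> g \<otimes> z" using xy g Z_carrier by (auto simp: G_assoc)
      then show "E (x \<otimes> g \<otimes> y) n v = E (x \<otimes> y \<otimes> g) n v" using True z(1) xy g by simp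
    next
      fix x n v assume "x \<in> carrier G" "v \<in> carrier H"
      then show "E (x \<otimes> g \<otimes> g) n v = E x n v" using True square_Z[OF g] g by (simp add: G_assoc)
    qed
    then have "E (\<one> \<otimes> g) n v = E \<one> n v \<or> E (\<one> \<otimes> g) n v = \<ominus>\<^bsub>H\<^esub> E \<one> n v"
      using v G_one by blast
    then have "E g n v = v \<or> E g n v = \<ominus>\<^bsub>H\<^esub> v" using g fixed by simp
    moreover have "E \<one> n (\<ominus>\<^bsub>H\<^esub> v) = \<ominus>\<^bsub>H\<^esub> v"
    proof -
      have "\<ominus>\<^bsub>H\<^esub> v = (-1) \<odot>\<^bsub>H\<^esub> v" by (rule ip_eqI) (use v in \<open>simp_all add: ip_simps\<close>)
      then show ?thesis using bounded_operator_smult[OF E_bounded[OF G_one] v] fixed by simp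
    qed
    ultimately show ?thesis using fixed by auto
  qed
  then show ?thesis using v by (intro exI[of _ "{v, \<ominus>\<^bsub>H\<^esub> v}"]) auto
next
  case False
  then obtain z where z: "z \<in> Z" "\<not> (\<forall>x\<in>carrier G. \<forall>n. \<forall>v\<in>carrier H. E (x \<otimes> z) n v = E x n v)"
    by blast
  then have neg: "E (x \<otimes> z) n v = \<ominus>\<^bsub>H\<^esub> E x n v" if "x \<in> carrier G" "v \<in> carrier H" for x n v
    using Z_sign[OF z(1)] z(2) that by (elim disjE) simp_all
  have zG: "z \<in> carrier G" using z(1) Z_carrier by blast
  have zne: "z \<noteq> \<one>" using z(2) by auto
  then obtain S where S: "finite S" "S \<subseteq> carrier G"
    "\<And>g. g \<in> carrier G \<Longrightarrow> (\<exists>k\<in>K n. g \<otimes> k = k \<otimes> g \<otimes> z) \<or> (\<exists>s\<in>S. \<exists>y\<in>Z. \<exists>k\<in>K n. g = s \<otimes> k \<otimes> y)"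
    using commutators_cofinite[OF z(1) zne, of n] by metis
  \<comment> \<open>The value 0 comes from the first alternative of
    \<open>commutators_cofinite\<close>. In the second, the central factor contributes a sign,
    whence two values for each element of \<open>S\<close>.\<close>
  define T where "T = insert \<zero>\<^bsub>H\<^esub> ((\<lambda>s. E \<one> n (E s n v)) ` S \<union> (\<lambda>s. E \<one> n (\<ominus>\<^bsub>H\<^esub> E s n v)) ` S)"
  have "E \<one> n (E g n v) \<in> T" if g: "g \<in> carrier G" for g
    using S(3)[OF g]
  proof
    assume "\<exists>k\<in>K n. g \<otimes> k = k \<otimes> g \<otimes> z"
    then obtain k where k: "k \<in> K n" "g \<otimes> k = k \<otimes> g \<otimes> z" by blast
    have kG: "k \<in> carrier G" using k(1) by (rule K_carrier)
    \<comment> \<open>Fine enough that \<open>E (k \<otimes> g) n v\<close> is the average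
      \<open>E k l\<close> of \<open>E g n v\<close>; as \<open>k\<close> lies in
      \<open>K n\<close>, this average is in turn absorbed by \<open>E \<one> n\<close>.\<close>
    obtain l where l: "n \<le> l" "\<And>k. k \<in> K l \<Longrightarrow> inv g \<otimes> k \<otimes> g \<in> K n"
      using K_conj'[OF g, of n n] by blast
    have "E g n v = E (k \<otimes> g \<otimes> z) n v" using E_mult_K[OF g k(1)] k(2) by simp
    also have "\<dots> = \<ominus>\<^bsub>H\<^esub> E (k \<otimes> g) n v" using neg[of "k \<otimes> g"] kG g v by simp
    also have "E (k \<otimes> g) n v = E k l (E g n v)" using E_absorb_left[OF kG g l(2) v] by simp
    finally have gv: "E g n v = \<ominus>\<^bsub>H\<^esub> E k l (E g n v)" .
    define u where "u = E g n v"
    have uH: "u \<in> carrier H" using g v by (simp add: u_def)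
    have ku: "E k l u \<in> carrier H" using kG uH by simp
    have "\<ominus>\<^bsub>H\<^esub> E k l u = (-1) \<odot>\<^bsub>H\<^esub> E k l u"
      by (rule ip_eqI) (use ku in \<open>simp_all add: ip_simps\<close>)
    then have "u = (-1) \<odot>\<^bsub>H\<^esub> E k l u" using gv by (simp add: u_def)
    then have "E \<one> n u = (-1) \<odot>\<^bsub>H\<^esub> E \<one> n (E k l u)"
      using bounded_operator_smult[OF E_bounded[OF G_one] ku, of n "-1"] by simp
    also have "E \<one> n (E k l u) = E \<one> n u" using k(1) l(1) uH by (intro E_absorb_right) auto
    finally have *: "E \<one> n u = (-1) \<odot>\<^bsub>H\<^esub> E \<one> n u" .
    have "hnorm H (E \<one> n u \<oplus>\<^bsub>H\<^esub> E \<one> n u) = 0"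
    proof -
      have "E \<one> n u \<oplus>\<^bsub>H\<^esub> (-1) \<odot>\<^bsub>H\<^esub> E \<one> n u = \<zero>\<^bsub>H\<^esub>"
        using uH diff_eq_add_smult[of "E \<one> n u" "E \<one> n u"] by simp
      then show ?thesis using * by simp
    qed
    moreover have "E \<one> n u \<oplus>\<^bsub>H\<^esub> E \<one> n u = 2 \<odot>\<^bsub>H\<^esub> E \<one> n u"
      by (rule ip_eqI) (use uH in \<open>simp_all add: ip_simps\<close>)
    ultimately have "E \<one> n u = \<zero>\<^bsub>H\<^esub>" using uH by (simp add: hnorm_smult hnorm_eq_0)
    then show ?thesis by (simp add: T_def u_def)
  next
    assume "\<exists>s\<in>S. \<exists>y\<in>Z. \<exists>k\<in>K n. g = s \<otimes> k \<otimes> y"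
    then obtain s y k where s: "s \<in> S" "y \<in> Z" "k \<in> K n" "g = s \<otimes> k \<otimes> y" by blast
    have car: "s \<in> carrier G" "y \<in> carrier G" "k \<in> carrier G"
      using s S(2) Z_carrier K_carrier by auto
    have "E g n v = E (s \<otimes> k) n v \<or> E g n v = \<ominus>\<^bsub>H\<^esub> E (s \<otimes> k) n v"
      unfolding s(4) using Z_sign[OF s(2)] car v by (meson G_closed)
    then show ?thesis
      using E_mult_K[OF car(1) s(3)] s(1) by (auto simp: T_def)
  qed
  moreover have "finite T" "T \<subseteq> carrier H" using S(1,2) v by (auto simp: T_def)
  ultimately show ?thesis by blast
qed

text \<open>If \<open>v\<close> is a nonzero vector fixed by the projection, irreducibility makes
  the vectors \<open>\<pi> f v\<close> dense. The projection sends them into one closed boundedly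
  compact subspace, and therefore all of \<open>H\<close>.\<close>

lemma fixed_space_boundedly_compact:
  "\<exists>V. boundedly_compact V \<and> (\<forall>w\<in>carrier H. E \<one> n w \<in> V)"
proof (cases "\<exists>v\<in>carrier H. v \<noteq> \<zero>\<^bsub>H\<^esub> \<and> E \<one> n v = v")
  case True
  then obtain v where v: "v \<in> carrier H" "v \<noteq> \<zero>\<^bsub>H\<^esub>" "E \<one> n v = v" by blast
  obtain T where T: "finite T" "T \<subseteq> carrier H" "\<And>g. g \<in> carrier G \<Longrightarrow> E \<one> n (E g n v) \<in> T"
    using finitely_many_values[OF v(1,3)] by blast
  obtain V0 where V0: "boundedly_compact V0" "T \<subseteq> V0" using finite_boundedly_compact[OF T(1,2)] by blast
  define V where "V = hclosure V0"
  have V: "boundedly_compact V" unfolding V_def using V0(1) by (rule boundedly_compact_hclosure)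
  then have Vsub: "submodule V complex_ring H" by (simp add: boundedly_compact_def)
  have V0H: "V0 \<subseteq> carrier H" using V0(1) submoduleE(1) by (auto simp: boundedly_compact_def)
  then have Vclosed: "hclosure V \<subseteq> V" unfolding V_def by (rule hclosure_idem)
  have TV: "T \<subseteq> V" using V0(2) subset_hclosure[OF V0H] by (simp add: V_def)
  define W where "W = {w \<in> carrier H. E \<one> n w \<in> V}"
  have W: "submodule W complex_ring H" "hclosure W \<subseteq> W"
    unfolding W_def using submodule_preimage[OF E_bounded[OF G_one] Vsub]
      hclosure_preimage[OF E_bounded[OF G_one] submoduleE(1)[OF Vsub] Vclosed] by auto
  have rep_W: "\<pi> f v \<in> W" if f: "f \<in> Cc" for f
  proof (rule rep_mem[OF W v(1) _ f])
    fix g l assume gl: "g \<in> carrier G" "l \<ge> n"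
    \<comment> \<open>\<open>v\<close> is already averaged at level \<open>n\<close>, so its finer
      averages agree with those of level \<open>n\<close>, where the finitely many values are
      known.\<close>
    have "E g l v = E g l (E \<one> n v)" using v(3) by simp
    also have "\<dots> = E (g \<otimes> \<one>) n v"
      using gl v(1) K_decreasing[OF gl(2)] K_carrier by (intro E_absorb_left) auto
    finally have "E g l v = E g n v" using gl(1) by simp
    then show "E g l v \<in> W" using T(3)[OF gl(1)] TV gl(1) v(1) by (auto simp: W_def)
  qed
  define Y0 where "Y0 = (\<lambda>f. \<pi> f v) ` Cc"
  have Y0: "submodule Y0 complex_ring H"
  proof (rule submoduleI')
    show "Y0 \<subseteq> carrier H" using v(1) by (auto simp: Y0_def Cc_rep_closed)
    show "\<zero>\<^bsub>H\<^esub> \<in> Y0" using rep_0[OF v(1)] Cc_zero unfolding Y0_def by (metis image_eqI)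
    show "a \<oplus>\<^bsub>H\<^esub> b \<in> Y0" if ab: "a \<in> Y0" "b \<in> Y0" for a b
    proof -
      obtain f h where fh: "f \<in> Cc" "h \<in> Cc" "a = \<pi> f v" "b = \<pi> h v" using ab by (auto simp: Y0_def)
      then have "a \<oplus>\<^bsub>H\<^esub> b = \<pi> (f + h) v" using v(1) by (simp add: rep_plus)
      then show ?thesis using Cc_add[OF fh(1,2)] by (simp add: Y0_def)
    qed
    show "c \<odot>\<^bsub>H\<^esub> a \<in> Y0" if a: "a \<in> Y0" for c a
    proof -
      obtain f where f: "f \<in> Cc" "a = \<pi> f v" using a by (auto simp: Y0_def)
      then have "c \<odot>\<^bsub>H\<^esub> a = \<pi> (\<lambda>x. c * f x) v" using v(1) by (simp add: rep_scale)
      then show ?thesis using Cc_smult[OF f(1)] by (simp add: Y0_def)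
    qed
  qed
  define Y where "Y = hclosure Y0"
  have Y0H: "Y0 \<subseteq> carrier H" using Y0 by (rule submoduleE(1))
  have Y: "submodule Y complex_ring H" "hclosure Y \<subseteq> Y"
    unfolding Y_def using submodule_hclosure[OF Y0] hclosure_idem[OF Y0H] by auto
  have "\<pi> f y \<in> Y" if f: "f \<in> Cc" and y: "y \<in> Y" for f y
  proof -
    have "Y0 \<subseteq> {u \<in> carrier H. \<pi> f u \<in> Y}"
    proof
      fix u assume "u \<in> Y0"
      then obtain h where h: "h \<in> Cc" "u = \<pi> h v" by (auto simp: Y0_def)
      have "\<pi> f u = \<pi> (conv f h) v" using rep_mult[of f h v] f h v(1) by (simp add: carrier_A mult_A)
      then have "\<pi> f u \<in> Y0" using conv_Cc[OF f h(1)] by (simp add: Y0_def)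
      then show "u \<in> {u \<in> carrier H. \<pi> f u \<in> Y}"
        using subset_hclosure[OF Y0H] \<open>u \<in> Y0\<close> Y0H by (auto simp: Y_def)
    qed
    then have "Y \<subseteq> hclosure {u \<in> carrier H. \<pi> f u \<in> Y}" unfolding Y_def by (rule hclosure_mono)
    also have "\<dots> \<subseteq> {u \<in> carrier H. \<pi> f u \<in> Y}"
      using rep_bounded[of f] f submoduleE(1)[OF Y(1)] Y(2) by (intro hclosure_preimage) (auto simp: carrier_A)
    finally show ?thesis using y by blast
  qed
  then have "Y = {\<zero>\<^bsub>H\<^esub>} \<or> Y = carrier H" by (rule invariant_trivial[OF Y])
  moreover have "v \<in> Y"
    using v(3) subset_hclosure[OF Y0H] \<delta>_Cc[OF G_one, of n] unfolding Y_def Y0_def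
    by (metis image_eqI subsetD)
  ultimately have YH: "Y = carrier H" using v(2) by blast
  have "Y0 \<subseteq> W" using rep_W by (auto simp: Y0_def)
  then have "carrier H \<subseteq> W" using hclosure_mono[of Y0 W] W(2) YH by (simp add: Y_def)
  then show ?thesis using V by (auto simp: W_def)
next
  case False
  \<comment> \<open>Every value of the idempotent \<open>E \<one> n\<close> is fixed by it, and here
    no nonzero vector is.\<close>
  have "E \<one> n w = \<zero>\<^bsub>H\<^esub>" if w: "w \<in> carrier H" for w
  proof -
    have "E \<one> n (E \<one> n w) = E \<one> n w" using w K_one by (intro E_absorb_right) auto
    then show ?thesis using False w by auto
  qed
  moreover obtain V where "boundedly_compact V" "{\<zero>\<^bsub>H\<^esub>} \<subseteq> V"
    using finite_boundedly_compact[of "{\<zero>\<^bsub>H\<^esub>}"] by auto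
  ultimately show ?thesis by auto
qed

text \<open>A step function on finitely many cosets is unchanged by left averaging over a
  sufficiently small \<open>K m\<close>, so its operator maps into the boundedly compact subspace
  found for \<open>E \<one> m\<close>. Operators of general \<open>f\<close> are norm limits of such
  operators.\<close>

lemma rep_compact:
  assumes f: "f \<in> Cc"
  shows "compact_operator H (\<pi> f)"
proof (rule compact_operatorI)
  show bf: "bounded_operator H (\<pi> f)" using f by (intro rep_bounded) (simp add: carrier_A)
  show "totally_bounded (\<pi> f ` {v \<in> carrier H. hnorm H v \<le> 1})"
  proof (rule totally_bounded_approx)
    show "\<pi> f ` {v \<in> carrier H. hnorm H v \<le> 1} \<subseteq> carrier H" using f by (auto simp: Cc_rep_closed)
    fix e :: real assume e: "e > 0"
    obtain n R c where R: "n \<ge> 0" "finite R" "R \<subseteq> carrier G"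
      "L1 (f - (\<Sum>r\<in>R. (\<lambda>x. c r * \<delta> r n x))) < e"
      using step_dense[OF f e] by blast
    define s where "s = (\<Sum>r\<in>R. (\<lambda>x. c r * \<delta> r n x))"
    have "\<forall>r\<in>R. \<exists>m. \<forall>k\<in>K m. inv r \<otimes> k \<otimes> r \<in> K n" using K_conj R(3) by blast
    then obtain m0 where m0: "\<And>r k. r \<in> R \<Longrightarrow> k \<in> K (m0 r) \<Longrightarrow> inv r \<otimes> k \<otimes> r \<in> K n" by metis
    \<comment> \<open>One level deep enough for the conjugations by all the finitely many
      representatives.\<close>
    define m where "m = Max (insert 0 (m0 ` R))"
    have m: "K m \<subseteq> K (m0 r)" if "r \<in> R" for r
      unfolding m_def using that R(2) by (intro K_decreasing Max_ge) auto
    obtain V where V: "boundedly_compact V" "\<And>w. w \<in> carrier H \<Longrightarrow> E \<one> m w \<in> V"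
      using fixed_space_boundedly_compact[of m] by blast
    have Vsub: "submodule V complex_ring H" using V(1) by (simp add: boundedly_compact_def)
    have sV: "s \<in> Cc \<and> \<pi> s v \<in> V" if v: "v \<in> carrier H" for v
      unfolding s_def
    proof (rule rep_sum_mem[OF R(2) v Vsub])
      fix r assume r: "r \<in> R"
      then have rG: "r \<in> carrier G" using R(3) by blast
      have "E \<one> m (E r n v) = E (\<one> \<otimes> r) n v"
        using rG v m0[OF r] m[OF r] by (intro E_absorb_left) auto
      then have "E r n v \<in> V" using V(2)[of "E r n v"] rG v by simp
      then show "(\<lambda>x. c r * \<delta> r n x) \<in> Cc \<and> \<pi> (\<lambda>x. c r * \<delta> r n x) v \<in> V"
        using submoduleE(4)[OF Vsub] rG v by (simp add: Cc_smult \<delta>_Cc rep_scale)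
    qed
    have s: "s \<in> Cc" using sV[OF M.zero_closed] by blast
    define B where "B = {v \<in> V. hnorm H v \<le> L1 s}"
    have "\<exists>y\<in>B. hnorm H (\<pi> f v \<ominus>\<^bsub>H\<^esub> y) < e" if v: "v \<in> carrier H" "hnorm H v \<le> 1" for v
    proof
      have "hnorm H (\<pi> s v) \<le> L1 s * hnorm H v" using s v(1) by (rule rep_le_L1)
      also have "\<dots> \<le> L1 s * 1" using v(2) L1_nonneg by (intro mult_left_mono)
      finally show "\<pi> s v \<in> B" using sV[OF v(1)] by (simp add: B_def)
      have "hnorm H (\<pi> f v \<ominus>\<^bsub>H\<^esub> \<pi> s v) = hnorm H (\<pi> (f - s) v)"
        using rep_diff[OF star_rep_axioms f s v(1)] by simp
      also have "\<dots> \<le> L1 (f - s) * hnorm H v" using f s v(1) by (intro rep_le_L1 Cc_diff)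
      also have "\<dots> \<le> L1 (f - s) * 1" using v(2) L1_nonneg by (intro mult_left_mono)
      finally show "hnorm H (\<pi> f v \<ominus>\<^bsub>H\<^esub> \<pi> s v) < e" using R(4) by (simp add: s_def)
    qed
    moreover have "totally_bounded B" unfolding B_def using V(1) by (simp add: boundedly_compact_def)
    ultimately show "\<exists>S. totally_bounded S \<and>
        (\<forall>x\<in>\<pi> f ` {v \<in> carrier H. hnorm H v \<le> 1}. \<exists>y\<in>S. hnorm H (x \<ominus>\<^bsub>H\<^esub> y) < e)"
      by auto
  qed
qed

end

theorem (in heisenberg_type) CCR: "CCR_group G X"
  unfolding CCR_group_def
proof (intro exI conjI)
  show "haar_measure G X M" by (rule haar)
  show "CCR_algebra (group_Cstar_algebra G X M)"
    unfolding group_Cstar_algebra_def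
  proof (rule seminormed_star_algebra.CCR_completion[OF seminormed_star_algebra_A])
    fix H :: "((nat \<Rightarrow> 'a \<Rightarrow> complex) set \<Rightarrow> complex) inner_space" and \<pi> f
    assume irr: "irreducible_representation A H \<pi>"
      and bound: "\<And>f v. f \<in> carrier A \<Longrightarrow> v \<in> carrier H \<Longrightarrow> hnorm H (\<pi> f v) \<le> p f * hnorm H v"
      and f: "f \<in> carrier A"
    interpret star_rep A H \<pi>
      by unfold_locales (use irr in \<open>simp add: irreducible_representation_def\<close>)
    interpret heisenberg_rep G X K M Z H \<pi>
    proof unfold_locales
      show "irreducible_representation A H \<pi>" by (rule irr)
      fix f v assume fv: "f \<in> Cc" "v \<in> carrier H"
      have "p f * hnorm H v \<le> L1 f * hnorm H v" using fv by (intro mult_right_mono p_le_L1) auto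
      then show "hnorm H (\<pi> f v) \<le> L1 f * hnorm H v"
        using bound[of f v] fv by (simp add: carrier_A)
    qed
    show "compact_operator H (\<pi> f)" using f by (intro rep_compact) (simp add: carrier_A)
  qed
qed


section \<open>Regularity of measures\<close>

lemma sums_half: "(\<Sum>i. ennreal (e * (1/2) ^ Suc i)) = ennreal e" if "e \<ge> 0" for e :: real
  by (rule suminf_ennreal_eq) (use that sums_mult[OF power_half_series, of e] in auto)

lemma emeasure_UN_le:
  assumes "\<And>i. A i \<in> sets M" "\<And>i. emeasure M (A i) \<le> ennreal (e * (1/2) ^ Suc i)" "e \<ge> 0"
  shows "emeasure M (\<Union>i. A i) \<le> ennreal e"
proof -
  have "emeasure M (\<Union>i. A i) \<le> (\<Sum>i. emeasure M (A i))"
    using assms(1) by (intro emeasure_subadditive_countably) auto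
  also have "\<dots> \<le> (\<Sum>i. ennreal (e * (1/2) ^ Suc i))"
    using assms(2) by (intro suminf_le) auto
  finally show ?thesis using sums_half[OF assms(3)] by simp
qed

text \<open>For a finite measure generated by clopen sets: the sets that can be approximated by open sets
  from outside, together with their complements, form a \<open>\<sigma>\<close>-algebra.\<close>

lemma open_approximation:
  assumes sp: "space M = topspace X" and sets: "sets M = sigma_sets (topspace X) B"
    and B: "\<And>b. b \<in> B \<Longrightarrow> openin X b \<and> openin X (topspace X - b)"
    and opens: "\<And>U. openin X U \<Longrightarrow> U \<in> sets M"
    and D: "openin X D" "emeasure M D < \<infinity>"
    and E: "E \<in> sigma_sets (topspace X) B"
  defines "P \<equiv> \<lambda>E (e::real). \<exists>U. openin X U \<and> E \<inter> D \<subseteq> U \<and> U \<subseteq> D \<and> emeasure M (U - E) \<le> ennreal e"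
  shows "\<forall>e>0. P E e \<and> P (topspace X - E) e"
  using E
proof (induction rule: sigma_sets.induct)
  have DX: "D \<subseteq> topspace X" using D(1) by (rule openin_subset)
  {
    case (Basic b)
    then have b: "openin X b" "openin X (topspace X - b)" using B by auto
    have "P b e" if "e > 0" for e
    proof -
      have "b \<inter> D - b = {}" by auto
      then have "emeasure M (b \<inter> D - b) = 0" by (simp only: emeasure_empty)
      then show ?thesis
        unfolding P_def by (intro exI[of _ "b \<inter> D"]) (use b D in auto)
    qed
    moreover have "P (topspace X - b) e" if "e > 0" for e
    proof -
      have "(topspace X - b) \<inter> D - (topspace X - b) = {}" by auto
      then have "emeasure M ((topspace X - b) \<inter> D - (topspace X - b)) = 0"
        by (simp only: emeasure_empty)
      then show ?thesis
        unfolding P_def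
        by (intro exI[of _ "(topspace X - b) \<inter> D"]) (use b D in auto)
    qed
    ultimately show ?case by blast
  next
    case Empty
    have "D - (topspace X - {}) = {}" using DX by auto
    then have "emeasure M (D - (topspace X - {})) = 0" by (simp only: emeasure_empty)
    then have "P (topspace X - {}) e" for e
      unfolding P_def by (intro exI[of _ D]) (use D in auto)
    moreover have "P {} e" for e
      unfolding P_def by (intro exI[of _ "{}"]) simp
    ultimately show ?case by blast
  next
    case (Compl a)
    have "a \<subseteq> topspace X"
      using Compl.hyps sets sets.sets_into_space[of a M] sp by auto
    then have "topspace X - (topspace X - a) = a" by auto
    then show ?case using Compl.IH by simp
  next
    case (Union a)
    have a_sets: "a i \<in> sets M" for i using Union.hyps sets by simp
    have a_sub: "a i \<subseteq> topspace X" for i using sets.sets_into_space[OF a_sets] sp by simp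
    show ?case
    proof (intro allI impI conjI)
      fix e :: real assume e: "e > 0"
      have "\<exists>U. openin X U \<and> a i \<inter> D \<subseteq> U \<and> U \<subseteq> D \<and> emeasure M (U - a i) \<le> ennreal (e * (1/2) ^ Suc i)" for i
        using Union.IH[of i] e unfolding P_def by simp
      then obtain U where U: "\<And>i. openin X (U i)" "\<And>i. a i \<inter> D \<subseteq> U i" "\<And>i. U i \<subseteq> D"
        "\<And>i. emeasure M (U i - a i) \<le> ennreal (e * (1/2) ^ Suc i)" by metis
      have "emeasure M ((\<Union>i. U i) - (\<Union>i. a i)) \<le> emeasure M (\<Union>i. U i - a i)"
        using U(1) a_sets opens by (intro emeasure_mono) auto
      also have "\<dots> \<le> ennreal e"
        using U a_sets opens e by (intro emeasure_UN_le) auto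
      finally have "emeasure M ((\<Union>i. U i) - (\<Union>i. a i)) \<le> ennreal e" .
      moreover have "(\<Union>i. a i) \<inter> D \<subseteq> (\<Union>i. U i)" "(\<Union>i. U i) \<subseteq> D" "openin X (\<Union>i. U i)"
        using U(1-3) by blast+
      ultimately show "P (\<Union>i. a i) e"
        unfolding P_def by blast
    next
      fix e :: real assume e: "e > 0"
      \<comment> \<open>Only finitely many open sets may be intersected to cover the complement of a
        union. The part of the union in \<open>D\<close> missed by its first \<open>n\<close>
        members decreases to the empty set, and the finite measure of \<open>D\<close> makes it
        small.\<close>
      define F where "F n = D \<inter> (\<Union>i. a i) - (\<Union>i<n. a i)" for n :: nat
      have F_sets: "F n \<in> sets M" for n
        unfolding F_def using a_sets opens[OF D(1)] by auto
      have "(\<lambda>n. emeasure M (F n)) \<longlonglongrightarrow> emeasure M (\<Inter>n. F n)"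
      proof (rule Lim_emeasure_decseq)
        show "decseq F" unfolding F_def decseq_def by force
        fix n
        have "emeasure M (F n) \<le> emeasure M D"
          using opens[OF D(1)] by (intro emeasure_mono) (auto simp: F_def)
        then show "emeasure M (F n) \<noteq> \<infinity>" using D(2) by (auto simp: top_unique)
      qed (use F_sets in auto)
      also have "(\<Inter>n. F n) = {}" unfolding F_def by auto
      finally have "(\<lambda>n. emeasure M (F n)) \<longlonglongrightarrow> 0" by simp
      then have "\<forall>\<^sub>F n in sequentially. emeasure M (F n) < ennreal (e/2)"
        using e by (intro order_tendstoD(2)) auto
      then obtain N where N: "emeasure M (F N) < ennreal (e/2)"
        unfolding eventually_sequentially by blast
      have "\<exists>V. openin X V \<and> (topspace X - a i) \<inter> D \<subseteq> V \<and> V \<subseteq> D \<and>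
          emeasure M (V - (topspace X - a i)) \<le> ennreal (e/2 * (1/2) ^ Suc i)" for i
        using Union.IH[of i] e unfolding P_def by simp
      then obtain V where V: "\<And>i. openin X (V i)" "\<And>i. (topspace X - a i) \<inter> D \<subseteq> V i" "\<And>i. V i \<subseteq> D"
        "\<And>i. emeasure M (V i - (topspace X - a i)) \<le> ennreal (e/2 * (1/2) ^ Suc i)" by metis
      define U where "U = D \<inter> ((\<Inter>i\<in>{..<N}. V i) \<inter> topspace X)"
      have U: "openin X U"
        unfolding U_def using V(1) D(1) by (intro openin_Int openin_INT) auto
      have sub: "U - (topspace X - (\<Union>i. a i)) \<subseteq> F N \<union> (\<Union>i. V i - (topspace X - a i))"
        unfolding U_def F_def by auto
      have V_sets: "V i - (topspace X - a i) \<in> sets M" for i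
        using V(1) opens a_sets sp by (auto simp: sp[symmetric])
      have "emeasure M (U - (topspace X - (\<Union>i. a i)))
          \<le> emeasure M (F N \<union> (\<Union>i. V i - (topspace X - a i)))"
        using F_sets V_sets by (intro emeasure_mono[OF sub]) auto
      also have "\<dots> \<le> emeasure M (F N) + emeasure M (\<Union>i. V i - (topspace X - a i))"
        using F_sets V_sets by (intro emeasure_subadditive) auto
      also have "\<dots> \<le> ennreal (e/2) + ennreal (e/2)"
        using N V(4) V_sets e by (intro add_mono emeasure_UN_le) auto
      also have "\<dots> = ennreal e" using e by (simp flip: ennreal_plus)
      finally have "emeasure M (U - (topspace X - (\<Union>i. a i))) \<le> ennreal e" .
      moreover have "(topspace X - (\<Union>i. a i)) \<inter> D \<subseteq> U"
        unfolding U_def using V(2) by blast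
      ultimately show "P (topspace X - (\<Union>i. a i)) e"
        unfolding P_def using U by (intro exI[of _ U]) (auto simp: U_def)
    qed
  }
qed

text \<open>The set is approximated inside each member of a countable cover of finite measure, with
  errors e/2^(i+1), and the open sets are united.\<close>

lemma outer_regular_clopen:
  assumes sp: "space M = topspace X" and sets: "sets M = sigma_sets (topspace X) B"
    and B: "\<And>b. b \<in> B \<Longrightarrow> openin X b \<and> openin X (topspace X - b)"
    and opens: "\<And>U. openin X U \<Longrightarrow> U \<in> sets M"
    and C: "countable C" "\<Union>C = topspace X" "\<And>D. D \<in> C \<Longrightarrow> openin X D \<and> emeasure M D < \<infinity>"
    and E: "E \<in> sets M"
  shows "emeasure M E = (INF U\<in>{U. openin X U \<and> E \<subseteq> U}. emeasure M U)"
proof (rule antisym)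
  show "emeasure M E \<le> (INF U\<in>{U. openin X U \<and> E \<subseteq> U}. emeasure M U)"
    by (rule INF_greatest) (auto intro!: emeasure_mono opens)
  have EX: "E \<subseteq> topspace X" using sets.sets_into_space[OF E] sp by simp
  show "(INF U\<in>{U. openin X U \<and> E \<subseteq> U}. emeasure M U) \<le> emeasure M E"
  proof (rule ennreal_le_epsilon)
    fix e :: real assume e: "e > 0"
    \<comment> \<open>Adjoining the empty set makes the family nonempty, so that it is the range of
      an enumeration.\<close>
    define D where "D = from_nat_into (insert {} C)"
    have rD: "range D = insert {} C" unfolding D_def using C(1) by (intro range_from_nat_into) auto
    have D: "openin X (D i)" "emeasure M (D i) < \<infinity>" for i
      using C(3) rD rangeI[of D i] by auto
    have UD: "(\<Union>i. D i) = topspace X" using rD C(2) by simp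
    have "\<exists>U. openin X U \<and> E \<inter> D i \<subseteq> U \<and> U \<subseteq> D i \<and> emeasure M (U - E) \<le> ennreal (e * (1/2) ^ Suc i)" for i
    proof -
      have "e * (1/2) ^ Suc i > 0" using e by simp
      then show ?thesis
        using open_approximation[OF sp sets B opens D(1,2), of E i] E sets by auto
    qed
    then obtain U where U: "\<And>i. openin X (U i)" "\<And>i. E \<inter> D i \<subseteq> U i"
      "\<And>i. emeasure M (U i - E) \<le> ennreal (e * (1/2) ^ Suc i)" by metis
    let ?U = "\<Union>i. U i"
    have oU: "openin X ?U" using U(1) by auto
    have EU: "E \<subseteq> ?U"
    proof
      fix x assume x: "x \<in> E"
      then obtain i where "x \<in> D i" using EX UD by blast
      then show "x \<in> ?U" using U(2)[of i] x by blast
    qed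
    have "(INF U\<in>{U. openin X U \<and> E \<subseteq> U}. emeasure M U) \<le> emeasure M ?U"
      using oU EU by (intro INF_lower) auto
    also have "?U = E \<union> (\<Union>i. U i - E)" using EU by auto
    also have "emeasure M \<dots> \<le> emeasure M E + emeasure M (\<Union>i. U i - E)"
      using E U(1) opens by (intro emeasure_subadditive) auto
    also have "\<dots> \<le> emeasure M E + ennreal e"
      using E U opens e by (intro add_left_mono emeasure_UN_le) auto
    finally show "(INF U\<in>{U. openin X U \<and> E \<subseteq> U}. emeasure M U) \<le> emeasure M E + ennreal e" .
  qed
qed

text \<open>Finite unions of the compact open pieces are compact and increase to
  \<open>U\<close>.\<close>

lemma inner_regular_open_countable:
  assumes U: "openin X U" and opens: "\<And>U. openin X U \<Longrightarrow> U \<in> sets M"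
    and C: "countable C" "\<Union>C = U" "\<And>c. c \<in> C \<Longrightarrow> openin X c \<and> compactin X c"
  shows "emeasure M U = (SUP K\<in>{K. compactin X K \<and> K \<subseteq> U}. emeasure M K)"
proof (rule antisym)
  show "(SUP K\<in>{K. compactin X K \<and> K \<subseteq> U}. emeasure M K) \<le> emeasure M U"
    by (rule SUP_least) (auto intro!: emeasure_mono opens U)
  define D where "D = from_nat_into (insert {} C)"
  have rD: "range D = insert {} C" unfolding D_def using C(1) by (intro range_from_nat_into) auto
  have D: "openin X (D i) \<and> compactin X (D i)" for i
    using C(3) rD rangeI[of D i] by auto
  have UD: "(\<Union>i. D i) = U" using rD C(2) by simp
  define A where "A n = (\<Union>i<n. D i)" for n
  have A: "openin X (A n)" "compactin X (A n)" "A n \<subseteq> U" for n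
    unfolding A_def using D UD by (auto intro!: compactin_Union)
  have "(\<Union>n. A n) = U" unfolding A_def UD[symmetric] by blast
  moreover have "(SUP n. emeasure M (A n)) = emeasure M (\<Union>n. A n)"
  proof (rule SUP_emeasure_incseq)
    show "incseq A" unfolding incseq_def A_def by (intro allI impI UN_mono) auto
  qed (use A opens in auto)
  ultimately have "emeasure M U = (SUP n. emeasure M (A n))" by simp
  also have "\<dots> \<le> (SUP K\<in>{K. compactin X K \<and> K \<subseteq> U}. emeasure M K)"
    by (rule SUP_least) (use A in \<open>auto intro!: SUP_upper\<close>)
  finally show "emeasure M U \<le> (SUP K\<in>{K. compactin X K \<and> K \<subseteq> U}. emeasure M K)" .
qed


section \<open>Laurent series over the field with two elements\<close>

text \<open>The fractional ideal t^n F_2[[t]]; these ideals are the balls around 0.\<close>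

definition fball :: "int \<Rightarrow> bit fls set" where
  "fball n = {a. \<forall>i<n. fls_nth a i = 0}"

lemma fball_zero [simp]: "0 \<in> fball n" by (simp add: fball_def)
lemma fball_add: "a \<in> fball n \<Longrightarrow> b \<in> fball n \<Longrightarrow> a + b \<in> fball n" by (simp add: fball_def)
lemma fball_diff: "a \<in> fball n \<Longrightarrow> b \<in> fball n \<Longrightarrow> a - b \<in> fball n"
  unfolding fball_def by simp
lemma fball_add_iff: "d \<in> fball n \<Longrightarrow> a + d \<in> fball n \<longleftrightarrow> a \<in> fball n"
  using fball_add[of a n d] fball_diff[of "a + d" n d] by auto
lemma fball_mono: "m \<le> n \<Longrightarrow> a \<in> fball n \<Longrightarrow> a \<in> fball m" by (simp add: fball_def)

lemma fball_subdegree: "a \<in> fball n \<longleftrightarrow> a = 0 \<or> n \<le> fls_subdegree a"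
proof
  assume "a \<in> fball n"
  then show "a = 0 \<or> n \<le> fls_subdegree a" by (auto simp: fball_def intro: fls_subdegree_geI)
qed (auto simp: fball_def)

lemma fball_mult: "a \<in> fball m \<Longrightarrow> b \<in> fball n \<Longrightarrow> a * b \<in> fball (m + n)"
  unfolding fball_subdegree by (cases "a = 0 \<or> b = 0") auto

lemma fball_mult': "a \<in> fball m \<Longrightarrow> b \<in> fball n \<Longrightarrow> l \<le> m + n \<Longrightarrow> a * b \<in> fball l"
  using fball_mult fball_mono by blast

lemma fball_ex: "\<exists>s::nat. a \<in> fball (- int s)"
proof
  show "a \<in> fball (- int (nat (- fls_subdegree a)))"
    by (cases "a = 0") (auto simp: fball_subdegree)
qed

lemma fball_eq_0: "(\<And>n::nat. a \<in> fball (int n)) \<Longrightarrow> a = 0"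
proof (rule fls_eqI)
  fix i assume "\<And>n::nat. a \<in> fball (int n)"
  then have "a \<in> fball (int (nat (i + 1)))" by blast
  then show "fls_nth a i = fls_nth 0 i" by (simp add: fball_def)
qed

lemma fball_eq_iff: "a - b \<in> fball n \<longleftrightarrow> (\<forall>i<n. fls_nth a i = fls_nth b i)"
  unfolding fball_def by (simp del: minus_bit_def add: eq_iff_diff_eq_0[symmetric])

lemma fball_cong: "a - b \<in> fball n \<Longrightarrow> a - c \<in> fball n \<longleftrightarrow> b - c \<in> fball n"
  unfolding fball_eq_iff by auto

lemma bit_fls_add_self [simp]: "(a :: bit fls) + a = 0"
proof (rule fls_eqI)
  fix i
  show "fls_nth (a + a) i = fls_nth 0 i" by (cases "fls_nth a i") simp_all
qed

lemma bit_fls_uminus [simp]: "- (a :: bit fls) = a"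
  using bit_fls_add_self[of a] by (simp add: neg_eq_iff_add_eq_0)

lemma bit_fls_diff: "a - b = a + (b :: bit fls)"
  using bit_fls_uminus[of b] by (metis diff_conv_add_uminus)

text \<open>Each increase of \<open>n\<close> by 1 splits every ball into two, whose centres differ
  by t^n.\<close>

lemma fball_finite_cover: "\<exists>R. finite R \<and> (\<forall>a\<in>fball m. \<exists>r\<in>R. a - r \<in> fball n)"
proof (cases "m \<le> n")
  case True
  then show ?thesis
  proof (induction n rule: int_ge_induct)
    case base
    show ?case by (rule exI[of _ "{0}"]) auto
  next
    case (step n)
    then obtain R where R: "finite R" "\<And>a. a \<in> fball m \<Longrightarrow> \<exists>r\<in>R. a - r \<in> fball n" by blast
    let ?x = "fls_X_intpow n :: bit fls"
    have "\<exists>r \<in> R \<union> (\<lambda>r. r + ?x) ` R. a - r \<in> fball (n + 1)" if a: "a \<in> fball m" for a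
    proof -
      obtain r where r: "r \<in> R" "a - r \<in> fball n" using R(2)[OF a] by blast
      have less: "i < n + 1 \<longleftrightarrow> i < n \<or> i = n" for i by auto
      show ?thesis
      proof (cases "fls_nth (a - r) n = 0")
        case True
        then have "a - r \<in> fball (n + 1)" using r(2) unfolding fball_def less by blast
        then show ?thesis using r(1) by blast
      next
        case False
        then have "fls_nth (a - r) n = 1" by simp
        then have "(a - r) - ?x \<in> fball (n + 1)" using r(2) unfolding fball_def less by auto
        then show ?thesis using r(1) by (auto simp: algebra_simps)
      qed
    qed
    then show ?case using R(1) by (intro exI[of _ "R \<union> (\<lambda>r. r + ?x) ` R"]) auto
  qed
next
  case False
  then show ?thesis using fball_mono[of n m] by (intro exI[of _ "{0}"]) auto
qed

subsection \<open>Binary digits\<close>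

definition bfloor :: "int \<Rightarrow> real \<Rightarrow> int" where "bfloor n x = \<lfloor>2 powi n * x\<rfloor>"

text \<open>The coefficient of \<open>t\<^sup>i\<close> is the binary digit of weight \<open>2\<^sup>-\<^sup>i\<^sup>-\<^sup>1\<close>.\<close>

definition digits :: "real \<Rightarrow> bit fls" where
  "digits x = Abs_fls (\<lambda>i. if odd (bfloor (i + 1) x) then 1 else 0)"

lemma bfloor_div: "bfloor n x = bfloor (n + 1) x div 2"
proof -
  have "2 powi n * x = (2 powi (n + 1) * x) / real_of_int 2"
    by (simp add: power_int_add)
  then show ?thesis unfolding bfloor_def by (simp only: floor_divide_real_eq_div)
qed

lemma bfloor_eventually_0:
  assumes "x \<ge> 0"
  shows "\<exists>N. \<forall>n\<le>N. bfloor n x = 0"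
proof -
  obtain m :: nat where m: "x < 2 ^ m" using real_arch_pow[of 2 x] by auto
  have "bfloor n x = 0" if n: "n \<le> - int m" for n
  proof -
    have "2 powi n * x \<le> 2 powi (- int m) * x"
      using n assms by (intro mult_right_mono power_int_increasing) auto
    also have "\<dots> < 1" using m by (simp add: power_int_minus divide_simps)
    finally show ?thesis unfolding bfloor_def using assms by (simp add: floor_eq_iff)
  qed
  then show ?thesis by blast
qed

lemma digits_nth:
  assumes "x \<ge> 0"
  shows "fls_nth (digits x) i = (if odd (bfloor (i + 1) x) then 1 else 0)"
proof -
  obtain N where N: "\<And>n. n \<le> N \<Longrightarrow> bfloor n x = 0" using bfloor_eventually_0[OF assms] by blast
  have "\<exists>N. \<forall>n<N. (if odd (bfloor (n + 1) x) then 1 else (0::bit)) = 0"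
    using N by (intro exI[of _ N]) auto
  then show ?thesis unfolding digits_def by (rule nth_Abs_fls_ex_lower_bound)
qed

text \<open>\<open>bfloor n x\<close> is the integer whose binary digits are the coefficients of
  index below \<open>n\<close>. Halving it drops the last digit; conversely it is rebuilt digit by
  digit, starting from a level at which both floors vanish.\<close>

lemma digits_cong_iff:
  assumes x: "x \<ge> 0" and y: "y \<ge> 0"
  shows "digits x - digits y \<in> fball n \<longleftrightarrow> bfloor n x = bfloor n y"
proof
  assume eq: "bfloor n x = bfloor n y"
  have "bfloor i x = bfloor i y" if "i \<le> n" for i
    using that
  proof (induction i rule: int_le_induct)
    case (step i)
    then show ?case using bfloor_div[of "i - 1" x] bfloor_div[of "i - 1" y] by simp
  qed (rule eq)
  then show "digits x - digits y \<in> fball n"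
    unfolding fball_eq_iff by (simp add: digits_nth x y)
next
  assume *: "digits x - digits y \<in> fball n"
  obtain N where N: "\<And>n. n \<le> N \<Longrightarrow> bfloor n x = 0" using bfloor_eventually_0[OF x] by blast
  obtain N' where N': "\<And>n. n \<le> N' \<Longrightarrow> bfloor n y = 0" using bfloor_eventually_0[OF y] by blast
  define L where "L = min N N'"
  have base: "bfloor i x = bfloor i y" if "i \<le> L" for i using that N[of i] N'[of i] by (simp add: L_def)
  have "i \<le> n \<longrightarrow> bfloor i x = bfloor i y" if "L \<le> i" for i
    using that
  proof (induction i rule: int_ge_induct)
    case base
    then show ?case using \<open>\<And>i. i \<le> L \<Longrightarrow> bfloor i x = bfloor i y\<close> by simp
  next
    case (step i)
    show ?case
    proof
      assume i: "i + 1 \<le> n"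
      then have "bfloor (i + 1) x div 2 = bfloor (i + 1) y div 2"
        using step.IH bfloor_div[of i x] bfloor_div[of i y] by simp
      moreover have "fls_nth (digits x) i = fls_nth (digits y) i"
        using * i unfolding fball_eq_iff by simp
      then have "odd (bfloor (i + 1) x) \<longleftrightarrow> odd (bfloor (i + 1) y)"
        by (simp add: digits_nth x y split: if_splits)
      ultimately show "bfloor (i + 1) x = bfloor (i + 1) y" by presburger
    qed
  qed
  then show "bfloor n x = bfloor n y" using base[of n] by (cases "n \<le> L") auto
qed

text \<open>Density replaces surjectivity: no nonnegative real number is sent to a series whose
  coefficients are 1 from some index on.\<close>

lemma digits_dense: "\<exists>y\<ge>0. a - digits y \<in> fball n"
proof -
  obtain s :: nat where s: "a \<in> fball (- int s)" using fball_ex by blast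
  have dig0: "digits 0 = 0"
    by (rule fls_eqI) (simp add: digits_nth bfloor_def)
  show ?thesis
  proof (cases "- int s \<le> n")
    case False
    then show ?thesis using s fball_mono[of n "- int s" a] dig0 by (intro exI[of _ 0]) auto
  next
    case True
    then show ?thesis
    proof (induction n rule: int_ge_induct)
      case base
      then show ?case using s dig0 by (intro exI[of _ 0]) auto
    next
      case (step n)
      then obtain y where y: "y \<ge> 0" "a - digits y \<in> fball n" by blast
      define d :: int where "d = (if fls_nth a n = 1 then 1 else 0)"
      \<comment> \<open>The left endpoint of that half of the dyadic interval of \<open>y\<close> on
        which the next digit is \<open>d\<close>.\<close>
      define z :: real where "z = (of_int (bfloor n y) + of_int d / 2) / 2 powi n"
      have b0: "bfloor n y \<ge> 0" using y(1) by (simp add: bfloor_def)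
      have d01: "0 \<le> d" "d \<le> 1" by (simp_all add: d_def)
      have z0: "z \<ge> 0" unfolding z_def using b0 d01 by simp
      have "2 powi n * z = of_int (bfloor n y) + of_int d / 2" by (simp add: z_def)
      then have bz: "bfloor n z = bfloor n y"
        unfolding bfloor_def[of n z] using d01 by (simp add: floor_eq_iff)
      have "2 powi (n + 1) * z = of_int (2 * bfloor n y + d)"
        by (simp add: z_def power_int_add field_simps)
      then have "bfloor (n + 1) z = 2 * bfloor n y + d"
        by (simp only: bfloor_def[of "n + 1" z] floor_of_int)
      then have zn: "fls_nth (digits z) n = fls_nth a n"
        by (simp add: digits_nth z0 d_def)
      have "digits z - digits y \<in> fball n" using bz by (simp add: digits_cong_iff z0 y(1))
      then have "a - digits z \<in> fball (n + 1)"
        using y(2) zn unfolding fball_eq_iff zless_add1_eq by auto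
      then show ?case using z0 by blast
    qed
  qed
qed

text \<open>By density the ball has a centre of the form \<open>digits y\<close>; membership then
  prescribes the floor at level \<open>n\<close>.\<close>

lemma digits_interval:
  "\<exists>k. {x. x \<ge> 0 \<and> a - digits x \<in> fball n} = {of_int k / 2 powi n ..< (of_int k + 1) / 2 powi n}"
proof -
  obtain y where y: "y \<ge> 0" "a - digits y \<in> fball n" using digits_dense by blast
  have b0: "bfloor n y \<ge> 0" using y(1) by (simp add: bfloor_def)
  have "x \<ge> 0 \<and> a - digits x \<in> fball n \<longleftrightarrow>
      x \<in> {of_int (bfloor n y) / 2 powi n ..< (of_int (bfloor n y) + 1) / 2 powi n}" for x
  proof -
    have "x \<ge> 0 \<and> a - digits x \<in> fball n \<longleftrightarrow> x \<ge> 0 \<and> bfloor n x = bfloor n y"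
      using fball_cong[OF y(2)] digits_cong_iff[OF y(1)] by auto
    also have "\<dots> \<longleftrightarrow> x \<ge> 0 \<and> of_int (bfloor n y) \<le> 2 powi n * x \<and> 2 powi n * x < of_int (bfloor n y) + 1"
      unfolding bfloor_def[of n x] floor_eq_iff ..
    also have "\<dots> \<longleftrightarrow> of_int (bfloor n y) \<le> 2 powi n * x \<and> 2 powi n * x < of_int (bfloor n y) + 1"
    proof -
      have "x \<ge> 0" if "of_int (bfloor n y) \<le> 2 powi n * x"
      proof -
        have "0 \<le> 2 powi n * x" using that b0 by (meson of_int_0_le_iff order_trans)
        moreover have "(0::real) < 2 powi n" by simp
        ultimately show ?thesis using zero_le_mult_iff[of "2 powi n" x] by linarith
      qed
      then show ?thesis by blast
    qed
    also have "\<dots> \<longleftrightarrow> x \<in> {of_int (bfloor n y) / 2 powi n ..< (of_int (bfloor n y) + 1) / 2 powi n}"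
      by (simp add: divide_le_eq less_divide_eq mult.commute)
    finally show ?thesis .
  qed
  then show ?thesis by blast
qed


section \<open>The Heisenberg group over the field of Laurent series\<close>

text \<open>A triple of Laurent series is encoded by its coefficient sequences, at the indices 0, 1 and 2.\<close>

definition bit_int :: "bit \<Rightarrow> int" where "bit_int x = (if x = 1 then 1 else 0)"

lemma bit_int_eq_iff [simp]: "bit_int x = bit_int y \<longleftrightarrow> x = y"
  by (cases x; cases y) (simp_all add: bit_int_def)

fun enc :: "bit fls \<times> bit fls \<times> bit fls \<Rightarrow> nat \<Rightarrow> int \<Rightarrow> int" where
  "enc (a, b, c) i j = bit_int (fls_nth (if i = 0 then a else if i = 1 then b else if i = 2 then c else 0) j)"

lemma enc_eq_iff [simp]: "enc s = enc t \<longleftrightarrow> s = t"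
proof
  assume eq: "enc s = enc t"
  obtain a b c a' b' c' where st: "s = (a, b, c)" "t = (a', b', c')" by (metis prod_cases3)
  have "enc s i j = enc t i j" for i j by (simp add: eq)
  from this[of 0] this[of 1] this[of 2] show "s = t"
    by (simp add: st fls_eq_iff enc.simps)
qed simp

declare enc.simps [simp del]

definition dec :: "(nat \<Rightarrow> int \<Rightarrow> int) \<Rightarrow> bit fls \<times> bit fls \<times> bit fls" where
  "dec x = (THE t. enc t = x)"

lemma dec_enc [simp]: "dec (enc t) = t"
  by (simp add: dec_def)

text \<open>The product of upper unitriangular 3 by 3 matrices with \<open>a\<close>,
  \<open>b\<close> next to the diagonal and \<open>c\<close> in the corner.\<close>

fun hmul :: "bit fls \<times> bit fls \<times> bit fls \<Rightarrow> bit fls \<times> bit fls \<times> bit fls \<Rightarrow> bit fls \<times> bit fls \<times> bit fls" where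
  "hmul (a, b, c) (a', b', c') = (a + a', b + b', c + c' + a * b')"

definition heis :: "(nat \<Rightarrow> int \<Rightarrow> int) monoid" where
  "heis = \<lparr>carrier = range enc, mult = (\<lambda>x y. enc (hmul (dec x) (dec y))), one = enc (0, 0, 0)\<rparr>"

lemma heis_carrier: "carrier heis = range enc" by (simp add: heis_def)
lemma heis_mult [simp]: "enc s \<otimes>\<^bsub>heis\<^esub> enc t = enc (hmul s t)" by (simp add: heis_def)
lemma heis_one: "\<one>\<^bsub>heis\<^esub> = enc (0, 0, 0)" by (simp add: heis_def)

lemma enc_carrier [simp]: "enc t \<in> carrier heis" by (simp add: heis_carrier)

lemma heis_cases:
  assumes "x \<in> carrier heis"
  obtains a b c where "x = enc (a, b, c)"
  using assms by (auto simp: heis_carrier)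

lemma bit_fls_add_self_left [simp]: "a + (a + b) = (b :: bit fls)"
  by (simp flip: add.assoc)

lemma group_heis: "group heis"
proof (rule groupI)
  fix x assume "x \<in> carrier heis"
  then obtain a b c where x: "x = enc (a, b, c)" by (rule heis_cases)
  show "\<exists>y\<in>carrier heis. y \<otimes>\<^bsub>heis\<^esub> x = \<one>\<^bsub>heis\<^esub>"
    by (rule bexI[of _ "enc (a, b, c + a * b)"]) (simp_all add: x heis_one algebra_simps)
qed (auto elim!: heis_cases simp: heis_one algebra_simps)

interpretation heis: group heis by (rule group_heis)

text \<open>Signs disappear in characteristic 2: the usual corner entry a b - c of the inverse
  matrix becomes c + a b.\<close>

lemma heis_inv [simp]: "inv\<^bsub>heis\<^esub> (enc (a, b, c)) = enc (a, b, c + a * b)"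
  by (rule heis.inv_equality) (simp_all add: heis_one algebra_simps)

section \<open>The topology of the Heisenberg group\<close>

definition hball :: "nat \<Rightarrow> (nat \<Rightarrow> int \<Rightarrow> int) set" where
  "hball n = enc ` (fball (int n) \<times> fball (int n) \<times> fball (int n))"

lemma enc_hball [simp]:
  "enc (a, b, c) \<in> hball n \<longleftrightarrow> a \<in> fball (int n) \<and> b \<in> fball (int n) \<and> c \<in> fball (int n)"
  by (auto simp: hball_def)

lemma hball_cases:
  assumes "x \<in> hball n"
  obtains a b c where "x = enc (a, b, c)" "a \<in> fball (int n)" "b \<in> fball (int n)" "c \<in> fball (int n)"
  using assms by (auto simp: hball_def)

definition heis_top :: "(nat \<Rightarrow> int \<Rightarrow> int) topology" where
  "heis_top = topology (\<lambda>U. U \<subseteq> carrier heis \<and> (\<forall>x\<in>U. \<exists>n. \<forall>k\<in>hball n. x \<otimes>\<^bsub>heis\<^esub> k \<in> U))"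

lemma hball_mono: "m \<le> n \<Longrightarrow> hball n \<subseteq> hball m"
  unfolding hball_def using fball_mono[of "int m" "int n"] by (auto intro!: image_eqI)

lemma openin_heis_top:
  "openin heis_top U \<longleftrightarrow> U \<subseteq> carrier heis \<and> (\<forall>x\<in>U. \<exists>n. \<forall>k\<in>hball n. x \<otimes>\<^bsub>heis\<^esub> k \<in> U)"
proof -
  let ?L = "\<lambda>U. U \<subseteq> carrier heis \<and> (\<forall>x\<in>U. \<exists>n. \<forall>k\<in>hball n. x \<otimes>\<^bsub>heis\<^esub> k \<in> U)"
  have "istopology ?L"
    unfolding istopology_def
  proof (intro conjI allI impI)
    fix S T assume S: "?L S" and T: "?L T"
    show "S \<inter> T \<subseteq> carrier heis" using S by blast
    show "\<forall>x\<in>S \<inter> T. \<exists>n. \<forall>k\<in>hball n. x \<otimes>\<^bsub>heis\<^esub> k \<in> S \<inter> T"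
    proof
      fix x assume x: "x \<in> S \<inter> T"
      then obtain m n where "\<forall>k\<in>hball m. x \<otimes>\<^bsub>heis\<^esub> k \<in> S" "\<forall>k\<in>hball n. x \<otimes>\<^bsub>heis\<^esub> k \<in> T"
        using S T by blast
      then show "\<exists>n. \<forall>k\<in>hball n. x \<otimes>\<^bsub>heis\<^esub> k \<in> S \<inter> T"
        using hball_mono[of m "max m n"] hball_mono[of n "max m n"]
        by (intro exI[of _ "max m n"]) auto
    qed
  next
    fix \<K> assume *: "\<forall>S\<in>\<K>. ?L S"
    show "\<Union>\<K> \<subseteq> carrier heis" using * by blast
    show "\<forall>x\<in>\<Union>\<K>. \<exists>n. \<forall>k\<in>hball n. x \<otimes>\<^bsub>heis\<^esub> k \<in> \<Union>\<K>"
    proof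
      fix x assume "x \<in> \<Union>\<K>"
      then obtain S where S: "S \<in> \<K>" "x \<in> S" by blast
      then obtain n where "\<forall>k\<in>hball n. x \<otimes>\<^bsub>heis\<^esub> k \<in> S" using * by blast
      then show "\<exists>n. \<forall>k\<in>hball n. x \<otimes>\<^bsub>heis\<^esub> k \<in> \<Union>\<K>" using S(1) by blast
    qed
  qed
  then show ?thesis unfolding heis_top_def by (simp add: topology_inverse')
qed

lemma hball_subgroup: "subgroup (hball n) heis"
proof (rule heis.subgroupI)
  show "hball n \<subseteq> carrier heis" by (auto simp: hball_def)
  show "hball n \<noteq> {}" by (auto simp: hball_def intro: fball_zero)
  have *: "a * b \<in> fball (int n)" if "a \<in> fball (int n)" "b \<in> fball (int n)" for a b
    using that by (rule fball_mult') simp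
  show "inv\<^bsub>heis\<^esub> x \<in> hball n" if "x \<in> hball n" for x
    using that by (auto elim!: hball_cases simp: fball_add *)
  show "x \<otimes>\<^bsub>heis\<^esub> y \<in> hball n" if "x \<in> hball n" "y \<in> hball n" for x y
    using that by (auto elim!: hball_cases simp: fball_add *)
qed

text \<open>\<open>hball 0\<close> is a continuous image of a product of finite spaces.\<close>

lemma compact_hball: "compactin heis_top (hball n)"
proof -
  define T where "T = product_topology (\<lambda>_::nat. discrete_topology (UNIV :: (bool \<times> bool \<times> bool) set)) UNIV"
  define F :: "(nat \<Rightarrow> bool) \<Rightarrow> bit fls" where "F f = fps_to_fls (Abs_fps (\<lambda>i. if f i then 1 else 0))" for f
  define \<psi> where "\<psi> s = enc (F (\<lambda>i. fst (s i)), F (\<lambda>i. fst (snd (s i))), F (\<lambda>i. snd (snd (s i))))" for s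
  have F_nth: "fls_nth (F f) i = (if 0 \<le> i \<and> f (nat i) then 1 else 0)" for f i
    by (simp add: F_def)
  have F0: "F f \<in> fball 0" for f by (simp add: fball_def F_nth)
  have F_diff: "F f - F g \<in> fball (int n)" if "\<And>i. i < n \<Longrightarrow> f i = g i" for f g n
    unfolding fball_eq_iff
  proof (intro allI impI)
    fix i assume "i < int n"
    then have "f (nat i) = g (nat i)" if "0 \<le> i"
      using that \<open>\<And>i. i < n \<Longrightarrow> f i = g i\<close> by (simp add: nat_less_iff)
    then show "fls_nth (F f) i = fls_nth (F g) i" by (auto simp: F_nth)
  qed
  have topT: "topspace T = UNIV" by (simp add: T_def)
  have "compact_space T"
    unfolding T_def by (simp add: compact_space_product_topology compact_space_discrete_topology)
  then have cT: "compactin T UNIV" by (simp add: compact_space_def topT)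
  have car: "topspace heis_top = carrier heis"
  proof
    show "topspace heis_top \<subseteq> carrier heis" using openin_heis_top[of "topspace heis_top"] by simp
    have "openin heis_top (carrier heis)"
      unfolding openin_heis_top by (auto elim!: heis_cases hball_cases)
    then show "carrier heis \<subseteq> topspace heis_top" by (rule openin_subset)
  qed
  have "continuous_map T heis_top \<psi>"
    unfolding continuous_map_def topT car
  proof (intro conjI allI impI)
    show "\<psi> \<in> UNIV \<rightarrow> carrier heis" by (simp add: \<psi>_def)
    fix U assume U: "openin heis_top U"
    show "openin T {s \<in> UNIV. \<psi> s \<in> U}"
    proof (subst openin_subopen, intro ballI)
      fix s assume "s \<in> {s \<in> UNIV. \<psi> s \<in> U}"
      then obtain n where n: "\<And>k. k \<in> hball n \<Longrightarrow> \<psi> s \<otimes>\<^bsub>heis\<^esub> k \<in> U"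
        using U unfolding openin_heis_top by blast
      \<comment> \<open>Sequences that agree with \<open>s\<close> in the first \<open>n\<close>
        places have coefficients that agree below index \<open>n\<close>.\<close>
      define W where "W = (\<Pi>\<^sub>E i\<in>UNIV. if i < n then {s i} else UNIV)"
      have W: "openin T W"
        unfolding T_def W_def by (rule product_topology_basis) auto
      have "\<psi> t \<in> U" if t: "t \<in> W" for t
      proof -
        have eq: "s i = t i" if "i < n" for i
        proof -
          have "t i \<in> (if i < n then {s i} else UNIV)" using t unfolding W_def by (rule PiE_mem) simp
          then show ?thesis using that by simp
        qed
        obtain a b c where s: "\<psi> s = enc (a, b, c)" "a = F (\<lambda>i. fst (s i))"
          "b = F (\<lambda>i. fst (snd (s i)))" "c = F (\<lambda>i. snd (snd (s i)))" by (simp add: \<psi>_def)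
        obtain a' b' c' where t': "\<psi> t = enc (a', b', c')" "a' = F (\<lambda>i. fst (t i))"
          "b' = F (\<lambda>i. fst (snd (t i)))" "c' = F (\<lambda>i. snd (snd (t i)))" by (simp add: \<psi>_def)
        have d: "a + a' \<in> fball (int n)" "b + b' \<in> fball (int n)" "c + c' \<in> fball (int n)"
          using F_diff eq by (simp_all add: s t' flip: bit_fls_diff)
        \<comment> \<open>\<open>\<psi> t\<close> is \<open>\<psi> s\<close> times the element
          formed below. Its corner entry involves a (b + b'), which is small because
          \<open>a\<close> is integral.\<close>
        have "a * (b + b') \<in> fball (int n)"
          using F0 d(2) by (intro fball_mult'[of _ 0]) (auto simp: s)
        then have "enc (a + a', b + b', (c + c') + a * (b + b')) \<in> hball n"
          using d by (simp add: fball_add)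
        then have "\<psi> s \<otimes>\<^bsub>heis\<^esub> enc (a + a', b + b', (c + c') + a * (b + b')) \<in> U" by (rule n)
        moreover have "\<psi> s \<otimes>\<^bsub>heis\<^esub> enc (a + a', b + b', (c + c') + a * (b + b')) = \<psi> t"
          by (simp add: s(1) t'(1) algebra_simps)
        ultimately show ?thesis by simp
      qed
      moreover have "s \<in> W" by (auto simp: W_def)
      ultimately show "\<exists>V. openin T V \<and> s \<in> V \<and> V \<subseteq> {s \<in> UNIV. \<psi> s \<in> U}" using W by blast
    qed
  qed
  then have compact_range: "compactin heis_top (range \<psi>)" by (rule image_compactin[OF cT])
  have in_range: "hball 0 \<subseteq> range \<psi>"
  proof
    fix x assume "x \<in> hball 0"
    then obtain a b c where x: "x = enc (a, b, c)" "a \<in> fball 0" "b \<in> fball 0" "c \<in> fball 0"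
      by (auto simp: hball_def)
    have F_inv: "F (\<lambda>i. fls_nth u (int i) = 1) = u" if "u \<in> fball 0" for u
    proof (rule fls_eqI)
      show "fls_nth (F (\<lambda>i. fls_nth u (int i) = 1)) i = fls_nth u i" for i
        using that by (cases "i < 0") (auto simp: F_nth fball_def)
    qed
    have "x = \<psi> (\<lambda>i. (fls_nth a (int i) = 1, fls_nth b (int i) = 1, fls_nth c (int i) = 1))"
      unfolding \<psi>_def by (simp add: x F_inv)
    then show "x \<in> range \<psi>" by simp
  qed
  \<comment> \<open>An open subgroup is closed, as its complement is stable under right translation
    by it.\<close>
  have closed: "closedin heis_top (hball n)"
    unfolding closedin_def car openin_heis_top
  proof (intro conjI ballI)
    show "hball n \<subseteq> carrier heis" by (rule subgroup.subset[OF hball_subgroup])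
    fix x assume x: "x \<in> carrier heis - hball n"
    have "x \<otimes>\<^bsub>heis\<^esub> k \<in> carrier heis - hball n" if k: "k \<in> hball n" for k
    proof -
      have kc: "k \<in> carrier heis" using k subgroup.subset[OF hball_subgroup] by blast
      have "x \<otimes>\<^bsub>heis\<^esub> k \<notin> hball n"
      proof
        assume "x \<otimes>\<^bsub>heis\<^esub> k \<in> hball n"
        then have "(x \<otimes>\<^bsub>heis\<^esub> k) \<otimes>\<^bsub>heis\<^esub> inv\<^bsub>heis\<^esub> k \<in> hball n"
          using k subgroup.m_closed[OF hball_subgroup] subgroup.m_inv_closed[OF hball_subgroup] by blast
        then show False using x kc by (simp add: heis.m_assoc)
      qed
      then show ?thesis using x kc by simp
    qed
    then show "\<exists>m. \<forall>k\<in>hball m. x \<otimes>\<^bsub>heis\<^esub> k \<in> carrier heis - hball n" by blast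
  qed auto
  have "hball n \<subseteq> hball 0" by (rule hball_mono) simp
  then show ?thesis
    by (rule closed_compactin[OF compact_range subset_trans[OF _ in_range] closed])
qed

interpretation heis: td_group heis heis_top hball
proof (intro td_group.intro td_group_axioms.intro)
  show "group heis" by (rule group_heis)
  show "subgroup (hball n) heis" for n by (rule hball_subgroup)
  show "hball n \<subseteq> hball m" if "m \<le> n" for m n using that by (rule hball_mono)
  show "compactin heis_top (hball n)" for n by (rule compact_hball)
  show "openin heis_top U \<longleftrightarrow> U \<subseteq> carrier heis \<and> (\<forall>x\<in>U. \<exists>n. \<forall>k\<in>hball n. x \<otimes>\<^bsub>heis\<^esub> k \<in> U)" for U
    by (rule openin_heis_top)
  show "x = \<one>\<^bsub>heis\<^esub>" if "x \<in> carrier heis" "\<And>n. x \<in> hball n" for x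
  proof -
    obtain a b c where x: "x = enc (a, b, c)" using \<open>x \<in> carrier heis\<close> by (rule heis_cases)
    then have "a = 0" "b = 0" "c = 0" using that(2) by (auto intro: fball_eq_0)
    then show ?thesis by (simp add: x heis_one)
  qed
  show "\<exists>m. \<forall>k\<in>hball m. inv\<^bsub>heis\<^esub> x \<otimes>\<^bsub>heis\<^esub> k \<otimes>\<^bsub>heis\<^esub> x \<in> hball n" if xc: "x \<in> carrier heis" for x n
  proof -
    obtain a b c where x: "x = enc (a, b, c)" using xc by (rule heis_cases)
    obtain s where s: "a \<in> fball (- int s)" using fball_ex by blast
    obtain t where t: "b \<in> fball (- int t)" using fball_ex by blast
    \<comment> \<open>Conjugation adds a q + b p to the corner entry, at a loss of at most
      \<open>s\<close> digits in one term and \<open>t\<close> in the other.\<close>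
    have "inv\<^bsub>heis\<^esub> x \<otimes>\<^bsub>heis\<^esub> k \<otimes>\<^bsub>heis\<^esub> x \<in> hball n" if k: "k \<in> hball (n + s + t)" for k
    proof -
      obtain p q r where k: "k = enc (p, q, r)" "p \<in> fball (int (n + s + t))"
        "q \<in> fball (int (n + s + t))" "r \<in> fball (int (n + s + t))" using k by (rule hball_cases)
      have "p \<in> fball (int n)" "q \<in> fball (int n)" "r \<in> fball (int n)"
        using k(2-4) fball_mono[of "int n" "int (n + s + t)"] by auto
      moreover have "a * q \<in> fball (int n)" "b * p \<in> fball (int n)"
        using s t k(2,3) by (auto intro!: fball_mult')
      moreover have "inv\<^bsub>heis\<^esub> x \<otimes>\<^bsub>heis\<^esub> k \<otimes>\<^bsub>heis\<^esub> x = enc (p, q, r + a * q + b * p)"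
        by (simp add: x k(1) algebra_simps)
      ultimately show ?thesis by (simp add: fball_add)
    qed
    then show ?thesis by blast
  qed
qed

subsection \<open>Boxes\<close>

text \<open>The cosets of \<open>hball n\<close> are sheared boxes. For a fixed group element \<open>(a, b, c)\<close>, translation
  by it permutes the boxes \<open>hbox n (n - s)\<close> as soon as \<open>t\<^sup>s a\<close> (on the left) or \<open>t\<^sup>s b\<close> (on the right)
  is integral, since the error term \<open>a b'\<close> or \<open>a' b\<close> loses at most \<open>s\<close> digits.\<close>

definition hbox :: "int \<Rightarrow> int \<Rightarrow> bit fls \<Rightarrow> bit fls \<Rightarrow> bit fls \<Rightarrow> (nat \<Rightarrow> int \<Rightarrow> int) set" where
  "hbox n m a b c = enc ` {(a', b', c'). a - a' \<in> fball n \<and> b - b' \<in> fball n \<and> c - c' \<in> fball m}"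

lemma enc_hbox [simp]:
  "enc (a', b', c') \<in> hbox n m a b c \<longleftrightarrow> a - a' \<in> fball n \<and> b - b' \<in> fball n \<and> c - c' \<in> fball m"
  by (auto simp: hbox_def)

lemma hbox_cases:
  assumes "x \<in> hbox n m a b c"
  obtains a' b' c' where "x = enc (a', b', c')" "a - a' \<in> fball n" "b - b' \<in> fball n" "c - c' \<in> fball m"
  using assms by (auto simp: hbox_def)

lemma hbox_carrier: "hbox n m a b c \<subseteq> carrier heis"
  by (auto simp: hbox_def)

lemma hbox_cong:
  assumes "a - a' \<in> fball n" "b - b' \<in> fball n" "c - c' \<in> fball m"
  shows "hbox n m a b c = hbox n m a' b' c'"
  unfolding hbox_def using fball_cong[OF assms(1)] fball_cong[OF assms(2)] fball_cong[OF assms(3)] by simp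

lemma hbox_eqI: "enc (a', b', c') \<in> hbox n m a b c \<Longrightarrow> hbox n m a b c = hbox n m a' b' c'"
  by (rule hbox_cong) auto

lemma hbox_self [simp]: "enc (a, b, c) \<in> hbox n m a b c"
  by simp

lemma hbox_mono: "n \<le> n' \<Longrightarrow> m \<le> m' \<Longrightarrow> hbox n' m' a b c \<subseteq> hbox n m a b c"
  by (auto elim!: hbox_cases intro: fball_mono)

lemma openin_hbox: "openin heis_top (hbox n m a b c)"
  unfolding openin_heis_top
proof (intro conjI ballI)
  show "hbox n m a b c \<subseteq> carrier heis" by (rule hbox_carrier)
  fix x assume "x \<in> hbox n m a b c"
  then obtain a' b' c' where x: "x = enc (a', b', c')" and mem: "enc (a', b', c') \<in> hbox n m a b c"
    by (auto elim!: hbox_cases)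
  obtain s where s: "a' \<in> fball (- int s)" using fball_ex by blast
  define l where "l = nat \<bar>n\<bar> + nat \<bar>m\<bar> + s"
  have "x \<otimes>\<^bsub>heis\<^esub> k \<in> hbox n m a b c" if "k \<in> hball l" for k
  proof -
    obtain p q r where k: "k = enc (p, q, r)" "p \<in> fball (int l)" "q \<in> fball (int l)" "r \<in> fball (int l)"
      using \<open>k \<in> hball l\<close> by (rule hball_cases)
    have "p \<in> fball n" "q \<in> fball n" "r \<in> fball m"
      using k(2-4) fball_mono[of n "int l"] fball_mono[of m "int l"] by (auto simp: l_def)
    moreover have "a' * q \<in> fball m" using s k(3) by (rule fball_mult') (simp add: l_def)
    ultimately have "x \<otimes>\<^bsub>heis\<^esub> k \<in> hbox n m a' b' c'"
      by (simp add: x k(1) bit_fls_diff add.assoc fball_add)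
    then show ?thesis using hbox_eqI[OF mem] by simp
  qed
  then show "\<exists>l. \<forall>k\<in>hball l. x \<otimes>\<^bsub>heis\<^esub> k \<in> hbox n m a b c" by blast
qed

lemma openin_hbox_complement: "openin heis_top (carrier heis - hbox n m a b c)"
proof (subst openin_subopen, intro ballI)
  fix x assume x: "x \<in> carrier heis - hbox n m a b c"
  then obtain a' b' c' where x': "x = enc (a', b', c')" by (auto elim: heis_cases)
  have "hbox n m a' b' c' \<subseteq> carrier heis - hbox n m a b c"
  proof
    fix y assume y: "y \<in> hbox n m a' b' c'"
    then obtain u v w where y': "y = enc (u, v, w)" by (auto elim: hbox_cases)
    have "y \<notin> hbox n m a b c"
    proof
      assume "y \<in> hbox n m a b c"
      then have "hbox n m a b c = hbox n m a' b' c'"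
        using y hbox_eqI unfolding y' by metis
      then show False using x x' by simp
    qed
    then show "y \<in> carrier heis - hbox n m a b c" using y hbox_carrier by blast
  qed
  then show "\<exists>V. openin heis_top V \<and> x \<in> V \<and> V \<subseteq> carrier heis - hbox n m a b c"
    using openin_hbox x' by (intro exI[of _ "hbox n m a' b' c'"]) simp
qed

text \<open>The corner entry of the quotient of a box element by the centre is (c + w) + a (b + v).
  The box gives n - s digits for the first term, and n - t for the second if t^t a is integral,
  where the exponent t bounds the pole of \<open>a\<close>.\<close>

lemma hbox_subset_coset:
  "\<exists>N. \<forall>n\<ge>N. hbox n (n - int s) a b c \<subseteq> heis.coset (enc (a, b, c)) l"
proof -
  obtain t where t: "a \<in> fball (- int t)" using fball_ex by blast
  have "hbox n (n - int s) a b c \<subseteq> heis.coset (enc (a, b, c)) l" if n: "n \<ge> int (l + s + t)" for n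
  proof
    fix x assume "x \<in> hbox n (n - int s) a b c"
    then obtain u v w where x: "x = enc (u, v, w)" "a + u \<in> fball n" "b + v \<in> fball n" "c + w \<in> fball (n - int s)"
      by (auto elim!: hbox_cases simp: bit_fls_diff)
    have *: "a + u \<in> fball (int l)" "b + v \<in> fball (int l)" "c + w \<in> fball (int l)"
      using x(2-4) n fball_mono[of "int l" n] fball_mono[of "int l" "n - int s"] by auto
    have "a * (b + v) \<in> fball (int l)" using t x(3) by (rule fball_mult') (use n in simp)
    then have "(c + w) + a * (b + v) \<in> fball (int l)" by (rule fball_add[OF *(3)])
    then show "x \<in> heis.coset (enc (a, b, c)) l"
      using * by (simp add: heis.coset_def x(1) algebra_simps)
  qed
  then show ?thesis by blast
qed

lemma open_contains_hbox:
  assumes U: "openin heis_top U" and x: "enc (a, b, c) \<in> U"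
  shows "\<exists>N. \<forall>n\<ge>N. hbox n (n - int s) a b c \<subseteq> U"
proof -
  obtain l where "heis.coset (enc (a, b, c)) l \<subseteq> U" using U x unfolding heis.openin_iff_coset by blast
  then show ?thesis using hbox_subset_coset[of s a b c l] by (meson order_trans)
qed

lemma eventually_compact_hbox: "\<exists>N. \<forall>n\<ge>N. compactin heis_top (hbox n (n - int s) a b c)"
proof -
  obtain N where N: "\<And>n. n \<ge> N \<Longrightarrow> hbox n (n - int s) a b c \<subseteq> heis.coset (enc (a, b, c)) 0"
    using hbox_subset_coset by blast
  have "compactin heis_top (hbox n (n - int s) a b c)" if "n \<ge> N" for n
  proof (rule closed_compactin[OF heis.compactin_coset[OF enc_carrier] N[OF that]])
    show "closedin heis_top (hbox n (n - int s) a b c)"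
      using openin_hbox_complement hbox_carrier by (simp add: closedin_def heis.topspace_X)
  qed
  then show ?thesis by blast
qed

text \<open>For fixed \<open>s\<close> the precision of the corner entry is tied to that of the
  others, so boxes that meet are nested. The empty set is adjoined to make the family closed under
  intersections.\<close>

definition boxes :: "nat \<Rightarrow> (nat \<Rightarrow> int \<Rightarrow> int) set set" where
  "boxes s = insert {} {hbox n (n - int s) a b c | n a b c. True}"

lemma hbox_in_boxes [simp]: "hbox n (n - int s) a b c \<in> boxes s"
  unfolding boxes_def by blast

lemma boxesE:
  assumes "B \<in> boxes s"
  obtains "B = {}" | n a b c where "B = hbox n (n - int s) a b c"
  using assms unfolding boxes_def by blast

lemma boxes_carrier: "boxes s \<subseteq> Pow (carrier heis)"
proof
  fix B assume "B \<in> boxes s"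
  then show "B \<in> Pow (carrier heis)" by (cases rule: boxesE) (simp_all add: hbox_carrier)
qed

lemma digits_rational_dense: "\<exists>i::int. a - digits (of_int i / 2 powi n) \<in> fball n"
proof -
  obtain y where y: "y \<ge> 0" "a - digits y \<in> fball n" using digits_dense by blast
  have b0: "bfloor n y \<ge> 0" using y(1) by (simp add: bfloor_def)
  define z :: real where "z = of_int (bfloor n y) / 2 powi n"
  have z: "z \<ge> 0" using b0 by (simp add: z_def)
  have "bfloor n z = bfloor n y" unfolding bfloor_def[of n z] by (simp add: z_def)
  then have "digits y - digits z \<in> fball n" using y(1) z by (simp add: digits_cong_iff)
  then have "a - digits z \<in> fball n" using y(2) fball_cong[OF y(2)] by simp
  then show ?thesis unfolding z_def by blast
qed

text \<open>A box does not change when its centre is replaced by nearby digit expansions of dyadic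
  rationals.\<close>

lemma countable_boxes: "countable (boxes s)"
proof -
  define f where "f = (\<lambda>(n, i, j, k :: int). hbox n (n - int s) (digits (of_int i / 2 powi n))
    (digits (of_int j / 2 powi n)) (digits (of_int k / 2 powi (n - int s))))"
  have "boxes s \<subseteq> insert {} (range f)"
  proof
    fix B assume "B \<in> boxes s"
    then show "B \<in> insert {} (range f)"
    proof (cases rule: boxesE)
      case (2 n a b c)
      obtain i j k :: int where "a - digits (of_int i / 2 powi n) \<in> fball n"
        "b - digits (of_int j / 2 powi n) \<in> fball n"
        "c - digits (of_int k / 2 powi (n - int s)) \<in> fball (n - int s)"
        using digits_rational_dense by metis
      then have "B = f (n, i, j, k)" unfolding 2 f_def by (simp add: hbox_cong)
      then show ?thesis by blast
    qed simp
  qed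
  then show ?thesis by (rule countable_subset) simp
qed

lemma open_eq_Union_boxes:
  assumes "openin heis_top U"
  shows "U = \<Union>{B \<in> boxes s. B \<subseteq> U}" "U = \<Union>{B \<in> boxes s. B \<subseteq> U \<and> compactin heis_top B}"
proof -
  have "\<exists>B\<in>boxes s. x \<in> B \<and> B \<subseteq> U \<and> compactin heis_top B" if x: "x \<in> U" for x
  proof -
    have "x \<in> carrier heis" using assms x unfolding openin_heis_top by blast
    then obtain a b c where x': "x = enc (a, b, c)" by (rule heis_cases)
    obtain N where N: "\<And>n. n \<ge> N \<Longrightarrow> hbox n (n - int s) a b c \<subseteq> U"
      using open_contains_hbox[OF assms, of a b c s] x x' by blast
    obtain N' where N': "\<And>n. n \<ge> N' \<Longrightarrow> compactin heis_top (hbox n (n - int s) a b c)"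
      using eventually_compact_hbox by blast
    show ?thesis
      by (rule bexI[of _ "hbox (max N N') (max N N' - int s) a b c"]) (use N N' x' in simp_all)
  qed
  then show "U = \<Union>{B \<in> boxes s. B \<subseteq> U}" "U = \<Union>{B \<in> boxes s. B \<subseteq> U \<and> compactin heis_top B}"
    by blast+
qed

lemma sigma_sets_boxes: "sigma_sets (carrier heis) (boxes s) = sigma_sets (carrier heis) {U. openin heis_top U}"
proof (rule sigma_sets_eqI)
  fix B assume "B \<in> boxes s"
  then show "B \<in> sigma_sets (carrier heis) {U. openin heis_top U}"
    by (cases rule: boxesE) (auto intro: openin_hbox sigma_sets.Basic sigma_sets.Empty)
next
  fix U assume "U \<in> {U. openin heis_top U}"
  then have U: "U = \<Union>{B \<in> boxes s. B \<subseteq> U}" using open_eq_Union_boxes(1) by blast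
  have "\<Union>{B \<in> boxes s. B \<subseteq> U} \<in> sigma_sets (carrier heis) (boxes s)"
    by (rule sigma_sets_UNION) (auto intro: countable_subset[OF _ countable_boxes[of s]])
  then show "U \<in> sigma_sets (carrier heis) (boxes s)" using U by simp
qed

lemma Int_stable_boxes: "Int_stable (boxes s)"
  unfolding Int_stable_def
proof (intro ballI)
  fix B C assume BC: "B \<in> boxes s" "C \<in> boxes s"
  show "B \<inter> C \<in> boxes s"
  proof (cases "B \<inter> C = {}")
    case True
    then show ?thesis by (simp add: boxes_def)
  next
    case False
    then obtain x where x: "x \<in> B" "x \<in> C" by blast
    obtain n a b c where B: "B = hbox n (n - int s) a b c" using BC(1) x(1) by (auto elim: boxesE)
    obtain m a' b' c' where C: "C = hbox m (m - int s) a' b' c'" using BC(2) x(2) by (auto elim: boxesE)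
    obtain u v w where uvw: "x = enc (u, v, w)" using x(1) unfolding B by (auto elim: hbox_cases)
    \<comment> \<open>Every point of a box is a centre of it, so two boxes with a common point are
      compared by their levels alone.\<close>
    have B': "B = hbox n (n - int s) u v w" using hbox_eqI[of u v w] x(1) unfolding B uvw by blast
    have C': "C = hbox m (m - int s) u v w" using hbox_eqI[of u v w] x(2) unfolding C uvw by blast
    show ?thesis
    proof (cases "n \<le> m")
      case True
      then have "B \<inter> C = C" using hbox_mono[of n m "n - int s" "m - int s"] unfolding B' C' by auto
      then show ?thesis using BC by simp
    next
      case False
      then have "B \<inter> C = B" using hbox_mono[of m n "m - int s" "n - int s"] unfolding B' C' by auto
      then show ?thesis using BC by simp
    qed
  qed
qed

text \<open>This provides the countable cover by sets of finite measure that uniqueness and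
  regularity of measures require.\<close>

lemma level_0_boxes:
  "\<Union>{hbox 0 (- int s) a b c | a b c. True} = carrier heis"
  "{hbox 0 (- int s) a b c | a b c. True} \<subseteq> boxes s"
proof -
  show "\<Union>{hbox 0 (- int s) a b c | a b c. True} = carrier heis"
  proof
    show "carrier heis \<subseteq> \<Union>{hbox 0 (- int s) a b c | a b c. True}"
    proof
      fix x assume "x \<in> carrier heis"
      then obtain a b c where "x = enc (a, b, c)" by (rule heis_cases)
      then have "x \<in> hbox 0 (- int s) a b c" by simp
      then show "x \<in> \<Union>{hbox 0 (- int s) a b c | a b c. True}" by blast
    qed
  qed (use hbox_carrier in blast)
  show "{hbox 0 (- int s) a b c | a b c. True} \<subseteq> boxes s"
    using hbox_in_boxes[of 0 s] by auto
qed

subsection \<open>Haar measure\<close>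

text \<open>Binary expansion identifies, up to a null set, the nonnegative reals with the Laurent series, and
  balls with dyadic intervals; so Lebesgue measure on the octant is pushed forward to a measure in
  which the volume of a box does not depend on its centre.\<close>

definition octant :: "(real \<times> real \<times> real) set" where "octant = {0..} \<times> {0..} \<times> {0..}"

definition from_reals :: "real \<times> real \<times> real \<Rightarrow> nat \<Rightarrow> int \<Rightarrow> int" where
  "from_reals = (\<lambda>(x, y, z). enc (digits x, digits y, digits z))"

definition heis_measure :: "(nat \<Rightarrow> int \<Rightarrow> int) measure" where
  "heis_measure = distr (restrict_space lborel octant)
     (sigma (carrier heis) {U. openin heis_top U}) from_reals"

lemma open_Pow: "{U. openin heis_top U} \<subseteq> Pow (carrier heis)"
  by (auto simp: openin_heis_top)

lemma space_heis_measure: "space heis_measure = carrier heis"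
  by (simp add: heis_measure_def space_measure_of[OF open_Pow])

lemma sets_heis_measure: "sets heis_measure = sigma_sets (carrier heis) {U. openin heis_top U}"
  by (simp add: heis_measure_def sets_measure_of[OF open_Pow])

lemma sets_heis_measure_boxes: "sets heis_measure = sigma_sets (carrier heis) (boxes s)"
  by (simp add: sets_heis_measure sigma_sets_boxes)

lemma open_sets_heis: "openin heis_top U \<Longrightarrow> U \<in> sets heis_measure"
  by (simp add: sets_heis_measure)

definition digit_interval :: "int \<Rightarrow> bit fls \<Rightarrow> real set" where
  "digit_interval n a = {x. x \<ge> 0 \<and> a - digits x \<in> fball n}"

lemma digit_interval:
  "digit_interval n a \<in> sets lborel" "emeasure lborel (digit_interval n a) = ennreal (1 / 2 powi n)"
proof -
  obtain k where k: "digit_interval n a = {of_int k / 2 powi n ..< (of_int k + 1) / 2 powi n}"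
    using digits_interval unfolding digit_interval_def by blast
  show "digit_interval n a \<in> sets lborel" unfolding k by simp
  have "of_int k / 2 powi n \<le> (of_int k + 1) / (2 powi n :: real)"
    by (simp add: divide_right_mono)
  moreover have "(of_int k + 1) / 2 powi n - of_int k / (2 powi n :: real) = 1 / 2 powi n"
    by (simp add: diff_divide_distrib[symmetric])
  ultimately show "emeasure lborel (digit_interval n a) = ennreal (1 / 2 powi n)"
    unfolding k by simp
qed

lemma from_reals_hbox:
  "from_reals -` hbox n m a b c \<inter> octant = digit_interval n a \<times> digit_interval n b \<times> digit_interval m c"
  by (auto simp: from_reals_def octant_def digit_interval_def)

lemma octant_sets: "octant \<in> sets lborel"
  unfolding octant_def by (simp add: closed_Times)

lemma digit_box_sets:
  "digit_interval n a \<times> digit_interval n b \<times> digit_interval m c \<in> sets (lborel :: (real \<times> real \<times> real) measure)"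
  unfolding lborel_prod[symmetric] by (intro pair_measureI digit_interval)

lemma from_reals_measurable:
  "from_reals \<in> measurable (restrict_space lborel octant) (sigma (carrier heis) {U. openin heis_top U})"
proof (rule measurable_sigma_sets)
  show "sets (sigma (carrier heis) {U. openin heis_top U}) = sigma_sets (carrier heis) (boxes 0)"
    by (simp add: sets_measure_of[OF open_Pow] sigma_sets_boxes)
  show "boxes 0 \<subseteq> Pow (carrier heis)" by (rule boxes_carrier)
  show "from_reals \<in> space (restrict_space lborel octant) \<rightarrow> carrier heis"
    by (auto simp: from_reals_def)
  fix B assume "B \<in> boxes 0"
  then show "from_reals -` B \<inter> space (restrict_space lborel octant) \<in> sets (restrict_space lborel octant)"
  proof (cases rule: boxesE)
    case (2 n a b c)
    have "from_reals -` B \<inter> octant \<in> sets lborel"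
      unfolding 2 from_reals_hbox by (rule digit_box_sets)
    then show ?thesis
      using octant_sets by (auto simp: space_restrict_space sets_restrict_space_iff)
  qed simp
qed

lemma emeasure_hbox:
  "emeasure heis_measure (hbox n m a b c) = ennreal (1 / 2 powi n) * (ennreal (1 / 2 powi n) * ennreal (1 / 2 powi m))"
proof -
  have "emeasure heis_measure (hbox n m a b c)
      = emeasure (restrict_space lborel octant) (from_reals -` hbox n m a b c \<inter> space (restrict_space lborel octant))"
    unfolding heis_measure_def
    using from_reals_measurable openin_hbox open_Pow
    by (intro emeasure_distr) (auto simp: sets_measure_of)
  also have "from_reals -` hbox n m a b c \<inter> space (restrict_space lborel octant)
      = digit_interval n a \<times> digit_interval n b \<times> digit_interval m c"
    by (simp add: space_restrict_space from_reals_hbox)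
  also have "emeasure (restrict_space lborel octant) \<dots> = emeasure lborel \<dots>"
    using octant_sets
    by (intro emeasure_restrict_space) (auto simp: octant_def digit_interval_def)
  also have "\<dots> = emeasure lborel (digit_interval n a) *
      (emeasure lborel (digit_interval n b) * emeasure lborel (digit_interval m c))"
  proof -
    have "digit_interval n b \<times> digit_interval m c \<in> sets (lborel :: (real \<times> real) measure)"
      unfolding lborel_prod[symmetric] by (intro pair_measureI digit_interval)
    then have "emeasure (lborel :: (real \<times> real \<times> real) measure) (digit_interval n a \<times> digit_interval n b \<times> digit_interval m c)
        = emeasure lborel (digit_interval n a) * emeasure (lborel :: (real \<times> real) measure) (digit_interval n b \<times> digit_interval m c)"
      unfolding lborel_prod[symmetric, where ?'a = real and ?'b = "real \<times> real"]
      by (intro lborel.emeasure_pair_measure_Times digit_interval)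
    also have "emeasure (lborel :: (real \<times> real) measure) (digit_interval n b \<times> digit_interval m c)
        = emeasure lborel (digit_interval n b) * emeasure lborel (digit_interval m c)"
      unfolding lborel_prod[symmetric, where ?'a = real and ?'b = real]
      by (intro lborel.emeasure_pair_measure_Times digit_interval)
    finally show ?thesis .
  qed
  finally show ?thesis by (simp add: digit_interval)
qed

lemma emeasure_hbox_finite: "emeasure heis_measure (hbox n m a b c) < \<infinity>"
  by (simp add: emeasure_hbox flip: ennreal_mult)

lemma emeasure_hbox_pos: "emeasure heis_measure (hbox n m a b c) \<noteq> 0"
  by (simp add: emeasure_hbox)

text \<open>Uniqueness of measures on the intersection-stable generator \<open>boxes s\<close>:
  \<open>T\<close> maps boxes to boxes of the same level, whose volume does not depend on the
  centre. As \<open>S\<close> is the inverse of \<open>T\<close>, preimages under \<open>S\<close>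
  are images under \<open>T\<close>, which also gives measurability.\<close>

lemma translation_invariant:
  assumes T: "\<And>x. x \<in> carrier heis \<Longrightarrow> T x \<in> carrier heis" and S: "\<And>x. x \<in> carrier heis \<Longrightarrow> S x \<in> carrier heis"
    and ST: "\<And>x. x \<in> carrier heis \<Longrightarrow> S (T x) = x" and TS: "\<And>x. x \<in> carrier heis \<Longrightarrow> T (S x) = x"
    and hbox: "\<And>n a b c. \<exists>a' b' c'. T ` hbox n (n - int s) a b c = hbox n (n - int s) a' b' c'"
    and E: "E \<in> sets heis_measure"
  shows "emeasure heis_measure (T ` E) = emeasure heis_measure E"
proof -
  have vim: "S -` F \<inter> space heis_measure = T ` F" if "F \<subseteq> carrier heis" for F
  proof -
    have "x \<in> T ` F" if "x \<in> carrier heis" "S x \<in> F" for x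
      using TS[OF that(1)] that(2) by (metis image_eqI)
    then show ?thesis using that T ST by (auto simp: space_heis_measure subset_eq)
  qed
  have boxes_sub: "boxes s \<subseteq> Pow (carrier heis)" by (rule boxes_carrier)
  have meas: "S \<in> measurable heis_measure heis_measure"
  proof (rule measurable_sigma_sets[OF sets_heis_measure_boxes boxes_sub])
    show "S \<in> space heis_measure \<rightarrow> carrier heis" using S by (auto simp: space_heis_measure)
    fix B assume "B \<in> boxes s"
    then show "S -` B \<inter> space heis_measure \<in> sets heis_measure"
    proof (cases rule: boxesE)
      case (2 n a b c)
      obtain a' b' c' where "T ` hbox n (n - int s) a b c = hbox n (n - int s) a' b' c'" using hbox by blast
      then show ?thesis unfolding 2 vim[OF hbox_carrier] by (simp add: open_sets_heis openin_hbox)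
    qed simp
  qed
  have "heis_measure = distr heis_measure heis_measure S"
  proof (rule measure_eqI_generator_eq_countable[OF Int_stable_boxes boxes_sub])
    fix B assume B: "B \<in> boxes s"
    then have Bs: "B \<in> sets heis_measure" by (auto simp: sets_heis_measure_boxes[of s])
    have BC: "B \<subseteq> carrier heis" using B boxes_sub by blast
    show "emeasure heis_measure B = emeasure (distr heis_measure heis_measure S) B"
      unfolding emeasure_distr[OF meas Bs] vim[OF BC]
      using B
    proof (cases rule: boxesE)
      case (2 n a b c)
      obtain a' b' c' where "T ` hbox n (n - int s) a b c = hbox n (n - int s) a' b' c'" using hbox by blast
      then show "emeasure heis_measure B = emeasure heis_measure (T ` B)" unfolding 2 by (simp add: emeasure_hbox)
    qed simp
  next
    show "{hbox 0 (- int s) a b c | a b c. True} \<subseteq> boxes s" by (rule level_0_boxes)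
    then show "countable {hbox 0 (- int s) a b c | a b c. True}" using countable_boxes by (rule countable_subset)
    show "\<Union>{hbox 0 (- int s) a b c | a b c. True} = carrier heis" by (rule level_0_boxes)
    show "emeasure heis_measure B \<noteq> \<infinity>" if "B \<in> {hbox 0 (- int s) a b c | a b c. True}" for B
      using that emeasure_hbox_finite by (auto simp: less_top)
  qed (simp_all add: sets_heis_measure_boxes[of s])
  then have "emeasure heis_measure E = emeasure (distr heis_measure heis_measure S) E" by simp
  also have "\<dots> = emeasure heis_measure (T ` E)"
    using emeasure_distr[OF meas E] vim[of E] sets.sets_into_space[OF E] by (simp add: space_heis_measure)
  finally show ?thesis by simp
qed

lemma left_invariant:
  assumes g: "g \<in> carrier heis" and E: "E \<in> sets heis_measure"
  shows "emeasure heis_measure (g <#\<^bsub>heis\<^esub> E) = emeasure heis_measure E"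
proof -
  obtain a b c where g': "g = enc (a, b, c)" using g by (rule heis_cases)
  obtain s where s: "a \<in> fball (- int s)" using fball_ex by blast
  have "emeasure heis_measure ((\<lambda>x. g \<otimes>\<^bsub>heis\<^esub> x) ` E) = emeasure heis_measure E"
  proof (rule translation_invariant[where S = "\<lambda>x. inv\<^bsub>heis\<^esub> g \<otimes>\<^bsub>heis\<^esub> x"])
    fix n u v w
    have *: "enc (a + u', b + v', c + w' + a * v') \<in> hbox n (n - int s) (a + u) (b + v) (c + w + a * v)
        \<longleftrightarrow> enc (u', v', w') \<in> hbox n (n - int s) u v w" for u' v' w'
    proof -
      have "(c + w + a * v) - (c + w' + a * v') \<in> fball (n - int s) \<longleftrightarrow> w - w' \<in> fball (n - int s)"
        if "v - v' \<in> fball n"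
      proof -
        have "a * (v - v') \<in> fball (n - int s)" using s that by (rule fball_mult') simp
        moreover have "(c + w + a * v) - (c + w' + a * v') = (w - w') + a * (v - v')"
          by (simp add: algebra_simps)
        ultimately show ?thesis using fball_add_iff by metis
      qed
      then show ?thesis unfolding enc_hbox add_diff_cancel_left by blast
    qed
    have "(\<lambda>x. g \<otimes>\<^bsub>heis\<^esub> x) ` hbox n (n - int s) u v w = hbox n (n - int s) (a + u) (b + v) (c + w + a * v)"
    proof
      show "(\<lambda>x. g \<otimes>\<^bsub>heis\<^esub> x) ` hbox n (n - int s) u v w \<subseteq> hbox n (n - int s) (a + u) (b + v) (c + w + a * v)"
      proof
        fix y assume "y \<in> (\<lambda>x. g \<otimes>\<^bsub>heis\<^esub> x) ` hbox n (n - int s) u v w"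
        then obtain u' v' w' where "y = g \<otimes>\<^bsub>heis\<^esub> enc (u', v', w')" "enc (u', v', w') \<in> hbox n (n - int s) u v w"
          by (auto elim!: hbox_cases)
        then show "y \<in> hbox n (n - int s) (a + u) (b + v) (c + w + a * v)"
          using *[of u' v' w'] by (simp add: g')
      qed
      show "hbox n (n - int s) (a + u) (b + v) (c + w + a * v) \<subseteq> (\<lambda>x. g \<otimes>\<^bsub>heis\<^esub> x) ` hbox n (n - int s) u v w"
      proof
        fix y assume y: "y \<in> hbox n (n - int s) (a + u) (b + v) (c + w + a * v)"
        then obtain p q r where y': "y = enc (p, q, r)" by (auto elim: hbox_cases)
        \<comment> \<open>Repeated terms cancel in characteristic 2; this form exhibits
          \<open>y\<close> as \<open>g\<close> times an element of the original box.\<close>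
        have eq: "y = enc (a + (a + p), b + (b + q), c + (c + r + a * (b + q)) + a * (b + q))"
          by (simp add: y' ac_simps)
        have "enc (a + p, b + q, c + r + a * (b + q)) \<in> hbox n (n - int s) u v w"
          using y unfolding eq * .
        moreover have "y = g \<otimes>\<^bsub>heis\<^esub> enc (a + p, b + q, c + r + a * (b + q))"
          unfolding eq g' by simp
        ultimately show "y \<in> (\<lambda>x. g \<otimes>\<^bsub>heis\<^esub> x) ` hbox n (n - int s) u v w" by blast
      qed
    qed
    then show "\<exists>a' b' c'. (\<lambda>x. g \<otimes>\<^bsub>heis\<^esub> x) ` hbox n (n - int s) u v w = hbox n (n - int s) a' b' c'" by blast
  qed (use g E heis.inv_mult_cancel in auto)
  moreover have "g <#\<^bsub>heis\<^esub> E = (\<lambda>x. g \<otimes>\<^bsub>heis\<^esub> x) ` E" by (auto simp: l_coset_def)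
  ultimately show ?thesis by simp
qed

lemma right_invariant:
  assumes g: "g \<in> carrier heis" and E: "E \<in> sets heis_measure"
  shows "emeasure heis_measure (E #>\<^bsub>heis\<^esub> g) = emeasure heis_measure E"
proof -
  obtain a b c where g': "g = enc (a, b, c)" using g by (rule heis_cases)
  obtain s where s: "b \<in> fball (- int s)" using fball_ex by blast
  have "emeasure heis_measure ((\<lambda>x. x \<otimes>\<^bsub>heis\<^esub> g) ` E) = emeasure heis_measure E"
  proof (rule translation_invariant[where S = "\<lambda>x. x \<otimes>\<^bsub>heis\<^esub> inv\<^bsub>heis\<^esub> g"])
    fix n u v w
    have *: "enc (u' + a, v' + b, w' + c + u' * b) \<in> hbox n (n - int s) (u + a) (v + b) (w + c + u * b)
        \<longleftrightarrow> enc (u', v', w') \<in> hbox n (n - int s) u v w" for u' v' w'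
    proof -
      have "(w + c + u * b) - (w' + c + u' * b) \<in> fball (n - int s) \<longleftrightarrow> w - w' \<in> fball (n - int s)"
        if "u - u' \<in> fball n"
      proof -
        have "b * (u - u') \<in> fball (n - int s)" using s that by (rule fball_mult') simp
        moreover have "(w + c + u * b) - (w' + c + u' * b) = (w - w') + b * (u - u')"
          by (simp add: algebra_simps)
        ultimately show ?thesis using fball_add_iff by metis
      qed
      then show ?thesis unfolding enc_hbox add_diff_cancel_right by blast
    qed
    have "(\<lambda>x. x \<otimes>\<^bsub>heis\<^esub> g) ` hbox n (n - int s) u v w = hbox n (n - int s) (u + a) (v + b) (w + c + u * b)"
    proof
      show "(\<lambda>x. x \<otimes>\<^bsub>heis\<^esub> g) ` hbox n (n - int s) u v w \<subseteq> hbox n (n - int s) (u + a) (v + b) (w + c + u * b)"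
      proof
        fix y assume "y \<in> (\<lambda>x. x \<otimes>\<^bsub>heis\<^esub> g) ` hbox n (n - int s) u v w"
        then obtain u' v' w' where "y = enc (u', v', w') \<otimes>\<^bsub>heis\<^esub> g" "enc (u', v', w') \<in> hbox n (n - int s) u v w"
          by (auto elim!: hbox_cases)
        then show "y \<in> hbox n (n - int s) (u + a) (v + b) (w + c + u * b)"
          using *[of u' v' w'] by (simp add: g')
      qed
      show "hbox n (n - int s) (u + a) (v + b) (w + c + u * b) \<subseteq> (\<lambda>x. x \<otimes>\<^bsub>heis\<^esub> g) ` hbox n (n - int s) u v w"
      proof
        fix y assume y: "y \<in> hbox n (n - int s) (u + a) (v + b) (w + c + u * b)"
        then obtain p q r where y': "y = enc (p, q, r)" by (auto elim: hbox_cases)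
        have eq: "y = enc ((p + a) + a, (q + b) + b, (r + c + (p + a) * b) + c + (p + a) * b)"
          by (simp add: y' ac_simps)
        have "enc (p + a, q + b, r + c + (p + a) * b) \<in> hbox n (n - int s) u v w"
          using y unfolding eq * .
        moreover have "y = enc (p + a, q + b, r + c + (p + a) * b) \<otimes>\<^bsub>heis\<^esub> g"
          unfolding eq g' by simp
        ultimately show "y \<in> (\<lambda>x. x \<otimes>\<^bsub>heis\<^esub> g) ` hbox n (n - int s) u v w" by blast
      qed
    qed
    then show "\<exists>a' b' c'. (\<lambda>x. x \<otimes>\<^bsub>heis\<^esub> g) ` hbox n (n - int s) u v w = hbox n (n - int s) a' b' c'" by blast
  qed (use g E in \<open>auto simp: heis.m_assoc\<close>)
  moreover have "E #>\<^bsub>heis\<^esub> g = (\<lambda>x. x \<otimes>\<^bsub>heis\<^esub> g) ` E" by (auto simp: r_coset_def)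
  ultimately show ?thesis by simp
qed

lemma haar_heis_measure: "haar_measure heis heis_top heis_measure"
  unfolding haar_measure_def
proof (intro conjI ballI allI impI)
  show "space heis_measure = carrier heis" by (rule space_heis_measure)
  show "sets heis_measure = sigma_sets (carrier heis) {U. openin heis_top U}" by (rule sets_heis_measure)
  show "emeasure heis_measure (carrier heis) \<noteq> 0"
  proof
    assume 0: "emeasure heis_measure (carrier heis) = 0"
    have "emeasure heis_measure (hbox 0 0 0 0 0) \<le> emeasure heis_measure (carrier heis)"
      using hbox_carrier sets.top[of heis_measure] by (intro emeasure_mono) (auto simp: space_heis_measure)
    then show False using 0 emeasure_hbox_pos by simp
  qed
  show "emeasure heis_measure (g <#\<^bsub>heis\<^esub> E) = emeasure heis_measure E"
    if "g \<in> carrier heis" "E \<in> sets heis_measure" for g E using that by (rule left_invariant)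
  show "emeasure heis_measure C < \<infinity>" if C: "compactin heis_top C" for C
  proof -
    define \<U> where "\<U> = {hbox 0 (- int 0) a b c | a b c. True}"
    have "\<exists>\<F>. finite \<F> \<and> \<F> \<subseteq> \<U> \<and> C \<subseteq> \<Union>\<F>"
    proof (rule compactinD[OF C])
      show "openin heis_top U" if "U \<in> \<U>" for U using that openin_hbox by (auto simp: \<U>_def)
      show "C \<subseteq> \<Union>\<U>" unfolding \<U>_def level_0_boxes(1) by (rule heis.compactin_carrier[OF C])
    qed
    then obtain \<F> where F: "finite \<F>" "\<F> \<subseteq> \<U>" "C \<subseteq> \<Union>\<F>" by blast
    have F_box: "B \<in> sets heis_measure \<and> emeasure heis_measure B < \<infinity>" if "B \<in> \<F>" for B
      using that F(2) open_sets_heis[OF openin_hbox] emeasure_hbox_finite by (auto simp: \<U>_def)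
    then have Fs: "\<F> \<subseteq> sets heis_measure" by blast
    have "emeasure heis_measure C \<le> emeasure heis_measure (\<Union>B\<in>\<F>. B)"
      using F(1,3) Fs by (intro emeasure_mono) (auto intro!: sets.finite_Union)
    also have "\<dots> \<le> (\<Sum>B\<in>\<F>. emeasure heis_measure B)"
      using F(1) Fs by (intro emeasure_subadditive_finite) auto
    also have "\<dots> < \<infinity>"
      using F(1) F_box by (simp add: less_top[symmetric])
    finally show ?thesis .
  qed
  show "emeasure heis_measure E = (INF U\<in>{U. openin heis_top U \<and> E \<subseteq> U}. emeasure heis_measure U)"
    if "E \<in> sets heis_measure" for E
  proof (rule outer_regular_clopen[where B = "boxes 0" and C = "{hbox 0 (- int 0) a b c | a b c. True}"])
    show "space heis_measure = topspace heis_top" by (simp add: space_heis_measure heis.topspace_X)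
    show "sets heis_measure = sigma_sets (topspace heis_top) (boxes 0)"
      by (simp add: heis.topspace_X sets_heis_measure_boxes)
    show "openin heis_top B \<and> openin heis_top (topspace heis_top - B)" if "B \<in> boxes 0" for B
      using that by (cases rule: boxesE) (auto simp: openin_hbox heis.topspace_X openin_hbox_complement
          openin_topspace[of heis_top, unfolded heis.topspace_X])
    show "countable {hbox 0 (- int 0) a b c | a b c. True}"
      using level_0_boxes(2) countable_boxes by (rule countable_subset)
    show "\<Union>{hbox 0 (- int 0) a b c | a b c. True} = topspace heis_top"
      unfolding heis.topspace_X by (rule level_0_boxes)
    show "openin heis_top D \<and> emeasure heis_measure D < \<infinity>" if "D \<in> {hbox 0 (- int 0) a b c | a b c. True}" for D
      using that openin_hbox emeasure_hbox_finite by blast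
  qed (use that open_sets_heis in auto)
  show "emeasure heis_measure U = (SUP C\<in>{C. compactin heis_top C \<and> C \<subseteq> U}. emeasure heis_measure C)"
    if U: "openin heis_top U" for U
  proof (rule inner_regular_open_countable[OF U open_sets_heis])
    show "countable {B \<in> boxes 0. B \<subseteq> U \<and> compactin heis_top B}"
      by (rule countable_subset[OF _ countable_boxes[of 0]]) blast
    show "\<Union>{B \<in> boxes 0. B \<subseteq> U \<and> compactin heis_top B} = U"
      using open_eq_Union_boxes(2)[OF U, of 0] by simp
    show "openin heis_top B \<and> compactin heis_top B" if "B \<in> {B \<in> boxes 0. B \<subseteq> U \<and> compactin heis_top B}" for B
      using that openin_hbox by (auto elim: boxesE)
  qed
qed

definition heis_center :: "(nat \<Rightarrow> int \<Rightarrow> int) set" where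
  "heis_center = range (\<lambda>c. enc (0, 0, c))"

interpretation heis: heisenberg_type heis heis_top hball heis_measure heis_center
proof unfold_locales
  show "haar_measure heis heis_top heis_measure" by (rule haar_heis_measure)
  show "emeasure heis_measure (E #>\<^bsub>heis\<^esub> g) = emeasure heis_measure E"
    if "g \<in> carrier heis" "E \<in> sets heis_measure" for g E using that by (rule right_invariant)
  show "emeasure heis_measure (hball n) \<noteq> 0" for n
  proof -
    have "hball n = hbox (int n) (int n) 0 0 0"
      unfolding hball_def hbox_def by auto
    then show ?thesis using emeasure_hbox_pos by simp
  qed
  show "heis_center \<subseteq> carrier heis" by (auto simp: heis_center_def)
  show "z \<otimes>\<^bsub>heis\<^esub> g = g \<otimes>\<^bsub>heis\<^esub> z" if "z \<in> heis_center" "g \<in> carrier heis" for z g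
    using that by (auto simp: heis_center_def elim!: heis_cases)
  show "z \<otimes>\<^bsub>heis\<^esub> z = \<one>\<^bsub>heis\<^esub>" if "z \<in> heis_center" for z
    using that by (auto simp: heis_center_def heis_one)
  show "\<exists>z\<in>heis_center. g \<otimes>\<^bsub>heis\<^esub> h = h \<otimes>\<^bsub>heis\<^esub> g \<otimes>\<^bsub>heis\<^esub> z"
    if gh: "g \<in> carrier heis" "h \<in> carrier heis" for g h
  proof -
    obtain a b c where g: "g = enc (a, b, c)" using gh(1) by (rule heis_cases)
    obtain a' b' c' where h: "h = enc (a', b', c')" using gh(2) by (rule heis_cases)
    show ?thesis
      by (rule bexI[of _ "enc (0, 0, a * b' + a' * b)"]) (simp_all add: g h heis_center_def ac_simps)
  qed
  show "g \<otimes>\<^bsub>heis\<^esub> g \<in> heis_center" if "g \<in> carrier heis" for g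
    using that by (auto simp: heis_center_def elim!: heis_cases)
  show "\<exists>S. finite S \<and> S \<subseteq> carrier heis \<and>
      (\<forall>g\<in>carrier heis. (\<exists>k\<in>hball n. g \<otimes>\<^bsub>heis\<^esub> k = k \<otimes>\<^bsub>heis\<^esub> g \<otimes>\<^bsub>heis\<^esub> z) \<or>
        (\<exists>s\<in>S. \<exists>y\<in>heis_center. \<exists>k\<in>hball n. g = s \<otimes>\<^bsub>heis\<^esub> k \<otimes>\<^bsub>heis\<^esub> y))"
    if z: "z \<in> heis_center" "z \<noteq> \<one>\<^bsub>heis\<^esub>" for z n
  proof -
    obtain c0 where c0: "z = enc (0, 0, c0)" "c0 \<noteq> 0" using z by (auto simp: heis_center_def heis_one)
    \<comment> \<open>Outside \<open>fball r\<close> the order of \<open>a\<close> is at most that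
      of \<open>c0\<close> minus \<open>n\<close>, which puts c0 / a into \<open>fball n\<close>;
      the summand 1 accounts for the strict inequality.\<close>
    define r where "r = fls_subdegree c0 - int n + 1"
    obtain R where R: "finite R" "\<And>a. a \<in> fball r \<Longrightarrow> \<exists>r\<in>R. a - r \<in> fball (int n)"
      using fball_finite_cover[of r "int n"] by metis
    define S where "S = (\<lambda>(a, b). enc (a, b, 0)) ` (R \<times> R)"
    have quot: "c0 / a \<in> fball (int n) \<and> a \<noteq> 0" if "a \<notin> fball r" for a
    proof -
      have a: "a \<noteq> 0" "fls_subdegree a < r" using that by (auto simp: fball_subdegree)
      have "fls_subdegree c0 = fls_subdegree ((c0 / a) * a)" using a by simp
      also have "\<dots> = fls_subdegree (c0 / a) + fls_subdegree a"
        using a c0(2) by (intro fls_subdegree_mult) auto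
      finally show ?thesis using a by (simp add: fball_subdegree r_def)
    qed
    have key: "(\<exists>k\<in>hball n. g \<otimes>\<^bsub>heis\<^esub> k = k \<otimes>\<^bsub>heis\<^esub> g \<otimes>\<^bsub>heis\<^esub> z) \<or>
        (\<exists>s\<in>S. \<exists>y\<in>heis_center. \<exists>k\<in>hball n. g = s \<otimes>\<^bsub>heis\<^esub> k \<otimes>\<^bsub>heis\<^esub> y)"
      if gc: "g \<in> carrier heis" for g
    proof -
      obtain a b c where g: "g = enc (a, b, c)" using gc by (rule heis_cases)
      consider "a \<notin> fball r" | "b \<notin> fball r" | "a \<in> fball r" "b \<in> fball r" by blast
      then show ?thesis
      proof cases
        case 1
        \<comment> \<open>The commutator of \<open>g\<close> with (0, y, 0) has corner entry a y, so
          y = c0 / a produces \<open>z\<close>.\<close>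
        have "g \<otimes>\<^bsub>heis\<^esub> enc (0, c0 / a, 0) = enc (0, c0 / a, 0) \<otimes>\<^bsub>heis\<^esub> g \<otimes>\<^bsub>heis\<^esub> z"
          using quot[OF 1] by (simp add: g c0(1) ac_simps)
        moreover have "enc (0, c0 / a, 0) \<in> hball n" using quot[OF 1] by simp
        ultimately show ?thesis by (intro disjI1 bexI)
      next
        case 2
        have "g \<otimes>\<^bsub>heis\<^esub> enc (c0 / b, 0, 0) = enc (c0 / b, 0, 0) \<otimes>\<^bsub>heis\<^esub> g \<otimes>\<^bsub>heis\<^esub> z"
          using quot[OF 2] by (simp add: g c0(1) ac_simps)
        moreover have "enc (c0 / b, 0, 0) \<in> hball n" using quot[OF 2] by simp
        ultimately show ?thesis by (intro disjI1 bexI)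
      next
        case 3
        obtain a' where a': "a' \<in> R" "a' + a \<in> fball (int n)"
          using R(2)[OF 3(1)] by (auto simp: bit_fls_diff add.commute)
        obtain b' where b': "b' \<in> R" "b' + b \<in> fball (int n)"
          using R(2)[OF 3(2)] by (auto simp: bit_fls_diff add.commute)
        \<comment> \<open>The small differences go into \<open>hball n\<close>, and whatever corner
          entry results is corrected by a central factor.\<close>
        have "g = enc (a', b', 0) \<otimes>\<^bsub>heis\<^esub> enc (a' + a, b' + b, 0) \<otimes>\<^bsub>heis\<^esub> enc (0, 0, c + a' * (b' + b))"
          by (simp add: g ac_simps)
        moreover have "enc (a', b', 0) \<in> S" using a'(1) b'(1) by (auto simp: S_def)
        moreover have "enc (a' + a, b' + b, 0) \<in> hball n" using a'(2) b'(2) by simp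
        moreover have "enc (0, 0, c + a' * (b' + b)) \<in> heis_center" by (simp add: heis_center_def)
        ultimately show ?thesis by (intro disjI2 bexI)
      qed
    qed
    have "finite S" "S \<subseteq> carrier heis" using R(1) by (auto simp: S_def)
    then show ?thesis using key by (intro exI[of _ S] conjI ballI)
  qed
qed

subsection \<open>The contraction\<close>

text \<open>For a homomorphism, translation reduces continuity to continuity at the
  identity.\<close>

lemma (in td_group) continuous_hom:
  assumes f: "f \<in> hom G G" and K: "\<And>n. \<exists>m. \<forall>k\<in>K m. f k \<in> K n"
  shows "continuous_map X X f"
  unfolding continuous_map_def topspace_X
proof (intro conjI allI impI)
  show "f \<in> carrier G \<rightarrow> carrier G" using f by (simp add: hom_def)
  fix U assume U: "openin X U"
  show "openin X {x \<in> carrier G. f x \<in> U}"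
    unfolding openin_iff
  proof (intro conjI ballI)
    fix x assume "x \<in> {x \<in> carrier G. f x \<in> U}"
    then have x: "x \<in> carrier G" "f x \<in> U" by auto
    then obtain n where n: "\<And>k. k \<in> K n \<Longrightarrow> f x \<otimes> k \<in> U" using U unfolding openin_iff by blast
    obtain m where m: "\<And>k. k \<in> K m \<Longrightarrow> f k \<in> K n" using K by blast
    have "x \<otimes> k \<in> {x \<in> carrier G. f x \<in> U}" if k: "k \<in> K m" for k
      using n[OF m[OF k]] x(1) K_carrier[OF k] f by (simp add: hom_def)
    then show "\<exists>m. \<forall>k\<in>K m. x \<otimes> k \<in> {x \<in> carrier G. f x \<in> U}" by blast
  qed auto
qed

text \<open>The corner entry is scaled by u^2, like the product a b' that multiplication adds to it;
  this makes the map an endomorphism.\<close>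

definition dilation :: "bit fls \<Rightarrow> (nat \<Rightarrow> int \<Rightarrow> int) \<Rightarrow> nat \<Rightarrow> int \<Rightarrow> int" where
  "dilation u x = (case dec x of (a, b, c) \<Rightarrow> enc (u * a, u * b, u * u * c))"

lemma dilation_enc [simp]: "dilation u (enc (a, b, c)) = enc (u * a, u * b, u * u * c)"
  by (simp add: dilation_def)

lemma dilation_hom: "dilation u \<in> hom heis heis"
  by (rule homI) (auto elim!: heis_cases simp: algebra_simps)

lemma dilation_continuous: "continuous_map heis_top heis_top (dilation u)"
proof (rule heis.continuous_hom[OF dilation_hom])
  fix n
  obtain s where s: "u \<in> fball (- int s)" using fball_ex by blast
  \<comment> \<open>The corner entry is multiplied by \<open>u\<close> twice and may lose 2 s
    digits.\<close>
  have "dilation u k \<in> hball n" if k: "k \<in> hball (n + s + s)" for k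
  proof -
    obtain a b c where k: "k = enc (a, b, c)" "a \<in> fball (int (n + s + s))" "b \<in> fball (int (n + s + s))"
      "c \<in> fball (int (n + s + s))" using k by (rule hball_cases)
    have "u * a \<in> fball (int n)" "u * b \<in> fball (int n)" "u * (u * c) \<in> fball (int n)"
      using s k(2-4) by (auto intro!: fball_mult'[OF s] fball_mult[OF s k(4)])
    then show ?thesis by (simp add: k(1) mult.assoc)
  qed
  then show "\<exists>m. \<forall>k\<in>hball m. dilation u k \<in> hball n" by blast
qed

lemma fls_X_X_inv: "fls_X * fls_X_inv = (1 :: bit fls)"
  by (simp add: fls_X_times_conv_shift)

lemma dilation_inverse:
  assumes "u * v = 1" "x \<in> carrier heis"
  shows "dilation u (dilation v x) = x"
proof -
  obtain a b c where x: "x = enc (a, b, c)" using assms(2) by (rule heis_cases)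
  have 1: "u * (v * d) = d" for d using assms(1) by (simp flip: mult.assoc)
  have 2: "u * u * (v * v * c) = u * (v * (u * (v * c)))" by (simp only: ac_simps)
  show ?thesis unfolding x dilation_enc 2 by (simp only: 1)
qed

lemma dilation_carrier: "x \<in> carrier heis \<Longrightarrow> dilation u x \<in> carrier heis"
  using dilation_hom[of u] by (auto simp: hom_def)

lemma dilation_power: "(dilation fls_X ^^ n) (enc (a, b, c)) = enc (fls_X ^ n * a, fls_X ^ n * b, fls_X ^ n * (fls_X ^ n * c))"
  by (induction n) (simp_all add: ac_simps)

lemma lc_contraction_group_heis: "lc_contraction_group heis heis_top (dilation fls_X)"
  unfolding lc_contraction_group_def
proof (intro conjI ballI)
  show "locally_compact_group heis heis_top" by (rule heis.locally_compact_group_X)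
  have inv: "dilation fls_X_inv (dilation fls_X x) = x" "dilation fls_X (dilation fls_X_inv x) = x"
    if "x \<in> carrier heis" for x
    using dilation_inverse[OF _ that] fls_X_X_inv by (simp_all add: mult.commute)
  have "bij_betw (dilation fls_X) (carrier heis) (carrier heis)"
    by (rule bij_betw_byWitness[where f' = "dilation fls_X_inv"]) (use inv dilation_carrier in auto)
  then show "dilation fls_X \<in> iso heis heis" using dilation_hom by (simp add: iso_def)
  have "homeomorphic_maps heis_top heis_top (dilation fls_X) (dilation fls_X_inv)"
    unfolding homeomorphic_maps_def heis.topspace_X using dilation_continuous inv by blast
  then show "homeomorphic_map heis_top heis_top (dilation fls_X)"
    unfolding homeomorphic_map_maps by blast
  fix g assume g: "g \<in> carrier heis"
  then obtain a b c where g': "g = enc (a, b, c)" by (rule heis_cases)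
  show "limitin heis_top (\<lambda>n. (dilation fls_X ^^ n) g) \<one>\<^bsub>heis\<^esub> sequentially"
    unfolding limitin_def heis.topspace_X
  proof (intro conjI allI impI)
    show "\<one>\<^bsub>heis\<^esub> \<in> carrier heis" by simp
    fix U assume U: "openin heis_top U \<and> \<one>\<^bsub>heis\<^esub> \<in> U"
    then obtain m where m: "\<And>k. k \<in> hball m \<Longrightarrow> \<one>\<^bsub>heis\<^esub> \<otimes>\<^bsub>heis\<^esub> k \<in> U"
      unfolding openin_heis_top by blast
    obtain s1 s2 s3 where s: "a \<in> fball (- int s1)" "b \<in> fball (- int s2)" "c \<in> fball (- int s3)"
      using fball_ex by metis
    have "(dilation fls_X ^^ n) g \<in> U" if n: "n \<ge> m + s1 + s2 + s3" for n
    proof -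
      have X: "(fls_X ^ n :: bit fls) \<in> fball (int n)" by (simp add: fball_def)
      have "fls_X ^ n * a \<in> fball (int m)" "fls_X ^ n * b \<in> fball (int m)"
        using n by (auto intro!: fball_mult'[OF X] s)
      moreover have "fls_X ^ n * (fls_X ^ n * c) \<in> fball (int m)"
        by (rule fball_mult'[OF X fball_mult[OF X s(3)]]) (use n in simp)
      ultimately have k: "(dilation fls_X ^^ n) g \<in> hball m" by (simp add: g' dilation_power)
      then show ?thesis using m[OF k] heis.K_carrier[OF k] by simp
    qed
    then show "\<forall>\<^sub>F n in sequentially. (dilation fls_X ^^ n) g \<in> U"
      unfolding eventually_sequentially by blast
  qed
qed

theorem corollary5p16:
  shows "\<exists>(N :: (nat \<Rightarrow> int \<Rightarrow> int) monoid) X \<alpha>.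
           lc_contraction_group N X \<alpha> \<and> \<not> comm_group N \<and> torsion_group N \<and> CCR_group N X"
proof (intro exI conjI)
  show "lc_contraction_group heis heis_top (dilation fls_X)" by (rule lc_contraction_group_heis)
  show "CCR_group heis heis_top" by (rule heis.CCR)
  show "\<not> comm_group heis"
  proof
    assume "comm_group heis"
    then interpret c: comm_group heis .
    \<comment> \<open>The corner entries of these two products are 1 and 0.\<close>
    have "enc (1, 0, 0) \<otimes>\<^bsub>heis\<^esub> enc (0, 1, 0) = enc (0, 1, 0) \<otimes>\<^bsub>heis\<^esub> enc (1, 0, 0)"
      by (rule c.m_comm) simp_all
    then show False by simp
  qed
  show "torsion_group heis"
    unfolding torsion_group_def
  proof
    fix g assume "g \<in> carrier heis"
    then obtain a b c where g: "g = enc (a, b, c)" by (rule heis_cases)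
    \<comment> \<open>The square of \<open>g\<close> is (0, 0, a b), a central element whose own
      square is the identity.\<close>
    have "g [^]\<^bsub>heis\<^esub> (4::nat) = \<one>\<^bsub>heis\<^esub>"
      by (simp add: g numeral_eq_Suc heis_one ac_simps)
    then show "\<exists>n::nat. n > 0 \<and> g [^]\<^bsub>heis\<^esub> n = \<one>\<^bsub>heis\<^esub>" by (intro exI[of _ 4]) simp
  qed
qed

end
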